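(* Let $\gamma<12$ and $\mu=\mu_r^0(\gamma)$. Then $$\sigma_{\rm ess}(\mathcal{A}_\mu)=\begin{cases}[E_\mu^{(1)},E_\mu^{(2)}]\cup[0,18], & \gamma<\gamma_0,\\ [E_\mu^{(1)},18], & \gamma_0\le\gamma<6,\\ [0,18], & 6\le\gamma<12.\end{cases}$$
   Context: $\mathbb{T}^3=(-\pi,\pi]^3$ with normalized Haar measure; $\mathcal{H}=L_2(\mathbb{T}^3)\oplus L_2^{\rm s}((\mathbb{T}^3)^2)$. $\varepsilon(k)=\sum_{i=1}^3(1-\cos k_i)$, $w_1(k)=\varepsilon(k)+\gamma$, $w_2(k,p)=\varepsilon(k)+\varepsilon(\tfrac12(k+p))+\varepsilon(p)$ (so $\min w_2=0$, $\max w_2=18$). $\mathcal{A}_\mu=\begin{pmatrix}A_{11}&\mu A_{12}\\ \mu A_{12}^*&A_{22}\end{pmatrix}$ with $(A_{11}f_1)(k)=w_1(k)f_1(k)$, $(A_{12}f_2)(k)=\int f_2(k,s)ds$, $(A_{12}^*f_1)(k,p)=\tfrac12(f_1(k)+f_1(p))$, $(A_{22}f_2)(k,p)=w_2(k,p)f_2(k,p)$. $I(k;z)=\int_{\mathbb{T}^3}\frac{dt}{w_2(k,t)-z}$ (for $z=0$ or $z=18$ this integral is finite for every $k$), $\Delta_\mu(k;z)=w_1(k)-z-\frac{\mu^2}{2}I(k;z)$, $\bar 0=(0,0,0)$. The generalized Friedrichs model $\mathcal{A}_\mu(k)$ on $\mathbb{C}\oplus L_2(\mathbb{T}^3)$ is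 $\mathcal{A}_\mu(k)(f_0,f_1)=(w_1(k)f_0+\tfrac{\mu}{\sqrt2}\int f_1,\ \tfrac{\mu}{\sqrt2}f_0+w_2(k,\cdot)f_1)$; $\Lambda_\mu=\bigcup_k\sigma_{\rm disc}(\mathcal{A}_\mu(k))$, where $\sigma_{\rm disc}(\mathcal{A}_\mu(k))=\{z\notin[\min_pw_2(k,p),\max_pw_2(k,p)]:\Delta_\mu(k;z)=0\}$. $\mu_r^0(\gamma)=\sqrt{24-2\gamma}\,(I(\bar0;0))^{-1/2}$ for $\gamma<12$. $k_0\in\mathbb{T}^3$ is a point with $\Delta_\mu(k_0;0)=\max_k\Delta_\mu(k;0)$, and $\gamma_0=\big(12\frac{I(k_0;0)}{I(\bar0;0)}-\varepsilon(k_0)\big)\big(1+\frac{I(k_0;0)}{I(\bar0;0)}\big)^{-1}$. $E_\mu^{(1)}=\min(\Lambda_\mu\cap(-\infty,0])$, $E_\mu^{(2)}=\max(\Lambda_\mu\cap(-\infty,0])$. *)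

theory Defs
  imports "HOL-Analysis.Analysis"
begin

definition T3 :: "(real^3) set" where
  "T3 = {k. \<forall>i. - pi < k $ i \<and> k $ i \<le> pi}"

definition T3M :: "(real^3) measure" where
  "T3M = density (restrict_space lborel T3) (\<lambda>_. ennreal (1 / (2 * pi) ^ 3))"

definition T3M2 :: "((real^3) \<times> (real^3)) measure" where
  "T3M2 = T3M \<Otimes>\<^sub>M T3M"

definition eps :: "real^3 \<Rightarrow> real" where
  "eps k = (\<Sum>i\<in>UNIV. 1 - cos (k $ i))"

definition w1 :: "real \<Rightarrow> real^3 \<Rightarrow> real" where
  "w1 \<gamma> k = eps k + \<gamma>"

definition w2 :: "real^3 \<Rightarrow> real^3 \<Rightarrow> real" where
  "w2 k p = eps k + eps ((1/2) *\<^sub>R (k + p)) + eps p"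

section \<open>The Hilbert space H = L2(T^3) (+) L2^s(T^3 x T^3), on representatives\<close>

type_synonym hvec = "(real^3 \<Rightarrow> complex) \<times> ((real^3) \<times> (real^3) \<Rightarrow> complex)"

definition inH :: "hvec \<Rightarrow> bool" where
  "inH f \<longleftrightarrow>
     fst f \<in> borel_measurable T3M \<and> (\<integral>\<^sup>+ k. ennreal ((cmod (fst f k))\<^sup>2) \<partial>T3M) < \<infinity> \<and>
     snd f \<in> borel_measurable T3M2 \<and> (\<integral>\<^sup>+ x. ennreal ((cmod (snd f x))\<^sup>2) \<partial>T3M2) < \<infinity> \<and>
     (AE x in T3M2. snd f (fst x, snd x) = snd f (snd x, fst x))"

definition eqH :: "hvec \<Rightarrow> hvec \<Rightarrow> bool" where
  "eqH f g \<longleftrightarrow> (AE k in T3M. fst f k = fst g k) \<and> (AE x in T3M2. snd f x = snd g x)"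

definition normH :: "hvec \<Rightarrow> real" where
  "normH f = sqrt (enn2real (\<integral>\<^sup>+ k. ennreal ((cmod (fst f k))\<^sup>2) \<partial>T3M)
                 + enn2real (\<integral>\<^sup>+ x. ennreal ((cmod (snd f x))\<^sup>2) \<partial>T3M2))"

definition Aop :: "real \<Rightarrow> real \<Rightarrow> hvec \<Rightarrow> hvec" where
  "Aop \<gamma> \<mu> f =
    ((\<lambda>k. complex_of_real (w1 \<gamma> k) * fst f k
          + complex_of_real \<mu> * (\<integral>s. snd f (k, s) \<partial>T3M)),
     (\<lambda>(k, p). complex_of_real \<mu> * ((fst f k + fst f p) / 2)
          + complex_of_real (w2 k p) * snd f (k, p)))"

definition Ashift :: "real \<Rightarrow> real \<Rightarrow> complex \<Rightarrow> hvec \<Rightarrow> hvec" where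
  "Ashift \<gamma> \<mu> z f =
    ((\<lambda>k. fst (Aop \<gamma> \<mu> f) k - z * fst f k), (\<lambda>x. snd (Aop \<gamma> \<mu> f) x - z * snd f x))"

definition resolvent_set :: "real \<Rightarrow> real \<Rightarrow> complex set" where
  "resolvent_set \<gamma> \<mu> = {z.
     (\<forall>g. inH g \<longrightarrow> (\<exists>f. inH f \<and> eqH (Ashift \<gamma> \<mu> z f) g)) \<and>
     (\<exists>C. \<forall>f. inH f \<longrightarrow> normH f \<le> C * normH (Ashift \<gamma> \<mu> z f))}"

definition spectrum_A :: "real \<Rightarrow> real \<Rightarrow> complex set" where
  "spectrum_A \<gamma> \<mu> = - resolvent_set \<gamma> \<mu>"

definition eigenspace_A :: "real \<Rightarrow> real \<Rightarrow> complex \<Rightarrow> hvec set" where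
  "eigenspace_A \<gamma> \<mu> z = {f. inH f \<and> eqH (Ashift \<gamma> \<mu> z f) (\<lambda>_. 0, \<lambda>_. 0)}"

definition is_eigenvalue_A :: "real \<Rightarrow> real \<Rightarrow> complex \<Rightarrow> bool" where
  "is_eigenvalue_A \<gamma> \<mu> z \<longleftrightarrow> (\<exists>f\<in>eigenspace_A \<gamma> \<mu> z. \<not> eqH f (\<lambda>_. 0, \<lambda>_. 0))"

definition finite_multiplicity_A :: "real \<Rightarrow> real \<Rightarrow> complex \<Rightarrow> bool" where
  "finite_multiplicity_A \<gamma> \<mu> z \<longleftrightarrow>
     (\<exists>B. finite B \<and> B \<subseteq> eigenspace_A \<gamma> \<mu> z \<and>
        (\<forall>f\<in>eigenspace_A \<gamma> \<mu> z. \<exists>c :: hvec \<Rightarrow> complex.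
            eqH f ((\<lambda>k. \<Sum>b\<in>B. c b * fst b k), (\<lambda>x. \<Sum>b\<in>B. c b * snd b x))))"

definition disc_spectrum_A :: "real \<Rightarrow> real \<Rightarrow> complex set" where
  "disc_spectrum_A \<gamma> \<mu> = {z \<in> spectrum_A \<gamma> \<mu>.
     (\<exists>e>0. ball z e \<inter> spectrum_A \<gamma> \<mu> = {z}) \<and>
     is_eigenvalue_A \<gamma> \<mu> z \<and> finite_multiplicity_A \<gamma> \<mu> z}"

definition ess_spectrum_A :: "real \<Rightarrow> real \<Rightarrow> complex set" where
  "ess_spectrum_A \<gamma> \<mu> = spectrum_A \<gamma> \<mu> - disc_spectrum_A \<gamma> \<mu>"

definition Iint :: "real^3 \<Rightarrow> real \<Rightarrow> real" where
  "Iint k z = (\<integral>t. 1 / (w2 k t - z) \<partial>T3M)"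

definition Delta :: "real \<Rightarrow> real \<Rightarrow> real^3 \<Rightarrow> real \<Rightarrow> real" where
  "Delta \<gamma> \<mu> k z = w1 \<gamma> k - z - \<mu>\<^sup>2 / 2 * Iint k z"

definition disc_fiber :: "real \<Rightarrow> real \<Rightarrow> real^3 \<Rightarrow> real set" where
  "disc_fiber \<gamma> \<mu> k = {z. z \<notin> {Inf (w2 k ` T3) .. Sup (w2 k ` T3)} \<and> Delta \<gamma> \<mu> k z = 0}"

definition Lambda :: "real \<Rightarrow> real \<Rightarrow> real set" where
  "Lambda \<gamma> \<mu> = (\<Union>k\<in>T3. disc_fiber \<gamma> \<mu> k)"

definition mu_r0 :: "real \<Rightarrow> real" where
  "mu_r0 \<gamma> = sqrt (24 - 2 * \<gamma>) / sqrt (Iint 0 0)"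

definition E1 :: "real \<Rightarrow> real \<Rightarrow> real" where
  "E1 \<gamma> \<mu> = Inf (Lambda \<gamma> \<mu> \<inter> {..0})"

definition E2 :: "real \<Rightarrow> real \<Rightarrow> real" where
  "E2 \<gamma> \<mu> = Sup (Lambda \<gamma> \<mu> \<inter> {..0})"

definition gamma0 :: "real^3 \<Rightarrow> real" where
  "gamma0 k0 = (12 * (Iint k0 0 / Iint 0 0) - eps k0) / (1 + Iint k0 0 / Iint 0 0)"

end

theory Submission
  imports Defs "HOL-Probability.Probability_Measure"
begin

text \<open>The essential spectrum is \<open>[0, 18]\<close> together with the negative \<open>z\<close> for which
  \<open>Delta \<gamma> \<mu> k z = 0\<close> for some \<open>k\<close>.

  Eliminating the two-particle component from \<open>(A - z) f = g\<close> leaves \<open>Delta(k; z) f1 = h + (\<mu>\<^sup>2/2) K f1\<close>,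
  where \<open>K\<close> is the integral operator with kernel \<open>1 / (w2 k s - z)\<close>. If \<open>Delta\<close> is bounded away from
  zero this is a compact perturbation of an invertible operator, so \<open>z\<close> is in the resolvent set or is an
  eigenvalue of finite multiplicity; by symmetry of \<open>A\<close> such eigenvalues are real and isolated.
  Conversely, singular sequences put \<open>[0, 18]\<close> and the zeros of \<open>Delta\<close> into the spectrum, and since
  neither set has isolated points, none of these points is discrete.

  To locate the zeros of \<open>Delta\<close>, a two-point rearrangement in one coordinate at a time shows that, for
  \<open>z < 0\<close>, \<open>Iint k z\<close> decreases in every \<open>\<bar>k $ i\<bar>\<close>. Hence \<open>Delta\<close> is minimal at \<open>k = 0\<close> and maximal
  at the corner \<open>(pi, pi, pi)\<close>, and the negative branch is \<open>{z < 0. Delta(0; z) \<le> 0 \<le> Delta(corner; z)}\<close>.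
  Note that \<open>w2\<close> is not \<open>2 * pi\<close>-periodic, but each \<open>Iint k z\<close> is even in every coordinate of \<open>k\<close>.
  Above the band, \<open>18 - w2 k t\<close> dominates \<open>w2 0\<close> at a folded point, so \<open>Delta \<le> 18 - z\<close> for \<open>z > 18\<close>.\<close>

section \<open>Square-integrable functions on probability spaces\<close>

text \<open>Compactness enters only as approximability: the kernel is Lipschitz in its second
  variable, so rounding that variable to a grid writes the integral operator as a contraction plus a
  finite-rank operator. The Fredholm alternative then reduces to Banach's fixed point theorem and a
  dimension count, and extracting two nearly equal images from infinitely many unit vectors is a
  pigeonhole argument. The thresholds come from one normalization: \<open>mu_r0\<close> is the
  coupling with \<open>\<mu>\<^sup>2 / 2 * Iint 0 0 = 12 - \<gamma>\<close>. Above the band it gives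
  \<open>Delta \<le> (6 + \<gamma>) - z + (12 - \<gamma>) = 18 - z\<close>. At \<open>z = 0\<close>
  it gives \<open>Delta = 2 * \<gamma> - 12\<close> at zero momentum, hence the value 6, while
  \<open>Delta \<gamma> \<mu> k 0\<close> becomes affine in \<open>\<gamma>\<close> with root
  \<open>gamma0 k\<close>. The point \<open>k0\<close> maximizes \<open>Delta\<close> at
  \<open>z = 0\<close>, the corner maximizes it for each \<open>z < 0\<close>. The two are never
  identified: the sign of \<open>Delta\<close> at \<open>k0\<close> is either used at
  \<open>z = 0\<close> alone or carried into \<open>z < 0\<close> by monotonicity in
  \<open>z\<close>.\<close>

definition L2 :: "'a measure \<Rightarrow> ('a \<Rightarrow> complex) \<Rightarrow> bool" where
  "L2 M f \<longleftrightarrow> f \<in> borel_measurable M \<and> integrable M (\<lambda>x. (cmod (f x))\<^sup>2)"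

definition nsq :: "'a measure \<Rightarrow> ('a \<Rightarrow> complex) \<Rightarrow> real" where
  "nsq M f = (\<integral>x. (cmod (f x))\<^sup>2 \<partial>M)"

lemma L2_integrable_sq: "L2 M f \<Longrightarrow> integrable M (\<lambda>x. (cmod (f x))\<^sup>2)"
  by (simp add: L2_def)

lemma nsq_nonneg [simp]: "0 \<le> nsq M f"
  unfolding nsq_def by simp

lemma L2_iff_nn_integral:
  "L2 M f \<longleftrightarrow> f \<in> borel_measurable M \<and> (\<integral>\<^sup>+x. ennreal ((cmod (f x))\<^sup>2) \<partial>M) < \<infinity>"
  unfolding L2_def by (auto simp: integrable_iff_bounded)

lemma nn_integral_nsq: "L2 M f \<Longrightarrow> (\<integral>\<^sup>+x. ennreal ((cmod (f x))\<^sup>2) \<partial>M) = ennreal (nsq M f)"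
  unfolding nsq_def L2_def by (subst nn_integral_eq_integral) auto

lemma nsq_cong_AE:
  assumes "f \<in> borel_measurable M" "g \<in> borel_measurable M" "AE x in M. f x = g x"
  shows "nsq M f = nsq M g"
  unfolding nsq_def using assms by (intro integral_cong_AE) auto

lemma L2_bounded_mult:
  assumes "L2 M f" "b \<in> borel_measurable M" "\<And>x. x \<in> space M \<Longrightarrow> cmod (b x) \<le> C"
  shows "L2 M (\<lambda>x. b x * f x)" "nsq M (\<lambda>x. b x * f x) \<le> C\<^sup>2 * nsq M f"
proof -
  have le: "(cmod (b x * f x))\<^sup>2 \<le> C\<^sup>2 * (cmod (f x))\<^sup>2" if "x \<in> space M" for x
    using assms(3)[OF that] by (simp add: norm_mult power_mult_distrib mult_right_mono power_mono)
  have [measurable]: "f \<in> borel_measurable M" "b \<in> borel_measurable M" using assms by (auto simp: L2_def)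
  have int: "integrable M (\<lambda>x. C\<^sup>2 * (cmod (f x))\<^sup>2)" using L2_integrable_sq[OF assms(1)] by simp
  have int': "integrable M (\<lambda>x. (cmod (b x * f x))\<^sup>2)"
    using le by (intro Bochner_Integration.integrable_bound[OF int]) (auto intro!: AE_I2)
  then show "L2 M (\<lambda>x. b x * f x)" by (simp add: L2_def)
  show "nsq M (\<lambda>x. b x * f x) \<le> C\<^sup>2 * nsq M f"
    unfolding nsq_def using integral_mono[OF int' int le] by simp
qed

lemma L2_cmult:
  assumes "L2 M f" shows "L2 M (\<lambda>x. c * f x)" "nsq M (\<lambda>x. c * f x) = (cmod c)\<^sup>2 * nsq M f"
  using L2_bounded_mult(1)[OF assms, of "\<lambda>_. c" "cmod c"]
  by (auto simp: nsq_def norm_mult power_mult_distrib)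

lemma cmod_add_sq_le: "(cmod (a + b))\<^sup>2 \<le> 2 * (cmod a)\<^sup>2 + 2 * (cmod b)\<^sup>2"
proof -
  have "(cmod (a + b))\<^sup>2 \<le> (cmod a + cmod b)\<^sup>2" by (intro power_mono norm_triangle_ineq) auto
  also have "\<dots> \<le> 2 * (cmod a)\<^sup>2 + 2 * (cmod b)\<^sup>2"
    using zero_le_power2[of "cmod a - cmod b"] by (simp add: power2_eq_square algebra_simps)
  finally show ?thesis .
qed

lemma L2_add:
  assumes "L2 M f" "L2 M g"
  shows "L2 M (\<lambda>x. f x + g x)" "nsq M (\<lambda>x. f x + g x) \<le> 2 * nsq M f + 2 * nsq M g"
proof -
  have [measurable]: "f \<in> borel_measurable M" "g \<in> borel_measurable M" using assms by (auto simp: L2_def)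
  have int: "integrable M (\<lambda>x. 2 * (cmod (f x))\<^sup>2 + 2 * (cmod (g x))\<^sup>2)"
    using assms[THEN L2_integrable_sq] by simp
  have int': "integrable M (\<lambda>x. (cmod (f x + g x))\<^sup>2)"
    using cmod_add_sq_le by (intro Bochner_Integration.integrable_bound[OF int]) (auto intro!: AE_I2)
  then show "L2 M (\<lambda>x. f x + g x)" by (simp add: L2_def)
  show "nsq M (\<lambda>x. f x + g x) \<le> 2 * nsq M f + 2 * nsq M g"
    unfolding nsq_def using integral_mono[OF int' int cmod_add_sq_le] assms[THEN L2_integrable_sq] by simp
qed

lemma L2_diff:
  assumes "L2 M f" "L2 M g"
  shows "L2 M (\<lambda>x. f x - g x)" "nsq M (\<lambda>x. f x - g x) \<le> 2 * nsq M f + 2 * nsq M g"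
  using L2_add[OF assms(1) L2_cmult(1)[OF assms(2), of "-1"]] L2_cmult(2)[OF assms(2), of "-1"] by auto

lemma integrable_L2_mult:
  assumes "L2 M f" "L2 M g"
  shows "integrable M (\<lambda>x. f x * g x)"
proof -
  have [measurable]: "f \<in> borel_measurable M" "g \<in> borel_measurable M" using assms by (auto simp: L2_def)
  have int: "integrable M (\<lambda>x. (cmod (f x))\<^sup>2 + (cmod (g x))\<^sup>2)"
    using assms[THEN L2_integrable_sq] by simp
  have "cmod (f x * g x) \<le> (cmod (f x))\<^sup>2 + (cmod (g x))\<^sup>2" for x
    using sum_squares_bound[of "cmod (f x)" "cmod (g x)"] mult_nonneg_nonneg[of "cmod (f x)" "cmod (g x)"]
    by (simp add: norm_mult del: mult_nonneg_nonneg)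
  then show ?thesis by (intro Bochner_Integration.integrable_bound[OF int]) (auto intro!: AE_I2)
qed

lemma L2_cnj:
  assumes "L2 M f" shows "L2 M (\<lambda>x. cnj (f x))"
proof -
  have "cnj \<in> borel_measurable borel"
    by (intro borel_measurable_continuous_onI continuous_on_cnj continuous_on_id)
  then have "(\<lambda>x. cnj (f x)) \<in> borel_measurable M"
    using assms by (intro measurable_compose[of f M borel cnj borel]) (auto simp: L2_def)
  then show ?thesis using assms by (simp add: L2_def)
qed

context prob_space
begin

lemma L2_bounded:
  assumes "f \<in> borel_measurable M" "\<And>x. x \<in> space M \<Longrightarrow> cmod (f x) \<le> C"
  shows "L2 M f" "nsq M f \<le> C\<^sup>2"
proof -
  have le: "(cmod (f x))\<^sup>2 \<le> C\<^sup>2" if "x \<in> space M" for x using assms(2)[OF that] by (intro power_mono) auto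
  have int: "integrable M (\<lambda>x. (cmod (f x))\<^sup>2)"
    using le assms(1) by (intro integrable_const_bound[where B="C\<^sup>2"]) (auto intro!: AE_I2)
  then show "L2 M f" using assms(1) by (simp add: L2_def)
  show "nsq M f \<le> C\<^sup>2"
    unfolding nsq_def using integral_mono[OF int integrable_const le] by (simp add: prob_space)
qed

lemma L2_integrable: "L2 M f \<Longrightarrow> integrable M f"
  using integrable_L2_mult[OF _ L2_bounded(1)[of "\<lambda>_. 1" 1], of f] by simp

text \<open>Nonnegativity of the variance of \<open>cmod (f x)\<close>, that is, Cauchy-Schwarz
  against the constant 1; total mass 1 enters here.\<close>

lemma integral_sq_le:
  assumes "L2 M f"
  shows "(\<integral>x. cmod (f x) \<partial>M)\<^sup>2 \<le> nsq M f"
proof -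
  define m where "m = (\<integral>x. cmod (f x) \<partial>M)"
  have int: "integrable M (\<lambda>x. cmod (f x))" using L2_integrable[OF assms] by simp
  have "0 \<le> (\<integral>x. (cmod (f x) - m)\<^sup>2 \<partial>M)" by simp
  also have "\<dots> = (\<integral>x. (cmod (f x))\<^sup>2 - 2 * m * cmod (f x) + m\<^sup>2 \<partial>M)"
    by (simp add: power2_diff algebra_simps)
  also have "\<dots> = nsq M f - 2 * m * m + m\<^sup>2"
    using int L2_integrable_sq[OF assms] by (simp add: nsq_def prob_space flip: m_def)
  finally show ?thesis unfolding m_def[symmetric] by (simp add: power2_eq_square)
qed

lemma cmod_integral_sq_le:
  assumes "L2 M f"
  shows "(cmod (\<integral>x. f x \<partial>M))\<^sup>2 \<le> nsq M f"
  using integral_sq_le[OF assms] integral_norm_bound[of M f]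
  by (meson norm_ge_zero order_trans power_mono)

end

section \<open>Product spaces: sections, marginals and lifts\<close>

locale prob_pair = M: prob_space M + N: prob_space N for M :: "'a measure" and N :: "'b measure"
begin

sublocale pair_prob_space M N ..

lemma AE_L2_section:
  assumes "L2 (M \<Otimes>\<^sub>M N) F" shows "AE x in M. L2 N (\<lambda>y. F (x, y))"
proof -
  have [measurable]: "F \<in> borel_measurable (M \<Otimes>\<^sub>M N)" using assms by (simp add: L2_def)
  have "AE x in M. integrable N (\<lambda>y. (cmod (F (x, y)))\<^sup>2)"
    using L2_integrable_sq[OF assms] AE_integrable_fst'[of "\<lambda>x. (cmod (F x))\<^sup>2"] by simp
  then show ?thesis by (auto simp: L2_def elim!: AE_mp intro!: AE_I2)
qed

text \<open>Cauchy-Schwarz on almost every section, followed by Tonelli. It bounds the norm of the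
  off-diagonal entry \<open>A12\<close>, integration over the second momentum, by 1.\<close>

lemma L2_marginal:
  assumes "L2 (M \<Otimes>\<^sub>M N) F"
  shows "L2 M (\<lambda>x. \<integral>y. F (x, y) \<partial>N)" "nsq M (\<lambda>x. \<integral>y. F (x, y) \<partial>N) \<le> nsq (M \<Otimes>\<^sub>M N) F"
proof -
  have [measurable]: "F \<in> borel_measurable (M \<Otimes>\<^sub>M N)" using assms by (simp add: L2_def)
  have "(\<integral>\<^sup>+x. ennreal ((cmod (\<integral>y. F (x, y) \<partial>N))\<^sup>2) \<partial>M)
      \<le> (\<integral>\<^sup>+x. (\<integral>\<^sup>+y. ennreal ((cmod (F (x, y)))\<^sup>2) \<partial>N) \<partial>M)"
  proof (rule nn_integral_mono_AE)
    show "AE x in M. ennreal ((cmod (\<integral>y. F (x, y) \<partial>N))\<^sup>2) \<le> (\<integral>\<^sup>+y. ennreal ((cmod (F (x, y)))\<^sup>2) \<partial>N)"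
      using AE_L2_section[OF assms]
      by eventually_elim (simp add: nn_integral_nsq N.cmod_integral_sq_le)
  qed
  also have "\<dots> = (\<integral>\<^sup>+x. ennreal ((cmod (F x))\<^sup>2) \<partial>(M \<Otimes>\<^sub>M N))"
    by (rule N.nn_integral_fst) simp
  also have "\<dots> = ennreal (nsq (M \<Otimes>\<^sub>M N) F)" by (rule nn_integral_nsq[OF assms])
  finally have le: "(\<integral>\<^sup>+x. ennreal ((cmod (\<integral>y. F (x, y) \<partial>N))\<^sup>2) \<partial>M) \<le> ennreal (nsq (M \<Otimes>\<^sub>M N) F)" .
  then show L: "L2 M (\<lambda>x. \<integral>y. F (x, y) \<partial>N)"
    unfolding L2_iff_nn_integral by (auto intro: le_less_trans)
  show "nsq M (\<lambda>x. \<integral>y. F (x, y) \<partial>N) \<le> nsq (M \<Otimes>\<^sub>M N) F"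
    using le unfolding nn_integral_nsq[OF L] by simp
qed

lemma L2_fst:
  assumes "L2 M f"
  shows "L2 (M \<Otimes>\<^sub>M N) (\<lambda>x. f (fst x))" "nsq (M \<Otimes>\<^sub>M N) (\<lambda>x. f (fst x)) = nsq M f"
proof -
  have [measurable]: "f \<in> borel_measurable M" using assms by (simp add: L2_def)
  have "(\<integral>\<^sup>+x. ennreal ((cmod (f (fst x)))\<^sup>2) \<partial>(M \<Otimes>\<^sub>M N)) = (\<integral>\<^sup>+x. (\<integral>\<^sup>+y. ennreal ((cmod (f x))\<^sup>2) \<partial>N) \<partial>M)"
    by (subst N.nn_integral_fst[symmetric]) auto
  also have "\<dots> = ennreal (nsq M f)" by (simp add: N.emeasure_space_1 nn_integral_nsq[OF assms])
  finally have eq: "(\<integral>\<^sup>+x. ennreal ((cmod (f (fst x)))\<^sup>2) \<partial>(M \<Otimes>\<^sub>M N)) = ennreal (nsq M f)" .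
  then show L: "L2 (M \<Otimes>\<^sub>M N) (\<lambda>x. f (fst x))"
    unfolding L2_iff_nn_integral by auto
  show "nsq (M \<Otimes>\<^sub>M N) (\<lambda>x. f (fst x)) = nsq M f"
    using eq unfolding nn_integral_nsq[OF L] by simp
qed

lemma L2_snd:
  assumes "L2 N f"
  shows "L2 (M \<Otimes>\<^sub>M N) (\<lambda>x. f (snd x))" "nsq (M \<Otimes>\<^sub>M N) (\<lambda>x. f (snd x)) = nsq N f"
proof -
  have [measurable]: "f \<in> borel_measurable N" using assms by (simp add: L2_def)
  have "(\<integral>\<^sup>+x. ennreal ((cmod (f (snd x)))\<^sup>2) \<partial>(M \<Otimes>\<^sub>M N)) = (\<integral>\<^sup>+x. (\<integral>\<^sup>+y. ennreal ((cmod (f y))\<^sup>2) \<partial>N) \<partial>M)"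
    by (subst N.nn_integral_fst[symmetric]) auto
  also have "\<dots> = ennreal (nsq N f)" by (simp add: M.emeasure_space_1 nn_integral_nsq[OF assms])
  finally have eq: "(\<integral>\<^sup>+x. ennreal ((cmod (f (snd x)))\<^sup>2) \<partial>(M \<Otimes>\<^sub>M N)) = ennreal (nsq N f)" .
  then show L: "L2 (M \<Otimes>\<^sub>M N) (\<lambda>x. f (snd x))"
    unfolding L2_iff_nn_integral by auto
  show "nsq (M \<Otimes>\<^sub>M N) (\<lambda>x. f (snd x)) = nsq N f"
    using eq unfolding nn_integral_nsq[OF L] by simp
qed

end

section \<open>A Fredholm alternative\<close>

text \<open>The image of a basis \<open>C\<close> of \<open>span B\<close> is independent and has as
  many elements as \<open>C\<close>. A basis vector outside its span would produce an independent
  set of more than \<open>card C\<close> vectors inside \<open>span C\<close>.\<close>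

lemma injective_on_span_imp_surjective:
  fixes f :: "'a::real_vector \<Rightarrow> 'a"
  assumes "finite B" "linear f" "f ` span B \<subseteq> span B" "inj_on f (span B)"
  shows "f ` span B = span B"
proof -
  obtain C where C: "C \<subseteq> span B" "independent C" "span B \<subseteq> span C"
    using maximal_independent_subset[of "span B"] by blast
  have eq: "span C = span B"
    using C span_mono[OF C(1)] by (simp add: span_span subset_antisym)
  have finC: "finite C"
    using independent_span_bound[OF assms(1) C(2,1)] by simp
  have inj: "inj_on f (span C)" using assms(4) eq by simp
  have ind: "independent (f ` C)"
    by (rule linear_independent_injective_image[OF assms(2) C(2) inj])
  have injC: "inj_on f C" using inj by (rule inj_on_subset) (simp add: span_superset)
  have card: "card (f ` C) = card C" by (rule card_image[OF injC])
  have sub: "f ` C \<subseteq> span C" using assms(3) C(1) eq by blast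
  have "span C \<subseteq> span (f ` C)"
  proof (rule ccontr)
    assume "\<not> span C \<subseteq> span (f ` C)"
    then obtain x where x: "x \<in> C" "x \<notin> span (f ` C)"
      by (meson in_mono span_minimal subsetI subspace_span)
    then have xi: "independent (insert x (f ` C))" using ind independent_insertI by blast
    have "insert x (f ` C) \<subseteq> span C" using sub x span_base by blast
    then have "card (insert x (f ` C)) \<le> card C"
      using independent_span_bound[OF finC xi] by simp
    moreover have "x \<notin> f ` C" using x(2) span_base[of x "f ` C"] by auto
    ultimately show False using card finC by simp
  qed
  also have "span (f ` C) = f ` span C" using linear_span_image[OF assms(2)] by simp
  finally show ?thesis using assms(3) eq by blast
qed

text \<open>\<open>M\<close> is the inverse of \<open>id - R\<close>, the sum of the Neumann series:
  \<open>M w\<close> is the unique fixed point of the contraction sending \<open>x\<close> to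
  \<open>w + R x\<close>, and uniqueness gives linearity.\<close>

lemma contraction_perturbation_inverse:
  fixes R :: "'a::{real_normed_vector,complete_space} \<Rightarrow> 'a"
  assumes R: "linear R" and b: "\<And>x. norm (R x) \<le> r * norm x" and r: "0 \<le> r" "r < 1"
  obtains M where "linear M" "\<And>x w. x - R x = w \<longleftrightarrow> x = M w"
    "\<And>w. norm (M w) \<le> norm w / (1 - r)"
proof -
  have ex: "\<exists>!x. w + R x = x" for w
  proof (rule banach_fix_type[OF r])
    show "\<forall>x y. dist (w + R x) (w + R y) \<le> r * dist x y"
      using b by (simp add: dist_norm flip: linear_diff[OF R])
  qed
  define M where "M w = (THE x. w + R x = x)" for w
  have M: "w + R (M w) = M w" for w unfolding M_def by (rule theI'[OF ex])
  have iff: "x - R x = w \<longleftrightarrow> x = M w" for x w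
    using ex[of w] M[of w] by (metis add_diff_cancel_right' diff_add_cancel)
  have lin: "linear M"
  proof (rule linearI)
    fix x y :: 'a and c :: real
    have "M x + M y - R (M x + M y) = (M x - R (M x)) + (M y - R (M y))"
      by (simp add: linear_add[OF R])
    also have "\<dots> = x + y" using iff by metis
    finally show "M (x + y) = M x + M y" using iff by metis
    have "c *\<^sub>R M x - R (c *\<^sub>R M x) = c *\<^sub>R (M x - R (M x))"
      by (simp add: linear_scale[OF R] scaleR_diff_right)
    also have "\<dots> = c *\<^sub>R x" using iff by metis
    finally show "M (c *\<^sub>R x) = c *\<^sub>R M x" using iff by metis
  qed
  have "norm (M w) \<le> norm w / (1 - r)" for w
  proof -
    have "norm (M w) \<le> norm w + norm (R (M w))" using M[of w] by (metis norm_triangle_ineq)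
    then have "norm (M w) \<le> norm w + r * norm (M w)" using b[of "M w"] by linarith
    then show ?thesis using r by (simp add: field_simps)
  qed
  then show ?thesis using that lin iff by blast
qed

text \<open>Applying the inverse \<open>M\<close> of \<open>id - R\<close> turns
  \<open>x - L x = w\<close> into \<open>x - T x = M w\<close>, where \<open>T\<close> has range in
  the span of the finitely many \<open>M (a j)\<close>. Fixed points therefore lie in that span, and
  injectivity on it gives surjectivity onto it.\<close>

lemma fredholm_alternative:
  fixes L R :: "'a::{real_normed_vector,complete_space} \<Rightarrow> 'a" and l :: "'j \<Rightarrow> 'a \<Rightarrow> real"
  assumes R: "linear R" and b: "\<And>x. norm (R x) \<le> r * norm x" and r: "0 \<le> r" "r < 1"
    and J: "finite J" and l: "\<And>j. j \<in> J \<Longrightarrow> bounded_linear (l j)"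
    and L: "\<And>x. L x = R x + (\<Sum>j\<in>J. l j x *\<^sub>R a j)"
  shows "\<exists>B. finite B \<and> {x. L x = x} \<subseteq> span B"
    and "(\<And>x. L x = x \<Longrightarrow> x = 0) \<Longrightarrow> \<exists>C. \<forall>w. \<exists>v. v - L v = w \<and> norm v \<le> C * norm w"
proof -
  obtain M where M: "linear M" and iff: "\<And>x w. x - R x = w \<longleftrightarrow> x = M w"
    and bd: "\<And>w. norm (M w) \<le> norm w / (1 - r)"
    using contraction_perturbation_inverse[OF R b r] by metis
  define B where "B = (\<lambda>j. M (a j)) ` J"
  have fin: "finite B" using J unfolding B_def by simp
  define F where "F x = (\<Sum>j\<in>J. l j x *\<^sub>R a j)" for x
  define T where "T x = (\<Sum>j\<in>J. l j x *\<^sub>R M (a j))" for x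
  have TF: "T x = M (F x)" for x
    unfolding T_def F_def by (simp add: linear_sum[OF M] linear_scale[OF M])
  have linT: "linear T"
    unfolding T_def
    by (rule linearI) (auto simp: linear_add[OF bounded_linear.linear[OF l]]
        linear_scale[OF bounded_linear.linear[OF l]] scaleR_left_distrib sum.distrib scaleR_sum_right)
  have Tsp: "T x \<in> span B" for x
    unfolding T_def B_def by (intro span_sum span_scale span_base) auto
  have eqv: "x - L x = w \<longleftrightarrow> x - T x = M w" for x w
  proof -
    have "x - L x = w \<longleftrightarrow> x - R x = w + F x" unfolding L F_def by (auto simp: algebra_simps)
    also have "\<dots> \<longleftrightarrow> x = M w + T x" unfolding iff TF by (simp add: linear_add[OF M])
    finally show ?thesis by (auto simp: algebra_simps)
  qed
  have ker: "L x = x \<longleftrightarrow> T x = x" for x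
    using eqv[of x 0] linear_0[OF M] by auto
  show "\<exists>B. finite B \<and> {x. L x = x} \<subseteq> span B"
    using fin ker Tsp by (metis (mono_tags, lifting) mem_Collect_eq subsetI)
  assume inj: "\<And>x. L x = x \<Longrightarrow> x = 0"
  have linf: "linear (\<lambda>x. x - T x)"
    using linT by (intro linear_compose_sub linear_ident) auto
  have "(\<lambda>x. x - T x) ` span B = span B"
  proof (rule injective_on_span_imp_surjective[OF fin linf])
    show "(\<lambda>x. x - T x) ` span B \<subseteq> span B" using Tsp by (auto intro: span_diff)
    show "inj_on (\<lambda>x. x - T x) (span B)"
    proof (rule inj_onI)
      fix x y assume "x - T x = y - T y"
      then have "T (x - y) = x - y" by (simp add: linear_diff[OF linT] algebra_simps)
      then have "x - y = 0" using inj ker by blast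
      then show "x = y" by simp
    qed
  qed
  note surj = this
  have "\<exists>y. y - T y = M (a j)" if "j \<in> J" for j
  proof -
    have "M (a j) \<in> span B" using that unfolding B_def by (intro span_base) simp
    then have "M (a j) \<in> (\<lambda>x. x - T x) ` span B" using surj by simp
    then show ?thesis by auto
  qed
  then obtain y where y: "\<And>j. j \<in> J \<Longrightarrow> y j - T (y j) = M (a j)" by metis
  obtain K where K: "\<And>j x. j \<in> J \<Longrightarrow> norm (l j x) \<le> norm x * K j"
    using bounded_linear.bounded[OF l] by metis
  define C where "C = (1 + (\<Sum>j\<in>J. \<bar>K j\<bar> * norm (y j))) / (1 - r)"
  show "\<exists>C. \<forall>w. \<exists>v. v - L v = w \<and> norm v \<le> C * norm w"
  proof (intro exI allI conjI)
    fix w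
    define x where "x = M w"
    \<comment> \<open>The first guess \<open>x = M w\<close> leaves the error \<open>- T x\<close>.
      The combination of the \<open>y j\<close> cancels it, and its norm is controlled by finitely
      many constants.\<close>
    define v where "v = x + (\<Sum>j\<in>J. l j x *\<^sub>R y j)"
    have "v - T v = x - T x + (\<Sum>j\<in>J. l j x *\<^sub>R (y j - T (y j)))"
      unfolding v_def
      by (simp add: linear_add[OF linT] linear_sum[OF linT] linear_scale[OF linT] scaleR_diff_right
          sum_subtractf)
    also have "(\<Sum>j\<in>J. l j x *\<^sub>R (y j - T (y j))) = T x"
      unfolding T_def[of x] using y by (intro sum.cong) auto
    finally show "v - L v = w" using eqv x_def by simp
    have "norm (\<Sum>j\<in>J. l j x *\<^sub>R y j) \<le> (\<Sum>j\<in>J. norm x * (\<bar>K j\<bar> * norm (y j)))"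
    proof (rule sum_norm_le)
      fix j assume "j \<in> J"
      then have "\<bar>l j x\<bar> \<le> norm x * K j" using K[of j x] by simp
      also have "\<dots> \<le> norm x * \<bar>K j\<bar>" by (intro mult_left_mono) auto
      finally show "norm (l j x *\<^sub>R y j) \<le> norm x * (\<bar>K j\<bar> * norm (y j))"
        by (simp add: mult_right_mono flip: mult.assoc)
    qed
    then have "norm v \<le> norm x + norm x * (\<Sum>j\<in>J. \<bar>K j\<bar> * norm (y j))"
      unfolding v_def by (simp add: sum_distrib_left norm_triangle_mono)
    also have "\<dots> = norm x * (1 + (\<Sum>j\<in>J. \<bar>K j\<bar> * norm (y j)))" by (simp add: algebra_simps)
    also have "\<dots> \<le> norm w / (1 - r) * (1 + (\<Sum>j\<in>J. \<bar>K j\<bar> * norm (y j)))"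
      unfolding x_def by (intro mult_right_mono bd add_nonneg_nonneg sum_nonneg) auto
    finally show "norm v \<le> C * norm w" unfolding C_def by (simp add: mult_ac)
  qed
qed

section \<open>The torus measure and the symbol\<close>

lemma T3_subset_cbox: "T3 \<subseteq> cbox (\<chi> i. - pi) (\<chi> i. pi)"
  by (auto simp: T3_def mem_box_cart less_imp_le)

lemma box_subset_T3: "box (\<chi> i. - pi) (\<chi> i. pi) \<subseteq> T3"
  by (auto simp: T3_def mem_box_cart less_imp_le)

lemma T3_borel [measurable]: "T3 \<in> sets borel"
proof -
  have "T3 = (\<Inter>i\<in>UNIV. {k. - pi < k $ i} \<inter> {k. k $ i \<le> pi})" by (auto simp: T3_def)
  also have "\<dots> \<in> sets borel"
    by (intro sets.finite_INT sets.Int borel_open borel_closed open_Collect_less closed_Collect_le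
        continuous_intros) auto
  finally show ?thesis .
qed

lemma emeasure_cube: "emeasure lborel (cbox (\<chi> i. - pi) (\<chi> i. pi) :: (real^3) set) = ennreal ((2 * pi)^3)"
  by (subst emeasure_lborel_cbox_eq)
    (simp add: inner_axis axis_in_Basis_iff Basis_vec_def prod.reindex UNION_singleton_eq_range inj_on_def axis_eq_axis)

text \<open>The closed cube replaces the half-open \<open>T3\<close> in all Lebesgue integrals,
  because it is invariant under sign changes of coordinates and \<open>T3\<close> is not.\<close>

lemma AE_T3_iff_cube: "AE t in lborel. t \<in> T3 \<longleftrightarrow> t \<in> cbox (\<chi> i. - pi) (\<chi> i. pi)"
proof -
  have "emeasure lborel (cbox (\<chi> i. - pi) (\<chi> i. pi) - box (\<chi> i. - pi) (\<chi> i. pi) :: (real^3) set) = 0"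
    using emeasure_lborel_cbox_finite
    by (subst emeasure_Diff) (auto simp: box_subset_cbox emeasure_lborel_cbox_eq emeasure_lborel_box_eq mem_box_cart
       inner_axis Basis_vec_def)
  then have "AE t in lborel. (t::real^3) \<notin> cbox (\<chi> i. - pi) (\<chi> i. pi) - box (\<chi> i. - pi) (\<chi> i. pi)"
    by (intro AE_not_in) (auto simp: null_sets_def)
  then show ?thesis by eventually_elim (use T3_subset_cbox box_subset_T3 in auto)
qed

lemma space_T3M [simp]: "space T3M = T3"
  by (simp add: T3M_def space_restrict_space)

lemma nn_integral_T3M:
  assumes "f \<in> borel_measurable borel"
  shows "(\<integral>\<^sup>+t. f t \<partial>T3M) = ennreal (1 / (2 * pi)^3) * (\<integral>\<^sup>+t. f t * indicator (cbox (\<chi> i. - pi) (\<chi> i. pi)) t \<partial>lborel)"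
proof -
  have [measurable]: "f \<in> borel_measurable lborel" using assms by simp
  have "(\<integral>\<^sup>+t. f t \<partial>T3M) = (\<integral>\<^sup>+t. ennreal (1 / (2 * pi)^3) * f t \<partial>(restrict_space lborel T3))"
    unfolding T3M_def by (subst nn_integral_density) (auto intro: measurable_restrict_space1)
  also have "\<dots> = (\<integral>\<^sup>+t. ennreal (1 / (2 * pi)^3) * f t * indicator T3 t \<partial>lborel)"
    by (subst nn_integral_restrict_space) auto
  also have "\<dots> = (\<integral>\<^sup>+t. ennreal (1 / (2 * pi)^3) * (f t * indicator (cbox (\<chi> i. - pi) (\<chi> i. pi)) t) \<partial>lborel)"
    by (rule nn_integral_cong_AE, use AE_T3_iff_cube in eventually_elim) (auto simp: indicator_def mult_ac)
  also have "\<dots> = ennreal (1 / (2 * pi)^3) * (\<integral>\<^sup>+t. f t * indicator (cbox (\<chi> i. - pi) (\<chi> i. pi)) t \<partial>lborel)"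
    by (rule nn_integral_cmult) measurable
  finally show ?thesis .
qed

lemma borel_measurable_T3M: "f \<in> borel_measurable borel \<Longrightarrow> f \<in> borel_measurable T3M"
  unfolding T3M_def by (auto intro: measurable_restrict_space1)

lemma sets_T3M: "sets T3M = sets (restrict_space borel T3)"
  unfolding T3M_def by (simp cong: sets_restrict_space_cong)

lemma id_measurable_T3M [measurable]: "(\<lambda>x. x) \<in> measurable T3M borel"
  by (rule borel_measurable_T3M) simp

interpretation T3M: prob_space T3M
proof
  have "emeasure T3M (space T3M) = (\<integral>\<^sup>+t. 1 \<partial>T3M)" by simp
  also have "\<dots> = ennreal (1 / (2 * pi)^3) * ennreal ((2 * pi)^3)"
    by (subst nn_integral_T3M) (simp_all add: emeasure_cube)
  also have "\<dots> = 1" by (subst ennreal_mult[symmetric]) (simp_all)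
  finally show "emeasure T3M (space T3M) = 1" .
qed

interpretation T3M2: prob_pair T3M T3M ..

lemma borel_measurable_T3M2:
  assumes "f \<in> borel_measurable borel" shows "f \<in> borel_measurable T3M2"
proof -
  have "(\<lambda>x. (fst x, snd x)) \<in> measurable T3M2 (borel \<Otimes>\<^sub>M borel)"
    unfolding T3M2_def
    by (intro measurable_Pair measurable_compose[OF measurable_fst id_measurable_T3M]
        measurable_compose[OF measurable_snd id_measurable_T3M])
  then have "(\<lambda>x. x) \<in> measurable T3M2 borel" by (simp add: borel_prod)
  then show ?thesis using assms by (rule measurable_compose)
qed

lemma eps_bounds: "0 \<le> eps k" "eps k \<le> 6"
proof -
  show "0 \<le> eps k" unfolding eps_def by (intro sum_nonneg) simp
  have "eps k \<le> (\<Sum>i\<in>(UNIV::3 set). 2)" unfolding eps_def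
  proof (rule sum_mono)
    fix i show "1 - cos (k $ i) \<le> 2" using cos_ge_minus_one[of "k $ i"] by linarith
  qed
  then show "eps k \<le> 6" by simp
qed

lemma w2_bounds: "0 \<le> w2 k p" "w2 k p \<le> 18"
  using eps_bounds[of k] eps_bounds[of p] eps_bounds[of "(1/2) *\<^sub>R (k + p)"] unfolding w2_def by auto

lemma w2_commute: "w2 k p = w2 p k"
  by (simp add: w2_def add.commute)

lemma continuous_on_eps [continuous_intros]:
  assumes "continuous_on S f" shows "continuous_on S (\<lambda>x. eps (f x))"
proof -
  have "continuous_on UNIV eps"
    unfolding eps_def by (intro continuous_intros continuous_on_cos continuous_on_component)
  then show ?thesis using assms by (rule continuous_on_compose2) simp
qed

lemma continuous_on_w2 [continuous_intros]:
  "continuous_on S f \<Longrightarrow> continuous_on S g \<Longrightarrow> continuous_on S (\<lambda>x. w2 (f x) (g x))"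
  unfolding w2_def by (intro continuous_intros)

lemma w2_diag: "w2 k k = 3 * eps k"
  by (simp add: w2_def scaleR_2[symmetric])

lemma borel_measurable_w2 [measurable]:
  assumes [measurable]: "f \<in> borel_measurable M" "g \<in> borel_measurable M"
  shows "(\<lambda>x. w2 (f x) (g x)) \<in> borel_measurable M"
proof -
  have "(\<lambda>p. w2 (fst p) (snd p)) \<in> borel_measurable borel"
    by (intro borel_measurable_continuous_onI continuous_intros)
  then have "(\<lambda>p. w2 (fst p) (snd p)) \<in> borel_measurable (borel \<Otimes>\<^sub>M borel)" by (simp add: borel_prod)
  then have "(\<lambda>x. (\<lambda>p. w2 (fst p) (snd p)) (f x, g x)) \<in> borel_measurable M"
    by (rule measurable_compose[rotated]) measurable
  then show ?thesis by simp
qed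

lemma borel_measurable_eps [measurable]:
  assumes [measurable]: "f \<in> borel_measurable M"
  shows "(\<lambda>x. eps (f x)) \<in> borel_measurable M"
  by (rule measurable_compose[OF assms borel_measurable_continuous_onI]) (intro continuous_intros)

section \<open>The resolvent kernel\<close>

definition resolvent_kernel :: "complex \<Rightarrow> real^3 \<Rightarrow> real^3 \<Rightarrow> complex" where
  "resolvent_kernel z k s = 1 / (complex_of_real (w2 k s) - z)"

definition Kop :: "complex \<Rightarrow> (real^3 \<Rightarrow> complex) \<Rightarrow> real^3 \<Rightarrow> complex" where
  "Kop z f k = (\<integral>s. resolvent_kernel z k s * f s \<partial>T3M)"

text \<open>\<open>Delta\<close> continued to complex \<open>z\<close>, since the resolvent set
  consists of complex numbers; the two agree for real \<open>z\<close> by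
  \<open>DeltaC_of_real\<close>.\<close>

definition DeltaC :: "real \<Rightarrow> real \<Rightarrow> complex \<Rightarrow> real^3 \<Rightarrow> complex" where
  "DeltaC \<gamma> \<mu> z k = complex_of_real (w1 \<gamma> k) - z
     - complex_of_real (\<mu>\<^sup>2 / 2) * (\<integral>t. resolvent_kernel z k t \<partial>T3M)"

text \<open>Cosine is 1-Lipschitz; the constant 3/2 is 1/2 from the half-sum
  \<open>(k + p) / 2\<close> plus 1 from \<open>eps p\<close>.\<close>

lemma w2_lipschitz: "\<bar>w2 k s - w2 k t\<bar> \<le> 3/2 * (\<Sum>i\<in>UNIV. \<bar>s $ i - t $ i\<bar>)"
proof -
  have cl: "\<bar>cos a - cos b\<bar> \<le> \<bar>a - b\<bar>" for a b :: real
  proof -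
    have "\<bar>cos a - cos b\<bar> = 2 * \<bar>sin ((a + b) / 2)\<bar> * \<bar>sin ((b - a) / 2)\<bar>"
      by (simp add: cos_diff_cos abs_mult)
    also have "\<dots> \<le> 2 * 1 * \<bar>(b - a) / 2\<bar>"
      by (intro mult_mono abs_sin_x_le_abs_x mult_nonneg_nonneg) auto
    finally show ?thesis by simp
  qed
  have "w2 k s - w2 k t = (\<Sum>i\<in>UNIV. (cos ((k $ i + t $ i) / 2) - cos ((k $ i + s $ i) / 2)) + (cos (t $ i) - cos (s $ i)))"
    unfolding w2_def eps_def by (simp add: sum.distrib sum_subtractf)
  also have "\<bar>\<dots>\<bar> \<le> (\<Sum>i\<in>UNIV. 3/2 * \<bar>s $ i - t $ i\<bar>)"
  proof (rule order_trans[OF sum_abs], rule sum_mono)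
    fix i :: 3
    show "\<bar>(cos ((k $ i + t $ i) / 2) - cos ((k $ i + s $ i) / 2)) + (cos (t $ i) - cos (s $ i))\<bar>
        \<le> 3/2 * \<bar>s $ i - t $ i\<bar>"
    proof -
      have "\<bar>cos ((k $ i + t $ i) / 2) - cos ((k $ i + s $ i) / 2)\<bar> \<le> \<bar>s $ i - t $ i\<bar> / 2"
        by (rule order_trans[OF cl]) (simp add: abs_minus_commute flip: diff_divide_distrib)
      moreover have "\<bar>cos (t $ i) - cos (s $ i)\<bar> \<le> \<bar>s $ i - t $ i\<bar>"
        by (rule order_trans[OF cl]) (simp add: abs_minus_commute)
      ultimately show ?thesis
        using order_trans[OF abs_triangle_ineq add_mono] by fastforce
    qed
  qed
  finally show ?thesis by (simp add: sum_distrib_left)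
qed

lemma DeltaC_eq_Kop: "DeltaC \<gamma> \<mu> z k = complex_of_real (w1 \<gamma> k) - z - complex_of_real (\<mu>\<^sup>2 / 2) * Kop z (\<lambda>_. 1) k"
  by (simp add: DeltaC_def Kop_def)

lemma integrable_indicator_vimage_mult:
  fixes f :: "real^3 \<Rightarrow> complex" and q :: "real^3 \<Rightarrow> real^3"
  assumes q: "q \<in> measurable borel borel" and f: "integrable T3M f"
  shows "integrable T3M (\<lambda>s. indicator (q -` {j}) s * f s)"
proof (rule Bochner_Integration.integrable_bound[OF f])
  have [measurable]: "q \<in> measurable T3M borel" using borel_measurable_T3M[OF q] .
  have "(\<lambda>x. indicator {j} (q x) :: complex) \<in> borel_measurable T3M" by measurable
  then have "(indicator (q -` {j}) :: _ \<Rightarrow> complex) \<in> borel_measurable T3M"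
    by (simp add: indicator_def[abs_def])
  then show "(\<lambda>s. indicator (q -` {j}) s * f s) \<in> borel_measurable T3M"
    by (rule borel_measurable_times[OF _ borel_measurable_integrable[OF f]])
  show "AE s in T3M. norm (indicator (q -` {j}) s * f s) \<le> norm (f s)"
    by (intro AE_I2) (simp add: indicator_def)
qed

text \<open>Here \<open>A22 - z\<close> is invertible with inverse of norm at most
  \<open>1 / d\<close>. Nonreal \<open>z\<close>, negative \<open>z\<close> and real
  \<open>z\<close> above 18 are all instances.\<close>

locale gap_point =
  fixes z :: complex and d :: real
  assumes d: "0 < d" and gap: "\<And>k s. d \<le> cmod (complex_of_real (w2 k s) - z)"
begin

lemma denom_nonzero: "complex_of_real (w2 k s) - z \<noteq> 0"
  using gap[of k s] d by auto

lemma denom_neq: "complex_of_real (w2 k s) \<noteq> z"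
  using denom_nonzero[of k s] by auto

lemma kernel_bound: "cmod (resolvent_kernel z k s) \<le> 1 / d"
  unfolding resolvent_kernel_def using gap[of k s] d by (simp add: norm_divide frac_le)

lemma kernel_commute: "resolvent_kernel z k s = resolvent_kernel z s k"
  by (simp add: resolvent_kernel_def w2_commute)

lemma continuous_on_kernel [continuous_intros]:
  assumes "continuous_on S f" "continuous_on S g"
  shows "continuous_on S (\<lambda>x. resolvent_kernel z (f x) (g x))"
  unfolding resolvent_kernel_def
  by (intro continuous_intros continuous_on_of_real assms) (simp add: denom_neq)

lemma measurable_kernel [measurable]:
  assumes [measurable]: "f \<in> borel_measurable M" "g \<in> borel_measurable M"
  shows "(\<lambda>x. resolvent_kernel z (f x) (g x)) \<in> borel_measurable M"
  unfolding resolvent_kernel_def by measurable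

lemma kernel_lipschitz: "cmod (resolvent_kernel z k s - resolvent_kernel z k t) \<le> \<bar>w2 k s - w2 k t\<bar> / d\<^sup>2"
proof -
  have "resolvent_kernel z k s - resolvent_kernel z k t =
      complex_of_real (w2 k t - w2 k s) * resolvent_kernel z k s * resolvent_kernel z k t"
    unfolding resolvent_kernel_def using denom_nonzero[of k s] denom_nonzero[of k t]
    by (simp add: field_simps)
  also have "cmod \<dots> \<le> \<bar>w2 k t - w2 k s\<bar> * (1 / d) * (1 / d)"
    unfolding norm_mult norm_of_real
    by (intro mult_mono kernel_bound order_refl mult_nonneg_nonneg) (use d in auto)
  finally show ?thesis by (simp add: power2_eq_square abs_minus_commute)
qed

section \<open>The integral operator \<open>Kop\<close>\<close>

lemma integrable_kernel_mult:
  assumes "integrable T3M f" shows "integrable T3M (\<lambda>s. resolvent_kernel z k s * f s)"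
proof (rule Bochner_Integration.integrable_bound)
  have [measurable]: "f \<in> borel_measurable T3M" using assms by simp
  show "integrable T3M (\<lambda>s. 1 / d * cmod (f s))" using assms by simp
  show "(\<lambda>s. resolvent_kernel z k s * f s) \<in> borel_measurable T3M" by measurable
  show "AE s in T3M. norm (resolvent_kernel z k s * f s) \<le> norm (1 / d * cmod (f s))"
  proof (rule AE_I2)
    fix s
    have "cmod (resolvent_kernel z k s) * cmod (f s) \<le> 1 / d * cmod (f s)"
      by (intro mult_right_mono kernel_bound) auto
    then show "norm (resolvent_kernel z k s * f s) \<le> norm (1 / d * cmod (f s))"
      using d by (simp add: norm_mult)
  qed
qed

lemma Kop_bound:
  assumes "integrable T3M f" shows "cmod (Kop z f k) \<le> 1 / d * (\<integral>s. cmod (f s) \<partial>T3M)"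
proof -
  have "cmod (Kop z f k) \<le> (\<integral>s. cmod (resolvent_kernel z k s * f s) \<partial>T3M)"
    unfolding Kop_def by (rule integral_norm_bound)
  also have "\<dots> \<le> (\<integral>s. 1 / d * cmod (f s) \<partial>T3M)"
    by (intro integral_mono integrable_norm integrable_kernel_mult assms integrable_mult_right)
      (simp add: norm_mult mult_right_mono[OF kernel_bound] del: divide_inverse times_divide_eq_left)
  finally show ?thesis by simp
qed

lemma Kop_bound_L2:
  assumes "L2 T3M f" shows "cmod (Kop z f k) \<le> 1 / d * sqrt (nsq T3M f)"
proof -
  have "(\<integral>s. cmod (f s) \<partial>T3M) \<le> sqrt (nsq T3M f)"
    using T3M.integral_sq_le[OF assms] by (intro real_le_rsqrt)
  then show ?thesis
    using Kop_bound[OF T3M.L2_integrable[OF assms], of k] d by (meson divide_nonneg_pos mult_left_mono order_trans zero_le_one)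
qed

text \<open>Dominated convergence with majorant \<open>cmod (f s) / d\<close>. The operator turns a
  function known almost everywhere into one that is continuous everywhere, which makes an equation
  between continuous functions possible.\<close>

lemma continuous_on_Kop:
  assumes "integrable T3M f" shows "continuous_on UNIV (Kop z f)"
  unfolding continuous_on_sequentially
proof (intro allI ballI impI, goal_cases)
  case (1 u k)
  then have u: "u \<longlonglongrightarrow> k" by simp
  have [measurable]: "f \<in> borel_measurable T3M" using assms by simp
  show ?case unfolding comp_def Kop_def
  proof (rule integral_dominated_convergence[where w = "\<lambda>s. 1 / d * cmod (f s)"])
    show "AE s in T3M. (\<lambda>n. resolvent_kernel z (u n) s * f s) \<longlonglongrightarrow> resolvent_kernel z k s * f s"
    proof (rule AE_I2, rule tendsto_mult[OF _ tendsto_const])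
      fix s
      have "continuous_on UNIV (\<lambda>k. resolvent_kernel z k s)" by (intro continuous_intros)
      then show "(\<lambda>n. resolvent_kernel z (u n) s) \<longlonglongrightarrow> resolvent_kernel z k s"
        using u by (auto simp: continuous_on_sequentially comp_def)
    qed
    show "AE s in T3M. norm (resolvent_kernel z (u n) s * f s) \<le> 1 / d * cmod (f s)" for n
      by (intro AE_I2) (simp add: norm_mult mult_right_mono[OF kernel_bound] del: divide_inverse times_divide_eq_left)
  qed (use assms in auto)
qed

lemma Kop_bcontfun:
  assumes "integrable T3M f" shows "(\<lambda>k. c * Kop z f k) \<in> bcontfun"
proof (rule bcontfun_normI)
  show "continuous_on UNIV (\<lambda>k. c * Kop z f k)"
    by (intro continuous_intros continuous_on_Kop assms)
  show "norm (c * Kop z f k) \<le> cmod c * (1 / d * (\<integral>s. cmod (f s) \<partial>T3M))" for k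
    unfolding norm_mult by (intro mult_left_mono Kop_bound assms) auto
qed

lemma Kop_add: "integrable T3M f \<Longrightarrow> integrable T3M g \<Longrightarrow> Kop z (\<lambda>s. f s + g s) k = Kop z f k + Kop z g k"
  unfolding Kop_def by (simp add: distrib_left integrable_kernel_mult)

lemma Kop_cmult: "Kop z (\<lambda>s. c * f s) k = c * Kop z f k"
  unfolding Kop_def by (simp add: mult.left_commute)

lemma Kop_cong_AE:
  assumes "f \<in> borel_measurable T3M" "g \<in> borel_measurable T3M" "AE s in T3M. f s = g s"
  shows "Kop z f k = Kop z g k"
  unfolding Kop_def using assms by (intro integral_cong_AE) auto

lemma Kop_measurable [measurable]:
  assumes "integrable T3M f" shows "Kop z f \<in> borel_measurable T3M"
  by (intro borel_measurable_T3M borel_measurable_continuous_onI continuous_on_Kop assms)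

lemma DeltaC_continuous: "continuous_on UNIV (DeltaC \<gamma> \<mu> z)"
  unfolding DeltaC_eq_Kop[abs_def] w1_def
  by (intro continuous_intros continuous_on_of_real continuous_on_Kop) simp_all

lemma DeltaC_measurable [measurable]: "DeltaC \<gamma> \<mu> z \<in> borel_measurable T3M"
  by (intro borel_measurable_T3M borel_measurable_continuous_onI DeltaC_continuous)

text \<open>Rounding the second variable to a grid makes the kernel degenerate, up to a uniformly small error.\<close>

lemma kernel_finite_rank_approx:
  assumes "0 < \<eta>"
  obtains q :: "real^3 \<Rightarrow> real^3" and J where "q \<in> measurable borel borel" "finite J" "q ` T3 \<subseteq> J"
    "\<And>k s. cmod (resolvent_kernel z k s - resolvent_kernel z k (q s)) \<le> \<eta>"
proof -
  \<comment> \<open>Each coordinate moves by at most \<open>1 / n\<close>, so \<open>w2\<close>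
    changes by at most \<open>9 / (2 * n)\<close> and the kernel by at most that over
    \<open>d\<^sup>2\<close>.\<close>
  obtain n :: nat where n: "9 / (2 * d\<^sup>2 * \<eta>) < real n" using reals_Archimedean2 by blast
  have "0 < 9 / (2 * d\<^sup>2 * \<eta>)" using assms d by simp
  then have n0: "0 < real n" using n by linarith
  define q :: "real^3 \<Rightarrow> real^3" where "q s = (\<chi> i. of_int \<lfloor>real n * s $ i\<rfloor> / real n)" for s
  define J where "J = (\<lambda>g. \<chi> i. of_int (g i) / real n :: real^3) ` (UNIV \<rightarrow>\<^sub>E {\<lfloor>- real n * pi\<rfloor>..\<lfloor>real n * pi\<rfloor>})"
  have "(\<lambda>s. \<lfloor>real n * s $ i\<rfloor>) \<in> measurable borel (count_space UNIV)" for i :: 3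
    by (intro measurable_compose[OF _ measurable_real_floor] borel_measurable_continuous_onI
        continuous_on_mult continuous_on_const continuous_on_component continuous_on_id)
  then have "q \<in> measurable borel borel"
    unfolding q_def
    by (subst borel_measurable_euclidean_space) (auto simp: Basis_vec_def inner_axis)
  moreover have "finite J" unfolding J_def by (intro finite_imageI finite_PiE) auto
  moreover have "q ` T3 \<subseteq> J"
  proof
    fix x assume "x \<in> q ` T3"
    then obtain s where s: "s \<in> T3" "x = q s" by auto
    have "(\<lambda>i. \<lfloor>real n * s $ i\<rfloor>) \<in> UNIV \<rightarrow>\<^sub>E {\<lfloor>- real n * pi\<rfloor>..\<lfloor>real n * pi\<rfloor>}"
    proof (intro PiE_I)
      fix i
      have "- pi \<le> s $ i" "s $ i \<le> pi" using s by (auto simp: T3_def less_imp_le)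
      then have "real n * (- pi) \<le> real n * s $ i" "real n * s $ i \<le> real n * pi"
        by (simp_all only: mult_left_mono less_imp_le[OF n0])
      then show "\<lfloor>real n * s $ i\<rfloor> \<in> {\<lfloor>- real n * pi\<rfloor>..\<lfloor>real n * pi\<rfloor>}"
        by (auto intro: floor_mono)
    qed auto
    then show "x \<in> J" unfolding J_def s q_def by (rule rev_image_eqI) simp
  qed
  moreover have "cmod (resolvent_kernel z k s - resolvent_kernel z k (q s)) \<le> \<eta>" for k s
  proof -
    have 1: "\<bar>s $ i - q s $ i\<bar> \<le> 1 / real n" for i
    proof -
      have "\<bar>real n * s $ i - of_int \<lfloor>real n * s $ i\<rfloor>\<bar> \<le> 1" by linarith
      moreover have "s $ i - q s $ i = (real n * s $ i - of_int \<lfloor>real n * s $ i\<rfloor>) / real n"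
        using n0 unfolding q_def by (simp add: diff_divide_distrib)
      ultimately show ?thesis using n0 by (simp add: divide_right_mono)
    qed
    have "\<bar>w2 k s - w2 k (q s)\<bar> \<le> 3/2 * (\<Sum>i\<in>(UNIV::3 set). 1 / real n)"
      by (rule order_trans[OF w2_lipschitz]) (intro mult_left_mono sum_mono 1, simp)
    then have "\<bar>w2 k s - w2 k (q s)\<bar> / d\<^sup>2 \<le> (9 / (2 * real n)) / d\<^sup>2"
      by (intro divide_right_mono) auto
    also have "\<dots> \<le> \<eta>" using n n0 d assms by (simp add: field_simps)
    finally show ?thesis using kernel_lipschitz[of k s "q s"] by linarith
  qed
  ultimately show ?thesis using that by blast
qed

text \<open>On the preimage of a grid point \<open>j\<close> under \<open>q\<close> the rounded
  kernel no longer depends on \<open>s\<close>, so its integral is a finite sum of functions of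
  \<open>k\<close> weighted by linear functionals of \<open>f\<close>.\<close>

lemma Kop_split:
  fixes q :: "real^3 \<Rightarrow> real^3"
  assumes q: "q \<in> measurable borel borel" "finite J" "q ` T3 \<subseteq> J"
    and \<eta>: "\<And>k s. cmod (resolvent_kernel z k s - resolvent_kernel z k (q s)) \<le> \<eta>"
    and f: "integrable T3M f"
  shows "cmod (Kop z f k - (\<Sum>j\<in>J. resolvent_kernel z k j * (\<integral>s. indicator (q -` {j}) s * f s \<partial>T3M)))
    \<le> \<eta> * (\<integral>s. cmod (f s) \<partial>T3M)"
proof -
  have [measurable]: "f \<in> borel_measurable T3M" using f by simp
  have qm [measurable]: "q \<in> measurable T3M borel" using borel_measurable_T3M[OF q(1)] .
  note int = integrable_indicator_vimage_mult[OF q(1) f]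
  have "(\<Sum>j\<in>J. resolvent_kernel z k j * (\<integral>s. indicator (q -` {j}) s * f s \<partial>T3M))
      = (\<integral>s. (\<Sum>j\<in>J. resolvent_kernel z k j * (indicator (q -` {j}) s * f s)) \<partial>T3M)"
    using int by (subst Bochner_Integration.integral_sum) auto
  also have "\<dots> = (\<integral>s. resolvent_kernel z k (q s) * f s \<partial>T3M)"
  proof (rule Bochner_Integration.integral_cong[OF refl])
    fix s assume "s \<in> space T3M"
    then have "q s \<in> J" using q(3) by auto
    have "(\<Sum>j\<in>J. resolvent_kernel z k j * (indicator (q -` {j}) s * f s))
        = (\<Sum>j\<in>J. if j = q s then resolvent_kernel z k (q s) * f s else 0)"
      by (intro sum.cong) (auto simp: indicator_def)
    then show "(\<Sum>j\<in>J. resolvent_kernel z k j * (indicator (q -` {j}) s * f s)) = resolvent_kernel z k (q s) * f s"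
      using \<open>q s \<in> J\<close> q(2) by simp
  qed
  finally have eq: "(\<Sum>j\<in>J. resolvent_kernel z k j * (\<integral>s. indicator (q -` {j}) s * f s \<partial>T3M))
      = (\<integral>s. resolvent_kernel z k (q s) * f s \<partial>T3M)" .
  have int2: "integrable T3M (\<lambda>s. resolvent_kernel z k (q s) * f s)"
  proof (rule Bochner_Integration.integrable_bound)
    show "integrable T3M (\<lambda>s. 1 / d * cmod (f s))" using f by simp
    show "AE s in T3M. norm (resolvent_kernel z k (q s) * f s) \<le> norm (1 / d * cmod (f s))"
      using d by (intro AE_I2) (simp add: norm_mult abs_mult mult_right_mono[OF kernel_bound] del: divide_inverse times_divide_eq_left)
  qed measurable
  have "Kop z f k - (\<integral>s. resolvent_kernel z k (q s) * f s \<partial>T3M)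
      = (\<integral>s. (resolvent_kernel z k s - resolvent_kernel z k (q s)) * f s \<partial>T3M)"
    unfolding Kop_def using int2 integrable_kernel_mult[OF f] by (simp add: left_diff_distrib)
  also have "cmod \<dots> \<le> (\<integral>s. cmod ((resolvent_kernel z k s - resolvent_kernel z k (q s)) * f s) \<partial>T3M)"
    by (rule integral_norm_bound)
  also have "\<dots> \<le> (\<integral>s. \<eta> * cmod (f s) \<partial>T3M)"
  proof (rule integral_mono)
    show "integrable T3M (\<lambda>s. cmod ((resolvent_kernel z k s - resolvent_kernel z k (q s)) * f s))"
      using int2 integrable_kernel_mult[OF f] by (simp add: left_diff_distrib)
  qed (use f in \<open>auto simp: norm_mult intro: mult_right_mono \<eta>\<close>)
  finally show ?thesis using eq by simp
qed

end

section \<open>Schur complement\<close>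

lemma inH_iff:
  "inH f \<longleftrightarrow> L2 T3M (fst f) \<and> L2 T3M2 (snd f) \<and>
     (AE x in T3M2. snd f (fst x, snd x) = snd f (snd x, fst x))"
  unfolding inH_def L2_iff_nn_integral by auto

lemma normH_eq:
  assumes "inH f" shows "normH f = sqrt (nsq T3M (fst f) + nsq T3M2 (snd f))"
  using assms unfolding normH_def inH_iff by (simp add: nn_integral_nsq)

lemma swap_measurable: "(\<lambda>x. (snd x, fst x)) \<in> measurable T3M2 T3M2"
  unfolding T3M2_def by (intro measurable_Pair measurable_fst measurable_snd)

lemma distr_swap: "distr T3M2 T3M2 (\<lambda>x. (snd x, fst x)) = T3M2"
  unfolding T3M2_def using T3M2.distr_pair_swap by (simp add: case_prod_beta')

lemma AE_swap: assumes "AE x in T3M2. P x" shows "AE x in T3M2. P (snd x, fst x)"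
proof -
  have "AE x in distr T3M2 T3M2 (\<lambda>x. (snd x, fst x)). P x" using assms unfolding distr_swap .
  then show ?thesis
    using AE_distrD[OF swap_measurable] by blast
qed

lemma integral_swap:
  fixes F :: "_ \<Rightarrow> complex"
  assumes "F \<in> borel_measurable T3M2"
  shows "(\<integral>x. F (snd x, fst x) \<partial>T3M2) = (\<integral>x. F x \<partial>T3M2)"
  using integral_distr[OF swap_measurable assms] by (simp add: distr_swap)

lemma AE_T3M2_sections: "AE x in T3M2. P x \<Longrightarrow> AE k in T3M. AE s in T3M. P (k, s)"
  unfolding T3M2_def by (rule T3M2.AE_pair)

text \<open>The adjoint of \<open>A12\<close> has norm at most 1: the factor 4 for the square of a
  sum of two copies is cancelled by the square of 1/2.\<close>

lemma L2_sym_sum: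
  assumes "L2 T3M f"
  shows "L2 T3M2 (\<lambda>x. (f (fst x) + f (snd x)) / 2)" "nsq T3M2 (\<lambda>x. (f (fst x) + f (snd x)) / 2) \<le> nsq T3M f"
proof -
  have L: "L2 T3M2 (\<lambda>x. f (fst x) + f (snd x))" "nsq T3M2 (\<lambda>x. f (fst x) + f (snd x)) \<le> 4 * nsq T3M f"
    unfolding T3M2_def
    using L2_add[OF T3M2.L2_fst(1)[OF assms] T3M2.L2_snd(1)[OF assms]]
      T3M2.L2_fst(2)[OF assms] T3M2.L2_snd(2)[OF assms] by auto
  show "L2 T3M2 (\<lambda>x. (f (fst x) + f (snd x)) / 2)" "nsq T3M2 (\<lambda>x. (f (fst x) + f (snd x)) / 2) \<le> nsq T3M f"
    using L2_cmult[OF L(1), of "1/2"] L(2) by (auto simp: norm_divide power2_eq_square)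
qed

lemma fst_Ashift: "fst (Ashift \<gamma> \<mu> z f) k =
   (complex_of_real (w1 \<gamma> k) - z) * fst f k + complex_of_real \<mu> * (\<integral>s. snd f (k, s) \<partial>T3M)"
  by (simp add: Ashift_def Aop_def algebra_simps)

lemma snd_Ashift: "snd (Ashift \<gamma> \<mu> z f) x =
   complex_of_real \<mu> * ((fst f (fst x) + fst f (snd x)) / 2) + (complex_of_real (w2 (fst x) (snd x)) - z) * snd f x"
  by (cases x) (simp add: Ashift_def Aop_def algebra_simps)

lemma inH_Ashift:
  assumes "inH f" shows "inH (Ashift \<gamma> \<mu> z f)"
proof -
  have f: "L2 T3M (fst f)" "L2 T3M2 (snd f)" "AE x in T3M2. snd f (fst x, snd x) = snd f (snd x, fst x)"
    using assms by (auto simp: inH_iff)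
  have "L2 T3M (\<lambda>k. (complex_of_real (w1 \<gamma> k) - z) * fst f k)"
  proof (rule L2_bounded_mult(1)[OF f(1)])
    show "(\<lambda>k. complex_of_real (w1 \<gamma> k) - z) \<in> borel_measurable T3M"
      unfolding w1_def by measurable
    show "cmod (complex_of_real (w1 \<gamma> k) - z) \<le> 6 + \<bar>\<gamma>\<bar> + cmod z" for k
      using norm_triangle_ineq4[of "complex_of_real (w1 \<gamma> k)" z] eps_bounds[of k]
      unfolding w1_def norm_of_real by linarith
  qed
  moreover have "L2 T3M (\<lambda>k. \<integral>s. snd f (k, s) \<partial>T3M)"
    using T3M2.L2_marginal(1) f(2) unfolding T3M2_def by blast
  ultimately have 1: "L2 T3M (fst (Ashift \<gamma> \<mu> z f))"
    unfolding fst_Ashift[abs_def] by (intro L2_add(1) L2_cmult(1))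
  have "L2 T3M2 (\<lambda>x. (complex_of_real (w2 (fst x) (snd x)) - z) * snd f x)"
  proof (rule L2_bounded_mult(1)[OF f(2)])
    show "(\<lambda>x. complex_of_real (w2 (fst x) (snd x)) - z) \<in> borel_measurable T3M2"
      by (rule borel_measurable_T3M2, intro borel_measurable_continuous_onI continuous_intros continuous_on_of_real)
    show "cmod (complex_of_real (w2 (fst x) (snd x)) - z) \<le> 18 + cmod z" for x
      using norm_triangle_ineq4[of "complex_of_real (w2 (fst x) (snd x))" z] w2_bounds[of "fst x" "snd x"]
      unfolding norm_of_real by linarith
  qed
  then have 2: "L2 T3M2 (snd (Ashift \<gamma> \<mu> z f))"
    unfolding snd_Ashift[abs_def] by (intro L2_add(1) L2_cmult(1) L2_sym_sum f)
  have "AE x in T3M2. snd (Ashift \<gamma> \<mu> z f) (fst x, snd x) = snd (Ashift \<gamma> \<mu> z f) (snd x, fst x)"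
    using f(3) unfolding snd_Ashift by eventually_elim (simp add: w2_commute add.commute)
  then show ?thesis using 1 2 by (simp add: inH_iff)
qed

lemma eqH_refl [simp]: "eqH f f" by (simp add: eqH_def)

section \<open>Elimination of the two-particle component\<close>

context gap_point
begin

lemma L2_kernel_mult:
  assumes "L2 T3M2 g"
  shows "L2 T3M2 (\<lambda>x. resolvent_kernel z (fst x) (snd x) * g x)"
    "nsq T3M2 (\<lambda>x. resolvent_kernel z (fst x) (snd x) * g x) \<le> (1/d)\<^sup>2 * nsq T3M2 g"
proof -
  have "(\<lambda>x. resolvent_kernel z (fst x) (snd x)) \<in> borel_measurable T3M2"
    by (rule borel_measurable_T3M2, intro borel_measurable_continuous_onI continuous_intros)
  then show "L2 T3M2 (\<lambda>x. resolvent_kernel z (fst x) (snd x) * g x)"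
    "nsq T3M2 (\<lambda>x. resolvent_kernel z (fst x) (snd x) * g x) \<le> (1/d)\<^sup>2 * nsq T3M2 g"
    using L2_bounded_mult[OF assms _ kernel_bound] by auto
qed

text \<open>The right-hand side left over for \<open>f1\<close> once the second row of
  \<open>(A - z) f = g\<close> has been solved for \<open>f2\<close>.\<close>

definition reduced_rhs :: "real \<Rightarrow> hvec \<Rightarrow> real^3 \<Rightarrow> complex" where
  "reduced_rhs \<mu> g k = fst g k - complex_of_real \<mu> * (\<integral>s. resolvent_kernel z k s * snd g (k, s) \<partial>T3M)"

text \<open>The unique \<open>f2\<close> that solves the second row when the first component is
  \<open>f1\<close>.\<close>

definition lift_snd :: "real \<Rightarrow> hvec \<Rightarrow> (real^3 \<Rightarrow> complex) \<Rightarrow> (real^3) \<times> (real^3) \<Rightarrow> complex" where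
  "lift_snd \<mu> g f1 x = resolvent_kernel z (fst x) (snd x) * (snd g x - complex_of_real \<mu> * ((f1 (fst x) + f1 (snd x)) / 2))"

lemma L2_reduced_rhs:
  assumes "inH g"
  shows "L2 T3M (reduced_rhs \<mu> g)"
    "nsq T3M (reduced_rhs \<mu> g) \<le> 2 * nsq T3M (fst g) + 2 * (\<mu>\<^sup>2 * ((1/d)\<^sup>2 * nsq T3M2 (snd g)))"
proof -
  have g: "L2 T3M (fst g)" "L2 T3M2 (snd g)" using assms by (auto simp: inH_iff)
  note K = L2_kernel_mult[OF g(2)]
  have m: "L2 T3M (\<lambda>k. \<integral>s. resolvent_kernel z k s * snd g (k, s) \<partial>T3M)"
    "nsq T3M (\<lambda>k. \<integral>s. resolvent_kernel z k s * snd g (k, s) \<partial>T3M) \<le> (1/d)\<^sup>2 * nsq T3M2 (snd g)"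
    using T3M2.L2_marginal[OF K(1)[unfolded T3M2_def]] K(2) unfolding T3M2_def by auto
  note c = L2_cmult[OF m(1), of "complex_of_real \<mu>"]
  show "L2 T3M (reduced_rhs \<mu> g)" unfolding reduced_rhs_def[abs_def]
    by (rule L2_diff(1)[OF g(1) c(1)])
  show "nsq T3M (reduced_rhs \<mu> g) \<le> 2 * nsq T3M (fst g) + 2 * (\<mu>\<^sup>2 * ((1/d)\<^sup>2 * nsq T3M2 (snd g)))"
    unfolding reduced_rhs_def[abs_def]
    by (rule order_trans[OF L2_diff(2)[OF g(1) c(1)]]) (use m(2) in \<open>simp add: c(2) mult_left_mono\<close>)
qed

lemma L2_lift_snd:
  assumes "inH g" "L2 T3M f1"
  shows "L2 T3M2 (lift_snd \<mu> g f1)"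
    "nsq T3M2 (lift_snd \<mu> g f1) \<le> (1/d)\<^sup>2 * (2 * nsq T3M2 (snd g) + 2 * (\<mu>\<^sup>2 * nsq T3M f1))"
proof -
  have g: "L2 T3M2 (snd g)" using assms by (auto simp: inH_iff)
  note c = L2_cmult[OF L2_sym_sum(1)[OF assms(2)], of "complex_of_real \<mu>"]
  note D = L2_diff[OF g c(1)]
  note K = L2_kernel_mult[OF D(1)]
  show "L2 T3M2 (lift_snd \<mu> g f1)" unfolding lift_snd_def[abs_def] by (rule K(1))
  show "nsq T3M2 (lift_snd \<mu> g f1) \<le> (1/d)\<^sup>2 * (2 * nsq T3M2 (snd g) + 2 * (\<mu>\<^sup>2 * nsq T3M f1))"
    unfolding lift_snd_def[abs_def]
  proof (rule order_trans[OF K(2)], rule mult_left_mono)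
    show "nsq T3M2 (\<lambda>x. snd g x - complex_of_real \<mu> * ((f1 (fst x) + f1 (snd x)) / 2))
       \<le> 2 * nsq T3M2 (snd g) + 2 * (\<mu>\<^sup>2 * nsq T3M f1)"
    proof -
      have "nsq T3M2 (\<lambda>x. complex_of_real \<mu> * ((f1 (fst x) + f1 (snd x)) / 2)) \<le> \<mu>\<^sup>2 * nsq T3M f1"
        unfolding c(2) using L2_sym_sum(2)[OF assms(2)] by (simp add: mult_left_mono)
      then show ?thesis using D(2) by linarith
    qed
  qed simp
qed

lemma lift_snd_sym:
  assumes "inH g"
  shows "AE x in T3M2. lift_snd \<mu> g f1 (fst x, snd x) = lift_snd \<mu> g f1 (snd x, fst x)"
proof -
  have "AE x in T3M2. snd g (fst x, snd x) = snd g (snd x, fst x)" using assms by (simp add: inH_iff)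
  then show ?thesis
    unfolding lift_snd_def by eventually_elim (simp add: kernel_commute add.commute)
qed

text \<open>Symmetrization is responsible for two terms: \<open>f1 k\<close> leaves the integral and
  later joins the diagonal to form \<open>DeltaC\<close>, whereas \<open>f1 s\<close> stays inside
  and gives the integral operator.\<close>

lemma integral_lift_snd:
  assumes "inH g" "L2 T3M f1"
  shows "AE k in T3M. (\<integral>s. lift_snd \<mu> g f1 (k, s) \<partial>T3M) =
    (\<integral>s. resolvent_kernel z k s * snd g (k, s) \<partial>T3M)
     - complex_of_real (\<mu> / 2) * (f1 k * Kop z (\<lambda>_. 1) k + Kop z f1 k)"
proof -
  have "L2 T3M2 (snd g)" using assms by (auto simp: inH_iff)
  then have "AE k in T3M. L2 T3M (\<lambda>s. snd g (k, s))" unfolding T3M2_def by (rule T3M2.AE_L2_section)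
  then show ?thesis
  proof eventually_elim
    fix k assume "L2 T3M (\<lambda>s. snd g (k, s))"
    then have i1: "integrable T3M (\<lambda>s. resolvent_kernel z k s * snd g (k, s))"
      by (intro integrable_kernel_mult T3M.L2_integrable)
    have i2: "integrable T3M (\<lambda>s. resolvent_kernel z k s * f1 s)"
      by (intro integrable_kernel_mult T3M.L2_integrable assms)
    have i3: "integrable T3M (\<lambda>s. resolvent_kernel z k s * 1)"
      by (rule integrable_kernel_mult) simp
    have "(\<integral>s. lift_snd \<mu> g f1 (k, s) \<partial>T3M) =
      (\<integral>s. resolvent_kernel z k s * snd g (k, s) - complex_of_real (\<mu> / 2) *
         (f1 k * (resolvent_kernel z k s * 1) + resolvent_kernel z k s * f1 s) \<partial>T3M)"
      unfolding lift_snd_def by (simp add: field_simps)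
    also have "\<dots> = (\<integral>s. resolvent_kernel z k s * snd g (k, s) \<partial>T3M)
     - complex_of_real (\<mu> / 2) * (f1 k * Kop z (\<lambda>_. 1) k + Kop z f1 k)"
      unfolding Kop_def using i1 i2 i3
      by (subst Bochner_Integration.integral_diff) auto
    finally show "(\<integral>s. lift_snd \<mu> g f1 (k, s) \<partial>T3M) =
    (\<integral>s. resolvent_kernel z k s * snd g (k, s) \<partial>T3M)
     - complex_of_real (\<mu> / 2) * (f1 k * Kop z (\<lambda>_. 1) k + Kop z f1 k)" .
  qed
qed

text \<open>The second row is divided by its nonvanishing multiplier and the result inserted into
  the first. The coupling \<open>\<mu>\<close> meets the \<open>\<mu> / 2\<close> of
  \<open>integral_lift_snd\<close> and gives \<open>\<mu>\<^sup>2 / 2\<close>.\<close>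

lemma reduction:
  assumes f: "inH f" and g: "inH g" and eq: "eqH (Ashift \<gamma> \<mu> z f) g"
  shows "AE x in T3M2. snd f x = lift_snd \<mu> g (fst f) x"
    and "AE k in T3M. DeltaC \<gamma> \<mu> z k * fst f k = reduced_rhs \<mu> g k + complex_of_real (\<mu>\<^sup>2 / 2) * Kop z (fst f) k"
proof -
  have L: "L2 T3M (fst f)" "L2 T3M2 (snd f)" using f by (auto simp: inH_iff)
  have "AE x in T3M2. snd (Ashift \<gamma> \<mu> z f) x = snd g x" using eq by (simp add: eqH_def)
  then show 1: "AE x in T3M2. snd f x = lift_snd \<mu> g (fst f) x"
  proof eventually_elim
    fix x assume "snd (Ashift \<gamma> \<mu> z f) x = snd g x"
    then show "snd f x = lift_snd \<mu> g (fst f) x"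
      unfolding snd_Ashift lift_snd_def resolvent_kernel_def
      using denom_nonzero[of "fst x" "snd x"] by (auto simp: field_simps)
  qed
  have "AE k in T3M. L2 T3M (\<lambda>s. snd f (k, s))"
    using L(2) unfolding T3M2_def by (rule T3M2.AE_L2_section)
  moreover have "AE k in T3M. L2 T3M (\<lambda>s. lift_snd \<mu> g (fst f) (k, s))"
    using L2_lift_snd(1)[OF g L(1)] unfolding T3M2_def by (rule T3M2.AE_L2_section)
  moreover note AE_T3M2_sections[OF 1] integral_lift_snd[OF g L(1), of \<mu>]
  moreover have "AE k in T3M. fst (Ashift \<gamma> \<mu> z f) k = fst g k" using eq by (simp add: eqH_def)
  ultimately show "AE k in T3M. DeltaC \<gamma> \<mu> z k * fst f k = reduced_rhs \<mu> g k + complex_of_real (\<mu>\<^sup>2 / 2) * Kop z (fst f) k"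
  proof eventually_elim
    case (elim k)
    have "(\<integral>s. snd f (k, s) \<partial>T3M) = (\<integral>s. lift_snd \<mu> g (fst f) (k, s) \<partial>T3M)"
      using elim(1-3) by (intro integral_cong_AE) (auto simp: L2_def)
    then have "fst g k = (complex_of_real (w1 \<gamma> k) - z) * fst f k + complex_of_real \<mu> *
       ((\<integral>s. resolvent_kernel z k s * snd g (k, s) \<partial>T3M)
         - complex_of_real (\<mu> / 2) * (fst f k * Kop z (\<lambda>_. 1) k + Kop z (fst f) k))"
      using elim(4,5) unfolding fst_Ashift by simp
    then show ?case
      unfolding DeltaC_eq_Kop reduced_rhs_def by (simp add: algebra_simps power2_eq_square)
  qed
qed

lemma reduction_converse:
  assumes g: "inH g" and f1: "L2 T3M f1"
    and eq: "AE k in T3M. DeltaC \<gamma> \<mu> z k * f1 k = reduced_rhs \<mu> g k + complex_of_real (\<mu>\<^sup>2 / 2) * Kop z f1 k"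
  shows "inH (f1, lift_snd \<mu> g f1)" "eqH (Ashift \<gamma> \<mu> z (f1, lift_snd \<mu> g f1)) g"
proof -
  show "inH (f1, lift_snd \<mu> g f1)"
    unfolding inH_iff using f1 L2_lift_snd(1)[OF g f1] lift_snd_sym[OF g] by auto
  have "snd (Ashift \<gamma> \<mu> z (f1, lift_snd \<mu> g f1)) x = snd g x" for x
    unfolding snd_Ashift lift_snd_def resolvent_kernel_def
    using denom_nonzero[of "fst x" "snd x"] by (auto simp: field_simps)
  moreover have "AE k in T3M. fst (Ashift \<gamma> \<mu> z (f1, lift_snd \<mu> g f1)) k = fst g k"
    using eq integral_lift_snd[OF g f1, of \<mu>]
  proof eventually_elim
    case (elim k)
    show ?case using elim unfolding fst_Ashift DeltaC_eq_Kop reduced_rhs_def fst_conv snd_conv elim(2)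
      by (auto simp: algebra_simps power2_eq_square)
  qed
  ultimately show "eqH (Ashift \<gamma> \<mu> z (f1, lift_snd \<mu> g f1)) g" by (simp add: eqH_def)
qed

end

section \<open>The reduced equation on bounded continuous functions\<close>

lemma AE_fst_T3M2: "AE k in T3M. P k \<Longrightarrow> AE x in T3M2. P (fst x)"
  using AE_distrD[of fst "T3M \<Otimes>\<^sub>M T3M" T3M P] unfolding T3M2_def T3M.distr_pair_fst by simp

lemma AE_snd_T3M2: "AE k in T3M. P k \<Longrightarrow> AE x in T3M2. P (snd x)"
  using AE_swap[OF AE_fst_T3M2] by simp

lemma apply_bcontfun_sum: "apply_bcontfun (\<Sum>i\<in>A. F i) x = (\<Sum>i\<in>A. apply_bcontfun (F i) x)"
  by (induction A rule: infinite_finite_induct) auto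

text \<open>\<open>Delta\<close> is bounded away from zero on \<open>T3\<close>, where the measure
  lives, so division by it is a bounded operation on square-integrable functions.\<close>

locale regular_point = gap_point +
  fixes \<gamma> \<mu> \<delta> :: real
  assumes \<delta>: "0 < \<delta>" and DeltaC_ge: "\<And>k. k \<in> T3 \<Longrightarrow> \<delta> \<le> cmod (DeltaC \<gamma> \<mu> z k)"
begin

abbreviation "Dl \<equiv> DeltaC \<gamma> \<mu> z"
abbreviation "c \<equiv> complex_of_real (\<mu>\<^sup>2 / 2)"

lemma Dl_nonzero: "k \<in> T3 \<Longrightarrow> Dl k \<noteq> 0"
  using DeltaC_ge[of k] \<delta> by auto

lemma L2_divide_Dl:
  assumes "L2 T3M f"
  shows "L2 T3M (\<lambda>k. f k / Dl k)" "nsq T3M (\<lambda>k. f k / Dl k) \<le> (1/\<delta>)\<^sup>2 * nsq T3M f"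
proof -
  have "cmod (1 / Dl k) \<le> 1 / \<delta>" if "k \<in> space T3M" for k
    using DeltaC_ge[of k] that \<delta> by (simp add: norm_divide frac_le)
  then show "L2 T3M (\<lambda>k. f k / Dl k)" "nsq T3M (\<lambda>k. f k / Dl k) \<le> (1/\<delta>)\<^sup>2 * nsq T3M f"
    using L2_bounded_mult[OF assms, of "\<lambda>k. 1 / Dl k" "1/\<delta>"] by auto
qed

text \<open>The compact term enters only through a uniform bound \<open>B\<close>, and
  \<open>C\<close> depends on neither \<open>f\<close> nor \<open>g\<close>. In this form the
  estimate serves both the boundedness of the inverse and the isolation of eigenvalues.\<close>

lemma a_priori_bound:
  "\<exists>C\<ge>0. \<forall>f g B. inH f \<longrightarrow> inH g \<longrightarrow> eqH (Ashift \<gamma> \<mu> z f) g \<longrightarrow> (\<forall>k. cmod (c * Kop z (fst f) k) \<le> B) \<longrightarrow>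
     nsq T3M (fst f) + nsq T3M2 (snd f) \<le> C * (nsq T3M (fst g) + nsq T3M2 (snd g) + B\<^sup>2)"
proof -
  \<comment> \<open>\<open>D\<close> and \<open>A\<close> bound the squared multipliers
    \<open>resolvent_kernel\<close> and \<open>1 / Dl\<close>; \<open>H\<close> then controls
    \<open>reduced_rhs\<close> by the data and \<open>P\<close> the first component. The factors 2
    come from squares of sums.\<close>
  define D where "D = (1/d)\<^sup>2"
  define A where "A = (1/\<delta>)\<^sup>2"
  define H where "H = 2 + 2 * \<mu>\<^sup>2 * D"
  define P where "P = A * (2 * H + 2)"
  have nn: "0 \<le> D" "0 \<le> A" "0 \<le> H" "0 \<le> P" unfolding D_def A_def H_def P_def by auto
  show ?thesis
  proof (intro exI[of _ "P + D * (2 + 2 * \<mu>\<^sup>2 * P)"] conjI allI impI)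
    show "0 \<le> P + D * (2 + 2 * \<mu>\<^sup>2 * P)" using nn by simp
    fix f g B
    assume f: "inH f" and g: "inH g" and eq: "eqH (Ashift \<gamma> \<mu> z f) g"
      and B: "\<forall>k. cmod (c * Kop z (fst f) k) \<le> B"
    have L: "L2 T3M (fst f)" "L2 T3M2 (snd f)" using f by (auto simp: inH_iff)
    define G where "G = nsq T3M (fst g) + nsq T3M2 (snd g)"
    have G: "nsq T3M (fst g) \<le> G" "nsq T3M2 (snd g) \<le> G" "0 \<le> G" unfolding G_def by auto
    note h = L2_reduced_rhs[OF g, of \<mu>]
    have v: "L2 T3M (\<lambda>k. c * Kop z (fst f) k)" "nsq T3M (\<lambda>k. c * Kop z (fst f) k) \<le> B\<^sup>2"
      using T3M.L2_bounded[of "\<lambda>k. c * Kop z (fst f) k" B] B Kop_measurable[OF T3M.L2_integrable[OF L(1)]]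
      by auto
    have "AE k in T3M. fst f k = (reduced_rhs \<mu> g k + c * Kop z (fst f) k) / Dl k"
      using reduction(2)[OF f g eq] AE_space
    proof eventually_elim
      case (elim k) then show ?case using Dl_nonzero[of k] by (simp add: field_simps)
    qed
    then have "nsq T3M (fst f) = nsq T3M (\<lambda>k. (reduced_rhs \<mu> g k + c * Kop z (fst f) k) / Dl k)"
      using L2_divide_Dl(1)[OF L2_add(1)[OF h(1) v(1)]] L(1) by (intro nsq_cong_AE) (auto simp: L2_def)
    also have "\<dots> \<le> A * (2 * nsq T3M (reduced_rhs \<mu> g) + 2 * B\<^sup>2)"
      unfolding A_def
      by (rule order_trans[OF L2_divide_Dl(2)[OF L2_add(1)[OF h(1) v(1)]]])
        (intro mult_left_mono order_trans[OF L2_add(2)[OF h(1) v(1)]] add_left_mono v(2), auto)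
    also have "\<dots> \<le> A * (2 * (H * G) + 2 * B\<^sup>2)"
    proof (intro mult_left_mono add_right_mono nn)
      have "\<mu>\<^sup>2 * (D * nsq T3M2 (snd g)) \<le> \<mu>\<^sup>2 * (D * G)" using G nn by (intro mult_left_mono) auto
      then show "nsq T3M (reduced_rhs \<mu> g) \<le> H * G"
        using h(2) G unfolding H_def D_def[symmetric] by (simp add: algebra_simps)
    qed auto
    also have "\<dots> \<le> P * (G + B\<^sup>2)"
    proof -
      have "2 * (H * G) + 2 * B\<^sup>2 \<le> (2 * H + 2) * (G + B\<^sup>2)"
        using nn G(3) mult_nonneg_nonneg[OF nn(3) zero_le_power2[of B]] by (simp add: algebra_simps)
      then show ?thesis unfolding P_def using nn(2) by (simp add: mult.assoc mult_left_mono)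
    qed
    finally have f1: "nsq T3M (fst f) \<le> P * (G + B\<^sup>2)" .
    have l: "L2 T3M2 (lift_snd \<mu> g (fst f))" "nsq T3M2 (lift_snd \<mu> g (fst f)) \<le> D * (2 * nsq T3M2 (snd g) + 2 * (\<mu>\<^sup>2 * nsq T3M (fst f)))"
      using L2_lift_snd[OF g L(1), of \<mu>] unfolding D_def by auto
    have "nsq T3M2 (snd f) = nsq T3M2 (lift_snd \<mu> g (fst f))"
      using reduction(1)[OF f g eq] l(1) L(2) by (intro nsq_cong_AE) (auto simp: L2_def)
    also have "\<dots> \<le> D * (2 * (G + B\<^sup>2) + 2 * (\<mu>\<^sup>2 * (P * (G + B\<^sup>2))))"
      using G f1 by (intro order_trans[OF l(2)] mult_left_mono add_mono nn) (auto intro: add_increasing2)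
    finally show "nsq T3M (fst f) + nsq T3M2 (snd f) \<le> (P + D * (2 + 2 * \<mu>\<^sup>2 * P)) * (nsq T3M (fst g) + nsq T3M2 (snd g) + B\<^sup>2)"
      using f1 unfolding G_def[symmetric] by (simp add: algebra_simps)
  qed
qed

text \<open>Substituting \<open>f1 = (h + v) / Dl\<close> with \<open>v = c * Kop z f1\<close> turns the reduced equation
  \<open>Dl * f1 = h + c * Kop z f1\<close> into \<open>v - Lop v = w\<close> for a bounded continuous unknown \<open>v\<close>, so that no
  space of classes modulo null sets is needed.\<close>

definition Lop :: "((real^3) \<Rightarrow>\<^sub>C complex) \<Rightarrow> ((real^3) \<Rightarrow>\<^sub>C complex)" where
  "Lop v = Bcontfun (\<lambda>k. c * Kop z (\<lambda>s. v s / Dl s) k)"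

lemma L2_bcontfun: "L2 T3M (apply_bcontfun v)"
proof (rule T3M.L2_bounded(1)[where C = "norm v"])
  show "apply_bcontfun v \<in> borel_measurable T3M"
    by (intro borel_measurable_T3M borel_measurable_continuous_onI) simp
qed (rule norm_bounded)

lemma integrable_bcontfun_divide: "integrable T3M (\<lambda>s. apply_bcontfun v s / Dl s)"
  by (intro T3M.L2_integrable L2_divide_Dl L2_bcontfun)

lemma integral_bcontfun_divide_le: "(\<integral>s. cmod (apply_bcontfun v s / Dl s) \<partial>T3M) \<le> norm v / \<delta>"
proof -
  have "(\<integral>s. cmod (apply_bcontfun v s / Dl s) \<partial>T3M) \<le> (\<integral>s. norm v / \<delta> \<partial>T3M)"
  proof (rule integral_mono)
    show "integrable T3M (\<lambda>s. cmod (apply_bcontfun v s / Dl s))" using integrable_bcontfun_divide by simp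
    show "cmod (apply_bcontfun v s / Dl s) \<le> norm v / \<delta>" if "s \<in> space T3M" for s
      using DeltaC_ge[of s] that \<delta> norm_bounded[of v s] by (simp add: norm_divide frac_le)
  qed simp
  then show ?thesis using T3M.prob_space by simp
qed

lemma apply_Kop_bcontfun:
  "integrable T3M f \<Longrightarrow> apply_bcontfun (Bcontfun (\<lambda>k. b * Kop z f k)) k = b * Kop z f k"
  by (subst Bcontfun_inverse[OF Kop_bcontfun]) auto

lemma apply_Lop: "apply_bcontfun (Lop v) k = c * Kop z (\<lambda>s. v s / Dl s) k"
  unfolding Lop_def by (rule apply_Kop_bcontfun[OF integrable_bcontfun_divide])

lemma linear_Lop: "linear Lop"
proof (rule linearI)
  fix u v :: "(real^3) \<Rightarrow>\<^sub>C complex" and r :: real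
  show "Lop (u + v) = Lop u + Lop v"
    by (rule bcontfun_eqI)
      (simp add: apply_Lop add_divide_distrib Kop_add integrable_bcontfun_divide distrib_left)
  show "Lop (r *\<^sub>R u) = r *\<^sub>R Lop u"
  proof (rule bcontfun_eqI)
    fix k
    have "Kop z (\<lambda>s. (r *\<^sub>R u) s / Dl s) k = complex_of_real r * Kop z (\<lambda>s. u s / Dl s) k"
      unfolding Kop_cmult[symmetric] by (simp add: scaleR_conv_of_real)
    then show "apply_bcontfun (Lop (r *\<^sub>R u)) k = apply_bcontfun (r *\<^sub>R Lop u) k"
      by (simp add: apply_Lop scaleR_conv_of_real)
  qed
qed

text \<open>Rounding the kernel splits \<open>Lop\<close> into a remainder \<open>R\<close> of norm
  at most 1/2 and finitely many rank-one terms.\<close>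

lemma Lop_fredholm:
  "\<exists>B. finite B \<and> {v. Lop v = v} \<subseteq> span B"
  "(\<And>v. Lop v = v \<Longrightarrow> v = 0) \<Longrightarrow> \<exists>C. \<forall>w. \<exists>v. v - Lop v = w \<and> norm v \<le> C * norm w"
proof -
  \<comment> \<open>Chosen so that \<open>cmod c * \<eta> / \<delta>\<close> is at most 1/2; the
    added 1 covers \<open>c = 0\<close>.\<close>
  define \<eta> where "\<eta> = \<delta> / (2 * (cmod c + 1))"
  have c0: "0 < 2 * (cmod c + 1)" by (intro mult_pos_pos add_nonneg_pos) auto
  have \<eta>0: "0 < \<eta>" using \<delta> c0 by (simp add: \<eta>_def)
  obtain q :: "real^3 \<Rightarrow> real^3" and J where q: "q \<in> measurable borel borel" "finite J" "q ` T3 \<subseteq> J"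
    and ap: "\<And>k s. cmod (resolvent_kernel z k s - resolvent_kernel z k (q s)) \<le> \<eta>"
    using kernel_finite_rank_approx[OF \<eta>0] by metis
  define l0 where "l0 j v = (\<integral>s. indicator (q -` {j}) s * (apply_bcontfun v s / Dl s) \<partial>T3M)" for j v
  \<comment> \<open>\<open>fredholm_alternative\<close> works over the reals, so each complex
    functional is split into real and imaginary part, the latter paired with \<open>\<i>\<close>
    times the same kernel function.\<close>
  define l where "l p v = (if snd p then Re (l0 (fst p) v) else Im (l0 (fst p) v))" for p :: "(real^3) \<times> bool" and v
  define a where "a p = Bcontfun (\<lambda>k. (if snd p then 1 else \<i>) * (c * resolvent_kernel z k (fst p)))" for p :: "(real^3) \<times> bool"
  define S where "S = J \<times> (UNIV :: bool set)"
  define R where "R v = Lop v - (\<Sum>p\<in>S. l p v *\<^sub>R a p)" for v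
  note int = integrable_indicator_vimage_mult[OF q(1) integrable_bcontfun_divide]
  have l0_add: "l0 j (u + v) = l0 j u + l0 j v" for j u v
    unfolding l0_def using int by (simp add: add_divide_distrib distrib_left)
  have l0_scale: "l0 j (r *\<^sub>R v) = complex_of_real r * l0 j v" for j r v
    unfolding l0_def integral_mult_right_zero[symmetric]
    by (simp add: scaleR_conv_of_real mult_ac)
  have l0_bound: "cmod (l0 j v) \<le> norm v / \<delta>" for j v
  proof -
    have "cmod (l0 j v) \<le> (\<integral>s. cmod (indicator (q -` {j}) s * (apply_bcontfun v s / Dl s)) \<partial>T3M)"
      unfolding l0_def by (rule integral_norm_bound)
    also have "\<dots> \<le> (\<integral>s. cmod (apply_bcontfun v s / Dl s) \<partial>T3M)"
      by (intro integral_mono integrable_norm int integrable_bcontfun_divide) (auto simp: indicator_def)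
    finally show ?thesis using integral_bcontfun_divide_le[of v] by linarith
  qed
  have bl: "bounded_linear (l p)" for p
  proof (rule bounded_linear_intro[where K = "1 / \<delta>"])
    show "l p (u + v) = l p u + l p v" "l p (r *\<^sub>R u) = r *\<^sub>R l p u" for u v r
      unfolding l_def by (auto simp: l0_add l0_scale)
    show "norm (l p v) \<le> norm v * (1 / \<delta>)" for v
      using l0_bound[of "fst p" v] abs_Re_le_cmod[of "l0 (fst p) v"] abs_Im_le_cmod[of "l0 (fst p) v"]
      unfolding l_def by auto
  qed
  have ap_a: "apply_bcontfun (a p) k = (if snd p then 1 else \<i>) * (c * resolvent_kernel z k (fst p))" for p k
  proof -
    have "(\<lambda>k. (if snd p then 1 else \<i>) * (c * resolvent_kernel z k (fst p))) \<in> bcontfun"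
    proof (rule bcontfun_normI)
      show "continuous_on UNIV (\<lambda>k. (if snd p then 1 else \<i>) * (c * resolvent_kernel z k (fst p)))"
        by (intro continuous_intros)
      show "norm ((if snd p then 1 else \<i>) * (c * resolvent_kernel z k (fst p))) \<le> cmod c * (1 / d)" for k
        using mult_left_mono[OF kernel_bound[of k "fst p"], of "cmod c"] by (simp add: norm_mult)
    qed
    then show ?thesis unfolding a_def by (subst Bcontfun_inverse) auto
  qed
  have sum: "apply_bcontfun (\<Sum>p\<in>S. l p v *\<^sub>R a p) k = c * (\<Sum>j\<in>J. resolvent_kernel z k j * l0 j v)" for v k
  proof -
    have "apply_bcontfun (\<Sum>p\<in>S. l p v *\<^sub>R a p) k = (\<Sum>j\<in>J. \<Sum>b\<in>UNIV. l (j, b) v *\<^sub>R apply_bcontfun (a (j, b)) k)"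
      unfolding S_def by (simp add: apply_bcontfun_sum sum.cartesian_product)
    also have "\<dots> = (\<Sum>j\<in>J. c * (resolvent_kernel z k j * l0 j v))"
    proof (rule sum.cong[OF refl])
      fix j
      show "(\<Sum>b\<in>UNIV. l (j, b) v *\<^sub>R apply_bcontfun (a (j, b)) k) = c * (resolvent_kernel z k j * l0 j v)"
        by (subst complex_eq[of "l0 j v"]) (simp add: UNIV_bool ap_a l_def scaleR_conv_of_real algebra_simps)
    qed
    finally show ?thesis by (simp add: sum_distrib_left)
  qed
  have linR: "linear R"
    unfolding R_def
    by (rule linearI) (simp_all add: linear_add[OF linear_Lop] linear_scale[OF linear_Lop]
        linear_add[OF bounded_linear.linear[OF bl]] linear_scale[OF bounded_linear.linear[OF bl]]
        scaleR_left_distrib sum.distrib scaleR_sum_right scaleR_diff_right)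
  have bR: "norm (R v) \<le> 1/2 * norm v" for v
  proof (rule norm_bound)
    fix k
    have "apply_bcontfun (R v) k = c * (Kop z (\<lambda>s. v s / Dl s) k - (\<Sum>j\<in>J. resolvent_kernel z k j * l0 j v))"
      unfolding R_def by (simp add: apply_Lop sum right_diff_distrib)
    also have "cmod \<dots> \<le> cmod c * (\<eta> * (norm v / \<delta>))"
      unfolding norm_mult
    proof (rule mult_left_mono)
      have "cmod (Kop z (\<lambda>s. v s / Dl s) k - (\<Sum>j\<in>J. resolvent_kernel z k j * l0 j v))
          \<le> \<eta> * (\<integral>s. cmod (v s / Dl s) \<partial>T3M)"
        unfolding l0_def by (rule Kop_split[OF q ap integrable_bcontfun_divide])
      also have "\<dots> \<le> \<eta> * (norm v / \<delta>)"
        using \<eta>0 by (intro mult_left_mono integral_bcontfun_divide_le) auto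
      finally show "cmod (Kop z (\<lambda>s. v s / Dl s) k - (\<Sum>j\<in>J. resolvent_kernel z k j * l0 j v)) \<le> \<eta> * (norm v / \<delta>)" .
    qed simp
    also have "\<dots> = cmod c / (2 * (cmod c + 1)) * norm v" using \<delta> by (simp add: \<eta>_def)
    also have "\<dots> \<le> 1/2 * norm v"
      by (rule mult_right_mono) (use c0 in \<open>simp_all add: field_simps del: norm_of_real\<close>)
    finally show "norm (apply_bcontfun (R v) k) \<le> 1/2 * norm v" .
  qed
  have finS: "finite S" unfolding S_def using q by simp
  have dec: "Lop v = R v + (\<Sum>p\<in>S. l p v *\<^sub>R a p)" for v unfolding R_def by simp
  show "\<exists>B. finite B \<and> {v. Lop v = v} \<subseteq> span B"
    by (rule fredholm_alternative(1)[where l = l and a = a and L = Lop, OF linR bR _ _ finS bl dec]) auto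
  show "\<exists>C. \<forall>w. \<exists>v. v - Lop v = w \<and> norm v \<le> C * norm w" if "\<And>v. Lop v = v \<Longrightarrow> v = 0"
    by (rule fredholm_alternative(2)[where l = l and a = a and L = Lop, OF linR bR _ _ finS bl dec])
      (auto intro: that)
qed

end

section \<open>Resolvent set and multiplicities\<close>

abbreviation zeroH :: hvec where "zeroH \<equiv> (\<lambda>_. 0, \<lambda>_. 0)"

lemma inH_zero [simp]: "inH zeroH"
  by (simp add: inH_iff L2_def)

lemma inH_diff:
  assumes "inH f" "inH g" shows "inH (\<lambda>k. fst f k - fst g k, \<lambda>x. snd f x - snd g x)"
proof -
  have "AE x in T3M2. snd f (fst x, snd x) = snd f (snd x, fst x)" "AE x in T3M2. snd g (fst x, snd x) = snd g (snd x, fst x)"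
    using assms by (auto simp: inH_iff)
  then have "AE x in T3M2. snd f (fst x, snd x) - snd g (fst x, snd x) = snd f (snd x, fst x) - snd g (snd x, fst x)"
    by eventually_elim simp
  then show ?thesis using assms by (auto simp: inH_iff intro: L2_diff)
qed

context gap_point
begin

lemma reduced_rhs_zero [simp]: "reduced_rhs \<mu> zeroH = (\<lambda>_. 0)"
  by (auto simp: reduced_rhs_def)

end

context regular_point
begin

definition eigvec :: "((real^3) \<Rightarrow>\<^sub>C complex) \<Rightarrow> hvec" where
  "eigvec v = (\<lambda>k. v k / Dl k, lift_snd \<mu> zeroH (\<lambda>k. v k / Dl k))"

lemma fst_eigvec: "fst (eigvec v) k = v k / Dl k"
  by (simp add: eigvec_def)

lemma Lop_fixed:
  assumes "Lop v = v" shows "apply_bcontfun v k = c * Kop z (\<lambda>s. v s / Dl s) k"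
  using apply_Lop[of v k] unfolding assms .

lemma eigvec_in_eigenspace:
  assumes "Lop v = v" shows "eigvec v \<in> eigenspace_A \<gamma> \<mu> z"
proof -
  have "AE k in T3M. Dl k * (v k / Dl k) = reduced_rhs \<mu> zeroH k + c * Kop z (\<lambda>s. v s / Dl s) k"
  proof (rule AE_I2)
    fix k assume "k \<in> space T3M"
    then show "Dl k * (v k / Dl k) = reduced_rhs \<mu> zeroH k + c * Kop z (\<lambda>s. v s / Dl s) k"
      unfolding Lop_fixed[OF assms, symmetric] using Dl_nonzero[of k] by simp
  qed
  from reduction_converse[OF inH_zero L2_divide_Dl(1)[OF L2_bcontfun] this]
  show ?thesis unfolding eigenspace_A_def eigvec_def by blast
qed

text \<open>A fixed point is recovered at every \<open>k\<close> from its first component, known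
  only almost everywhere, by applying \<open>c * Kop z\<close>. Hence passing to classes modulo null
  sets loses nothing.\<close>

lemma eigvec_eq_imp_eq:
  assumes "Lop u = u" "Lop v = v" "AE k in T3M. fst (eigvec u) k = fst (eigvec v) k"
  shows "u = v"
proof (rule bcontfun_eqI)
  fix k
  have "Kop z (\<lambda>s. u s / Dl s) k = Kop z (\<lambda>s. v s / Dl s) k"
    using assms(3) by (intro Kop_cong_AE borel_measurable_integrable integrable_bcontfun_divide) (simp add: fst_eigvec)
  then show "u k = v k"
    using Lop_fixed[OF assms(1), of k] Lop_fixed[OF assms(2), of k] by presburger
qed

text \<open>\<open>v = c * Kop z (fst f)\<close> is a bounded continuous fixed point, and the
  reduced equation returns \<open>fst f = v / Dl\<close> almost everywhere.\<close>

lemma eigenspace_eq_eigvec: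
  assumes "f \<in> eigenspace_A \<gamma> \<mu> z"
  obtains v where "Lop v = v" "eqH f (eigvec v)"
proof -
  have f: "inH f" "eqH (Ashift \<gamma> \<mu> z f) zeroH" using assms by (auto simp: eigenspace_A_def)
  have L: "L2 T3M (fst f)" "L2 T3M2 (snd f)" using f by (auto simp: inH_iff)
  define v where "v = Bcontfun (\<lambda>k. c * Kop z (fst f) k)"
  have v: "apply_bcontfun v k = c * Kop z (fst f) k" for k
    unfolding v_def by (rule apply_Kop_bcontfun[OF T3M.L2_integrable[OF L(1)]])
  have eq: "AE k in T3M. fst f k = v k / Dl k"
    using reduction(2)[OF f(1) inH_zero f(2)] AE_space
  proof eventually_elim
    case (elim k)
    then have "Dl k * fst f k = v k" by (simp only: v reduced_rhs_zero add_0)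
    then show ?case using Dl_nonzero[of k] elim by (simp add: field_simps)
  qed
  have "Lop v = v"
  proof (rule bcontfun_eqI)
    fix k
    have "Kop z (fst f) k = Kop z (\<lambda>s. v s / Dl s) k"
      by (intro Kop_cong_AE borel_measurable_integrable T3M.L2_integrable[OF L(1)] integrable_bcontfun_divide eq)
    then show "Lop v k = v k" by (simp only: v[of k] apply_Lop)
  qed
  moreover have "AE x in T3M2. snd f x = snd (eigvec v) x"
    using reduction(1)[OF f(1) inH_zero f(2)] AE_fst_T3M2[OF eq] AE_snd_T3M2[OF eq]
    by eventually_elim (simp add: eigvec_def lift_snd_def)
  ultimately show ?thesis using that eq by (auto simp: eqH_def eigvec_def)
qed

lemma inj_Lop_if_not_eigenvalue:
  assumes "\<not> is_eigenvalue_A \<gamma> \<mu> z" "Lop v = v" shows "v = 0"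
proof -
  have "eqH (eigvec v) zeroH"
    using assms eigvec_in_eigenspace unfolding is_eigenvalue_A_def by blast
  then have "AE k in T3M. fst (eigvec v) k = fst (eigvec 0) k"
    by (simp add: eqH_def eigvec_def)
  then show ?thesis
    using eigvec_eq_imp_eq[of v 0] assms(2) linear_0[OF linear_Lop] by simp
qed

text \<open>A finite real basis of the fixed points is carried by \<open>eigvec\<close>, which is
  real-linear, to a finite family that spans the eigenspace already with real coefficients.\<close>

lemma finite_multiplicity: "finite_multiplicity_A \<gamma> \<mu> z"
proof -
  obtain B0 where B0: "finite B0" "{v. Lop v = v} \<subseteq> span B0" using Lop_fredholm(1) by blast
  obtain B where B: "B \<subseteq> {v. Lop v = v}" "independent B" "{v. Lop v = v} \<subseteq> span B"
    using maximal_independent_subset by blast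
  have fin: "finite B" using independent_span_bound[OF B0(1) B(2)] B(1) B0(2) by auto
  have inj: "inj_on eigvec B"
  proof (rule inj_onI)
    fix u v assume "u \<in> B" "v \<in> B" "eigvec u = eigvec v"
    then show "u = v" using eigvec_eq_imp_eq[of u v] B(1) by auto
  qed
  show ?thesis unfolding finite_multiplicity_A_def
  proof (intro exI[of _ "eigvec ` B"] conjI ballI)
    show "eigvec ` B \<subseteq> eigenspace_A \<gamma> \<mu> z" using B(1) eigvec_in_eigenspace by auto
    fix f assume "f \<in> eigenspace_A \<gamma> \<mu> z"
    then obtain v where v: "Lop v = v" "eqH f (eigvec v)" by (rule eigenspace_eq_eigvec)
    then have "v \<in> span B" using B(3) by auto
    then obtain r where r: "v = (\<Sum>b\<in>B. r b *\<^sub>R b)" unfolding span_finite[OF fin] by auto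
    define c' where "c' x = complex_of_real (r (inv_into B eigvec x))" for x
    have c': "c' (eigvec b) = complex_of_real (r b)" if "b \<in> B" for b
      unfolding c'_def using inv_into_f_f[OF inj that] by simp
    have 1: "apply_bcontfun v k / Dl k = (\<Sum>b\<in>B. complex_of_real (r b) * (apply_bcontfun b k / Dl k))" for k
      by (subst r) (simp add: apply_bcontfun_sum scaleR_conv_of_real sum_divide_distrib)
    have fst: "fst (eigvec v) k = (\<Sum>b\<in>eigvec ` B. c' b * fst b k)" for k
      by (subst sum.reindex[OF inj]) (simp add: c' 1 fst_eigvec)
    have lin: "lift_snd \<mu> zeroH f x = (- resolvent_kernel z (fst x) (snd x) * complex_of_real \<mu> / 2) * f (fst x)
        + (- resolvent_kernel z (fst x) (snd x) * complex_of_real \<mu> / 2) * f (snd x)" for f x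
      unfolding lift_snd_def by (simp add: field_simps)
    have snd: "snd (eigvec v) x = (\<Sum>b\<in>eigvec ` B. c' b * snd b x)" for x
    proof -
      have "snd (eigvec v) x = (\<Sum>b\<in>B. complex_of_real (r b) * snd (eigvec b) x)"
        unfolding eigvec_def snd_conv lin 1 sum_distrib_left sum.distrib[symmetric]
        by (intro sum.cong refl) (simp add: algebra_simps)
      then show ?thesis by (subst sum.reindex[OF inj]) (simp add: c')
    qed
    have "eqH f (\<lambda>k. \<Sum>b\<in>eigvec ` B. c' b * fst b k, \<lambda>x. \<Sum>b\<in>eigvec ` B. c' b * snd b x)"
      using v(2) unfolding eqH_def by (simp add: fst snd)
    then show "\<exists>c'. eqH f (\<lambda>k. \<Sum>b\<in>eigvec ` B. c' b * fst b k, \<lambda>x. \<Sum>b\<in>eigvec ` B. c' b * snd b x)" by blast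
  qed (use fin in simp)
qed

text \<open>Without eigenvectors \<open>id - Lop\<close> is injective, hence onto with bounded
  solutions. Solving for \<open>v\<close> yields \<open>f1 = (h + v) / Dl\<close>; the norm bound on
  \<open>v\<close> is the uniform bound that the a priori estimate asks for.\<close>

lemma in_resolvent_if_not_eigenvalue:
  assumes "\<not> is_eigenvalue_A \<gamma> \<mu> z" shows "z \<in> resolvent_set \<gamma> \<mu>"
proof -
  obtain C where C: "\<And>w. \<exists>v. v - Lop v = w \<and> norm v \<le> C * norm w"
    using Lop_fredholm(2) inj_Lop_if_not_eigenvalue[OF assms] by blast
  have "\<exists>f. inH f \<and> eqH (Ashift \<gamma> \<mu> z f) g" if g: "inH g" for g
  proof -
    define h where "h = reduced_rhs \<mu> g"
    have h: "L2 T3M h" unfolding h_def by (rule L2_reduced_rhs(1)[OF g])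
    note hD = T3M.L2_integrable[OF L2_divide_Dl(1)[OF h]]
    define w where "w = Bcontfun (\<lambda>k. c * Kop z (\<lambda>s. h s / Dl s) k)"
    have w: "apply_bcontfun w k = c * Kop z (\<lambda>s. h s / Dl s) k" for k
      unfolding w_def by (rule apply_Kop_bcontfun[OF hD])
    obtain v where v: "v - Lop v = w" using C[of w] by blast
    define f1 where "f1 k = h k / Dl k + v k / Dl k" for k
    have f1: "L2 T3M f1" unfolding f1_def[abs_def]
      by (intro L2_add(1) L2_divide_Dl(1) h L2_bcontfun)
    have "v k = c * Kop z f1 k" for k
    proof -
      have "v = w + Lop v" using v by (simp add: algebra_simps)
      then have "v k = w k + Lop v k" by (metis plus_bcontfun.rep_eq)
      then show ?thesis unfolding f1_def[abs_def]
        by (simp add: w apply_Lop Kop_add[OF hD integrable_bcontfun_divide] distrib_left)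
    qed
    then have "AE k in T3M. Dl k * f1 k = reduced_rhs \<mu> g k + c * Kop z f1 k"
      using Dl_nonzero by (intro AE_I2) (simp add: f1_def h_def distrib_left)
    then show ?thesis using reduction_converse[OF g f1] by blast
  qed
  moreover have "\<exists>C. \<forall>f. inH f \<longrightarrow> normH f \<le> C * normH (Ashift \<gamma> \<mu> z f)"
  proof -
    obtain P where P: "P \<ge> 0" "\<And>f g B. \<lbrakk>inH f; inH g; eqH (Ashift \<gamma> \<mu> z f) g; \<forall>k. cmod (c * Kop z (fst f) k) \<le> B\<rbrakk> \<Longrightarrow>
     nsq T3M (fst f) + nsq T3M2 (snd f) \<le> P * (nsq T3M (fst g) + nsq T3M2 (snd g) + B\<^sup>2)"
      using a_priori_bound by blast
    define H where "H = 2 + 2 * \<mu>\<^sup>2 * (1/d)\<^sup>2"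
    define Q where "Q = (C * (cmod c * (1/d)))\<^sup>2 * ((1/\<delta>)\<^sup>2 * H)"
    have H0: "0 \<le> H" unfolding H_def by simp
    have Q0: "0 \<le> Q" unfolding Q_def using H0 by simp
    have "normH f \<le> sqrt (P * (1 + Q)) * normH (Ashift \<gamma> \<mu> z f)" if f: "inH f" for f
    proof -
      define g where "g = Ashift \<gamma> \<mu> z f"
      have g: "inH g" "eqH (Ashift \<gamma> \<mu> z f) g" unfolding g_def using inH_Ashift[OF f] by simp_all
      define G where "G = nsq T3M (fst g) + nsq T3M2 (snd g)"
      define h where "h = reduced_rhs \<mu> g"
      have h: "L2 T3M h" unfolding h_def by (rule L2_reduced_rhs(1)[OF g(1)])
      have L: "L2 T3M (fst f)" using f by (auto simp: inH_iff)
      note hD = T3M.L2_integrable[OF L2_divide_Dl(1)[OF h]]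
      define w where "w = Bcontfun (\<lambda>k. c * Kop z (\<lambda>s. h s / Dl s) k)"
      have w: "apply_bcontfun w k = c * Kop z (\<lambda>s. h s / Dl s) k" for k
        unfolding w_def by (rule apply_Kop_bcontfun[OF hD])
      define v where "v = Bcontfun (\<lambda>k. c * Kop z (fst f) k)"
      have v: "apply_bcontfun v k = c * Kop z (fst f) k" for k
        unfolding v_def by (rule apply_Kop_bcontfun[OF T3M.L2_integrable[OF L]])
      have eq: "AE k in T3M. fst f k = h k / Dl k + v k / Dl k"
        using reduction(2)[OF f g] AE_space
      proof eventually_elim
        case (elim k)
        then have "Dl k * fst f k = h k + v k" by (simp only: v h_def)
        then show ?case using Dl_nonzero[of k] elim by (simp add: field_simps)
      qed
      have vw: "v - Lop v = w"
      proof (rule bcontfun_eqI)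
        fix k
        have "Kop z (fst f) k = Kop z (\<lambda>s. h s / Dl s + v s / Dl s) k"
          using L eq hD integrable_bcontfun_divide[of v]
          by (intro Kop_cong_AE borel_measurable_add) (auto simp: L2_def)
        then show "apply_bcontfun (v - Lop v) k = apply_bcontfun w k"
          unfolding minus_bcontfun.rep_eq v[of k] w apply_Lop
          by (simp only: Kop_add[OF hD integrable_bcontfun_divide] distrib_left add_diff_cancel_right')
      qed
      \<comment> \<open>\<open>v'\<close> comes with a norm bound, \<open>v\<close> comes from the
        given \<open>f\<close>; injectivity identifies them.\<close>
      obtain v' where v': "v' - Lop v' = w" "norm v' \<le> C * norm w" using C[of w] by blast
      have "Lop (v - v') = Lop v - Lop v'" by (rule linear_diff[OF linear_Lop])
      also have "\<dots> = v - v'"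
      proof -
        have "(v - Lop v) - (v' - Lop v') = 0" by (simp only: vw v'(1) diff_self)
        then show ?thesis by (simp add: algebra_simps)
      qed
      finally have "v = v'" using inj_Lop_if_not_eigenvalue[OF assms, of "v - v'"] by simp
      have nw: "norm w \<le> cmod c * (1/d * sqrt (nsq T3M (\<lambda>s. h s / Dl s)))"
        by (rule norm_bound) (simp only: w norm_mult mult_left_mono Kop_bound_L2[OF L2_divide_Dl(1)[OF h]] norm_ge_zero)
      define B where "B = C * norm w"
      have bd: "\<forall>k. cmod (c * Kop z (fst f) k) \<le> B"
      proof
        fix k
        have "cmod (c * Kop z (fst f) k) \<le> norm v" using norm_bounded[of v k] unfolding v .
        also have "\<dots> \<le> B" using v'(2) \<open>v = v'\<close> unfolding B_def by simp
        finally show "cmod (c * Kop z (fst f) k) \<le> B" .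
      qed
      have "B\<^sup>2 = C\<^sup>2 * (norm w)\<^sup>2" by (simp add: B_def power_mult_distrib)
      also have "\<dots> \<le> C\<^sup>2 * (cmod c * (1/d * sqrt (nsq T3M (\<lambda>s. h s / Dl s))))\<^sup>2"
        by (intro mult_left_mono power_mono nw) auto
      also have "\<dots> = (C * (cmod c * (1/d)))\<^sup>2 * nsq T3M (\<lambda>s. h s / Dl s)"
        by (simp add: power_mult_distrib power_divide)
      also have "\<dots> \<le> (C * (cmod c * (1/d)))\<^sup>2 * ((1/\<delta>)\<^sup>2 * (H * G))"
      proof (intro mult_left_mono order_trans[OF L2_divide_Dl(2)[OF h]])
        have "(\<mu>\<^sup>2 * ((1/d)\<^sup>2 * nsq T3M2 (snd g))) \<le> \<mu>\<^sup>2 * ((1/d)\<^sup>2 * G)"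
          unfolding G_def by (intro mult_left_mono) auto
        moreover have "nsq T3M (fst g) \<le> G" unfolding G_def by simp
        ultimately show "nsq T3M h \<le> H * G"
          using L2_reduced_rhs(2)[OF g(1), of \<mu>] unfolding h_def H_def by (simp add: algebra_simps)
      qed auto
      finally have B2: "B\<^sup>2 \<le> Q * G" unfolding Q_def by (simp add: mult_ac)
      have "nsq T3M (fst f) + nsq T3M2 (snd f) \<le> P * (G + B\<^sup>2)"
        using P(2)[OF f g bd] unfolding G_def .
      also have "\<dots> \<le> P * (G + Q * G)" using B2 P(1) by (intro mult_left_mono) auto
      also have "\<dots> = P * (1 + Q) * G" by (simp add: algebra_simps)
      finally have "sqrt (nsq T3M (fst f) + nsq T3M2 (snd f)) \<le> sqrt (P * (1 + Q)) * sqrt G"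
        by (simp flip: real_sqrt_mult)
      then show ?thesis using normH_eq[OF f] normH_eq[OF g(1)] unfolding G_def g_def by simp
    qed
    then show ?thesis by blast
  qed
  ultimately show ?thesis unfolding resolvent_set_def by blast
qed

end

section \<open>Symmetry\<close>

definition ipH :: "hvec \<Rightarrow> hvec \<Rightarrow> complex" where
  "ipH f g = (\<integral>k. fst f k * cnj (fst g k) \<partial>T3M) + (\<integral>x. snd f x * cnj (snd g x) \<partial>T3M2)"

definition nsqH :: "hvec \<Rightarrow> real" where
  "nsqH f = nsq T3M (fst f) + nsq T3M2 (snd f)"

lemma integral_cnj_mult_swap:
  fixes f g :: "'a \<Rightarrow> complex"
  shows "(\<integral>x. f x * cnj (g x) \<partial>M) = cnj (\<integral>x. g x * cnj (f x) \<partial>M)"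
  by (simp add: mult.commute flip: Bochner_Integration.integral_cnj)

lemma ipH_commute: "ipH f g = cnj (ipH g f)"
  unfolding ipH_def by (subst (1 2) integral_cnj_mult_swap) simp

lemma ipH_self: "ipH f f = complex_of_real (nsqH f)"
  unfolding ipH_def nsqH_def nsq_def
  by (simp flip: complex_norm_square of_real_power)

lemma nsq_diff:
  assumes "L2 M f" "L2 M g"
  shows "nsq M (\<lambda>x. f x - g x) = nsq M f + nsq M g - 2 * Re (\<integral>x. f x * cnj (g x) \<partial>M)"
proof -
  have i: "integrable M (\<lambda>x. f x * cnj (g x))" by (intro integrable_L2_mult assms L2_cnj)
  note ab = assms[THEN L2_integrable_sq]
  have "(cmod (f x - g x))\<^sup>2 = (cmod (f x))\<^sup>2 + (cmod (g x))\<^sup>2 - 2 * Re (f x * cnj (g x))" for x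
    unfolding cmod_power2 by (simp add: power2_eq_square algebra_simps)
  then have "nsq M (\<lambda>x. f x - g x) = (\<integral>x. (cmod (f x))\<^sup>2 + (cmod (g x))\<^sup>2 - 2 * Re (f x * cnj (g x)) \<partial>M)"
    unfolding nsq_def by simp
  also have "\<dots> = nsq M f + nsq M g - 2 * (\<integral>x. Re (f x * cnj (g x)) \<partial>M)"
    unfolding nsq_def
    by (simp only: Bochner_Integration.integral_diff[OF Bochner_Integration.integrable_add[OF ab] integrable_mult_right[OF integrable_Re[OF i]]]
        Bochner_Integration.integral_add[OF ab] integral_mult_right_zero)
  also have "(\<integral>x. Re (f x * cnj (g x)) \<partial>M) = Re (\<integral>x. f x * cnj (g x) \<partial>M)"
    using i by (rule integral_Re)
  finally show ?thesis .
qed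

lemma nsqH_diff:
  assumes "inH f" "inH g"
  shows "nsqH (\<lambda>k. fst f k - fst g k, \<lambda>x. snd f x - snd g x) = nsqH f + nsqH g - 2 * Re (ipH f g)"
  using assms unfolding nsqH_def ipH_def inH_iff by (simp add: nsq_diff)

lemma nsq_eq_0_iff: "L2 M f \<Longrightarrow> nsq M f = 0 \<longleftrightarrow> (AE x in M. f x = 0)"
  unfolding nsq_def by (subst integral_nonneg_eq_0_iff_AE) (auto simp: L2_def)

lemma nsqH_eq_0_iff: "inH f \<Longrightarrow> nsqH f = 0 \<longleftrightarrow> eqH f zeroH"
  unfolding nsqH_def eqH_def inH_iff using nsq_nonneg[of T3M "fst f"] nsq_nonneg[of T3M2 "snd f"]
  by (auto simp: add_nonneg_eq_0_iff nsq_eq_0_iff)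

lemma nsqH_nonneg: "0 \<le> nsqH f" by (simp add: nsqH_def)

text \<open>The two off-diagonal entries are adjoint to each other. Exchanging the variables
  preserves the product measure, so by symmetry of \<open>g\<close> both halves of the symmetrized
  sum contribute equally.\<close>

lemma cross_term:
  assumes f: "L2 T3M f" and g: "L2 T3M2 g" and sym: "AE x in T3M2. g (fst x, snd x) = g (snd x, fst x)"
  shows "(\<integral>x. (f (fst x) + f (snd x)) / 2 * cnj (g x) \<partial>T3M2) = (\<integral>k. f k * cnj (\<integral>s. g (k, s) \<partial>T3M) \<partial>T3M)"
proof -
  have i1: "integrable T3M2 (\<lambda>x. f (fst x) * cnj (g x))"
    using integrable_L2_mult[OF T3M2.L2_fst(1)[OF f] L2_cnj[OF g[unfolded T3M2_def]]] unfolding T3M2_def .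
  have i2: "integrable T3M2 (\<lambda>x. f (snd x) * cnj (g x))"
    using integrable_L2_mult[OF T3M2.L2_snd(1)[OF f] L2_cnj[OF g[unfolded T3M2_def]]] unfolding T3M2_def .
  have m: "(\<lambda>x. f (snd x) * cnj (g x)) \<in> borel_measurable T3M2" using i2 by simp
  have "(\<integral>x. f (snd x) * cnj (g x) \<partial>T3M2) = (\<integral>x. f (fst x) * cnj (g (snd x, fst x)) \<partial>T3M2)"
    using integral_swap[OF m] by simp
  also have "\<dots> = (\<integral>x. f (fst x) * cnj (g x) \<partial>T3M2)"
  proof (rule integral_cong_AE)
    show "(\<lambda>x. f (fst x) * cnj (g (snd x, fst x))) \<in> borel_measurable T3M2"
      using measurable_compose[OF swap_measurable m] by simp
    show "AE x in T3M2. f (fst x) * cnj (g (snd x, fst x)) = f (fst x) * cnj (g x)"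
      using sym by eventually_elim simp
  qed (use i1 in simp)
  finally have "(\<integral>x. (f (fst x) + f (snd x)) / 2 * cnj (g x) \<partial>T3M2) = (\<integral>x. f (fst x) * cnj (g x) \<partial>T3M2)"
    using i1 i2 by (simp add: add_divide_distrib distrib_right)
  also have "\<dots> = (\<integral>k. (\<integral>s. f k * cnj (g (k, s)) \<partial>T3M) \<partial>T3M)"
    using T3M2.integral_fst'[OF i1[unfolded T3M2_def]] unfolding T3M2_def by simp
  finally show ?thesis by simp
qed

text \<open>The right-hand side is the sesquilinear form of \<open>A\<close>, written out in
  integrals so that its Hermitian symmetry is visible: exchanging \<open>f\<close> and
  \<open>g\<close> conjugates it.\<close>

lemma eigenvector_expand:
  assumes f: "inH f" and g: "inH g" and eq: "eqH (Ashift \<gamma> \<mu> z f) zeroH"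
  shows "z * ipH f g =
     (\<integral>k. complex_of_real (w1 \<gamma> k) * (fst f k * cnj (fst g k)) \<partial>T3M)
   + (\<integral>x. complex_of_real (w2 (fst x) (snd x)) * (snd f x * cnj (snd g x)) \<partial>T3M2)
   + complex_of_real \<mu> * ((\<integral>k. (\<integral>s. snd f (k, s) \<partial>T3M) * cnj (fst g k) \<partial>T3M)
     + cnj (\<integral>k. (\<integral>s. snd g (k, s) \<partial>T3M) * cnj (fst f k) \<partial>T3M))"
proof -
  have F: "L2 T3M (fst f)" "L2 T3M2 (snd f)" using f by (auto simp: inH_iff)
  have G: "L2 T3M (fst g)" "L2 T3M2 (snd g)" "AE x in T3M2. snd g (fst x, snd x) = snd g (snd x, fst x)"
    using g by (auto simp: inH_iff)
  have m1: "L2 T3M (\<lambda>k. \<integral>s. snd f (k, s) \<partial>T3M)"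
    using T3M2.L2_marginal(1)[OF F(2)[unfolded T3M2_def]] .
  have b1: "L2 T3M (\<lambda>k. complex_of_real (w1 \<gamma> k) * fst f k)"
  proof (rule L2_bounded_mult(1)[OF F(1)])
    show "(\<lambda>k. complex_of_real (w1 \<gamma> k)) \<in> borel_measurable T3M" unfolding w1_def by measurable
    show "cmod (complex_of_real (w1 \<gamma> k)) \<le> 6 + \<bar>\<gamma>\<bar>" for k
      using eps_bounds[of k] unfolding w1_def norm_of_real by linarith
  qed
  have b2: "L2 T3M2 (\<lambda>x. complex_of_real (w2 (fst x) (snd x)) * snd f x)"
  proof (rule L2_bounded_mult(1)[OF F(2)])
    show "(\<lambda>x. complex_of_real (w2 (fst x) (snd x))) \<in> borel_measurable T3M2"
      by (rule borel_measurable_T3M2, intro borel_measurable_continuous_onI continuous_intros continuous_on_of_real)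
    show "cmod (complex_of_real (w2 (fst x) (snd x))) \<le> 18" for x
      using w2_bounds[of "fst x" "snd x"] unfolding norm_of_real by linarith
  qed
  note s = L2_sym_sum(1)[OF F(1)]
  have e1: "AE k in T3M. z * (fst f k * cnj (fst g k)) = complex_of_real (w1 \<gamma> k) * fst f k * cnj (fst g k)
      + complex_of_real \<mu> * ((\<integral>s. snd f (k, s) \<partial>T3M) * cnj (fst g k))"
  proof -
    have "AE k in T3M. fst (Ashift \<gamma> \<mu> z f) k = 0" using eq by (simp add: eqH_def)
    then show ?thesis
    proof eventually_elim
      case (elim k)
      then have "z * fst f k = complex_of_real (w1 \<gamma> k) * fst f k + complex_of_real \<mu> * (\<integral>s. snd f (k, s) \<partial>T3M)"
        unfolding fst_Ashift by (simp add: algebra_simps)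
      then show ?case by (simp add: distrib_right mult.assoc flip: mult.assoc[of z])
    qed
  qed
  have e2: "AE x in T3M2. z * (snd f x * cnj (snd g x)) = complex_of_real (w2 (fst x) (snd x)) * snd f x * cnj (snd g x)
      + complex_of_real \<mu> * ((fst f (fst x) + fst f (snd x)) / 2 * cnj (snd g x))"
  proof -
    have "AE x in T3M2. snd (Ashift \<gamma> \<mu> z f) x = 0" using eq by (simp add: eqH_def)
    then show ?thesis
    proof eventually_elim
      case (elim x)
      then have "z * snd f x = complex_of_real (w2 (fst x) (snd x)) * snd f x + complex_of_real \<mu> * ((fst f (fst x) + fst f (snd x)) / 2)"
        unfolding snd_Ashift by (simp add: algebra_simps)
      then show ?case by (simp only: distrib_right mult.assoc flip: mult.assoc[of z])
    qed
  qed
  note i = integrable_L2_mult[OF _ L2_cnj[OF G(1)]] integrable_L2_mult[OF _ L2_cnj[OF G(2)]]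
  have "z * (\<integral>k. fst f k * cnj (fst g k) \<partial>T3M) = (\<integral>k. complex_of_real (w1 \<gamma> k) * fst f k * cnj (fst g k)
      + complex_of_real \<mu> * ((\<integral>s. snd f (k, s) \<partial>T3M) * cnj (fst g k)) \<partial>T3M)"
    unfolding integral_mult_right_zero[symmetric]
    by (intro integral_cong_AE e1 borel_measurable_integrable Bochner_Integration.integrable_add integrable_mult_right
        i(1)[OF F(1)] i(1)[OF b1] i(1)[OF m1])
  also have "\<dots> = (\<integral>k. complex_of_real (w1 \<gamma> k) * fst f k * cnj (fst g k) \<partial>T3M)
     + complex_of_real \<mu> * (\<integral>k. (\<integral>s. snd f (k, s) \<partial>T3M) * cnj (fst g k) \<partial>T3M)"
    using i(1)[OF b1] i(1)[OF m1] by (subst Bochner_Integration.integral_add) auto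
  finally have 1: "z * (\<integral>k. fst f k * cnj (fst g k) \<partial>T3M) = \<dots>" .
  have "z * (\<integral>x. snd f x * cnj (snd g x) \<partial>T3M2) = (\<integral>x. complex_of_real (w2 (fst x) (snd x)) * snd f x * cnj (snd g x)
      + complex_of_real \<mu> * ((fst f (fst x) + fst f (snd x)) / 2 * cnj (snd g x)) \<partial>T3M2)"
    unfolding integral_mult_right_zero[symmetric]
    by (intro integral_cong_AE e2 borel_measurable_integrable Bochner_Integration.integrable_add integrable_mult_right
        i(2)[OF F(2)] i(2)[OF b2] i(2)[OF s])
  also have "\<dots> = (\<integral>x. complex_of_real (w2 (fst x) (snd x)) * snd f x * cnj (snd g x) \<partial>T3M2)
     + complex_of_real \<mu> * (\<integral>x. (fst f (fst x) + fst f (snd x)) / 2 * cnj (snd g x) \<partial>T3M2)"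
    by (simp only: Bochner_Integration.integral_add[OF i(2)[OF b2] integrable_mult_right[OF i(2)[OF s]]] integral_mult_right_zero)
  also have "(\<integral>x. (fst f (fst x) + fst f (snd x)) / 2 * cnj (snd g x) \<partial>T3M2)
      = cnj (\<integral>k. (\<integral>s. snd g (k, s) \<partial>T3M) * cnj (fst f k) \<partial>T3M)"
    unfolding cross_term[OF F(1) G(2,3)] by (rule integral_cnj_mult_swap)
  finally show ?thesis using 1 unfolding ipH_def by (simp add: distrib_left mult.assoc)
qed

text \<open>Both \<open>z\<close> and \<open>cnj z'\<close> times the inner product equal the
  Hermitian form of \<open>A\<close>. With \<open>f = g\<close> this makes eigenvalues real; for
  distinct real eigenvalues it makes eigenvectors orthogonal.\<close>

lemma eigenvectors_ip:
  assumes f: "inH f" "eqH (Ashift \<gamma> \<mu> z f) zeroH" and g: "inH g" "eqH (Ashift \<gamma> \<mu> z' g) zeroH"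
  shows "(z - cnj z') * ipH f g = 0"
proof -
  define Q where "Q f g = (\<integral>k. complex_of_real (w1 \<gamma> k) * (fst f k * cnj (fst g k)) \<partial>T3M)
   + (\<integral>x. complex_of_real (w2 (fst x) (snd x)) * (snd f x * cnj (snd g x)) \<partial>T3M2)" for f g :: hvec
  define X where "X f g = (\<integral>k. (\<integral>s. snd f (k, s) \<partial>T3M) * cnj (fst g k) \<partial>T3M)" for f g :: hvec
  have Q: "cnj (Q g f) = Q f g"
    unfolding Q_def by (simp add: mult.commute flip: Bochner_Integration.integral_cnj)
  have 1: "z * ipH f g = Q f g + complex_of_real \<mu> * (X f g + cnj (X g f))"
    unfolding Q_def X_def by (rule eigenvector_expand[OF f(1) g(1) f(2)])
  have 2: "z' * ipH g f = Q g f + complex_of_real \<mu> * (X g f + cnj (X f g))"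
    unfolding Q_def X_def by (rule eigenvector_expand[OF g(1) f(1) g(2)])
  have "cnj z' * ipH f g = cnj (z' * ipH g f)" by (subst ipH_commute) simp
  also have "\<dots> = Q f g + complex_of_real \<mu> * (X f g + cnj (X g f))"
    unfolding 2 by (simp add: Q add.commute)
  finally show ?thesis using 1 by (simp add: left_diff_distrib)
qed

lemma nonreal_not_eigenvalue:
  assumes "Im z \<noteq> 0" shows "\<not> is_eigenvalue_A \<gamma> \<mu> z"
proof
  assume "is_eigenvalue_A \<gamma> \<mu> z"
  then obtain f where f: "inH f" "eqH (Ashift \<gamma> \<mu> z f) zeroH" "\<not> eqH f zeroH"
    unfolding is_eigenvalue_A_def eigenspace_A_def by blast
  have "z - cnj z \<noteq> 0" using assms by (auto simp: complex_eq_iff)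
  then have "ipH f f = 0" using eigenvectors_ip[OF f(1,2) f(1,2)] by simp
  then show False using ipH_self[of f] nsqH_eq_0_iff[OF f(1)] f(3) by simp
qed

lemma inH_cmult:
  assumes "inH f" shows "inH (\<lambda>k. a * fst f k, \<lambda>x. a * snd f x)"
proof -
  have "AE x in T3M2. snd f (fst x, snd x) = snd f (snd x, fst x)" using assms by (auto simp: inH_iff)
  then have "AE x in T3M2. a * snd f (fst x, snd x) = a * snd f (snd x, fst x)" by eventually_elim simp
  then show ?thesis using assms by (auto simp: inH_iff intro: L2_cmult)
qed

lemma nsqH_cmult:
  assumes "inH f" shows "nsqH (\<lambda>k. a * fst f k, \<lambda>x. a * snd f x) = (cmod a)\<^sup>2 * nsqH f"
  using assms unfolding nsqH_def inH_iff by (simp add: L2_cmult distrib_left)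

lemma Ashift_cmult:
  "Ashift \<gamma> \<mu> z (\<lambda>k. a * fst f k, \<lambda>x. a * snd f x) =
   (\<lambda>k. a * fst (Ashift \<gamma> \<mu> z f) k, \<lambda>x. a * snd (Ashift \<gamma> \<mu> z f) x)"
  by (rule prod_eqI; rule ext; simp only: fst_Ashift snd_Ashift fst_conv snd_conv integral_mult_right_zero)
    (simp_all add: algebra_simps add_divide_distrib)

lemma eigenvalue_unit_eigenvector:
  assumes "is_eigenvalue_A \<gamma> \<mu> z"
  obtains f where "inH f" "eqH (Ashift \<gamma> \<mu> z f) zeroH" "nsqH f = 1"
proof -
  obtain f where f: "inH f" "eqH (Ashift \<gamma> \<mu> z f) zeroH" "\<not> eqH f zeroH"
    using assms unfolding is_eigenvalue_A_def eigenspace_A_def by blast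
  define a where "a = complex_of_real (1 / sqrt (nsqH f))"
  have pos: "0 < nsqH f" using nsqH_eq_0_iff[OF f(1)] f(3) nsqH_nonneg[of f] by auto
  have "(cmod a)\<^sup>2 * nsqH f = 1" using pos unfolding a_def norm_of_real by (simp add: power_divide)
  moreover have "eqH (Ashift \<gamma> \<mu> z (\<lambda>k. a * fst f k, \<lambda>x. a * snd f x)) zeroH"
    using f(2) unfolding Ashift_cmult eqH_def by (auto elim: AE_mp)
  ultimately show ?thesis using that inH_cmult[OF f(1), of a] nsqH_cmult[OF f(1), of a] by metis
qed

section \<open>Isolation of eigenvalues\<close>

text \<open>A pigeonhole form of compactness. Up to a uniform error the image of \<open>F i\<close>
  is determined by finitely many bounded numbers \<open>l p (F i)\<close>; once these are rounded to
  a grid, finitely many codes are left for infinitely many indices.\<close>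

lemma (in gap_point) Kop_almost_equal:
  assumes I: "infinite I" and F: "\<And>i. i \<in> I \<Longrightarrow> L2 T3M (F i) \<and> nsq T3M (F i) \<le> 1" and e: "0 < e"
  obtains i j where "i \<in> I" "j \<in> I" "i \<noteq> j" "\<forall>k. cmod (Kop z (\<lambda>s. F i s - F j s) k) \<le> e"
proof -
  obtain q :: "real^3 \<Rightarrow> real^3" and J where q: "q \<in> measurable borel borel" "finite J" "q ` T3 \<subseteq> J"
    and ap: "\<And>k s. cmod (resolvent_kernel z k s - resolvent_kernel z k (q s)) \<le> e / 4"
    using kernel_finite_rank_approx[of "e / 4"] e by auto
  define l where "l p f = (\<integral>s. indicator (q -` {p}) s * f s \<partial>T3M)" for p and f :: "real^3 \<Rightarrow> complex"
  note int = integrable_indicator_vimage_mult[OF q(1)]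
  have F_int: "integrable T3M (F i)" if "i \<in> I" for i using F[OF that] T3M.L2_integrable by blast
  have F_le: "(\<integral>s. cmod (F i s) \<partial>T3M) \<le> 1" if "i \<in> I" for i
  proof (rule power2_le_imp_le)
    show "(\<integral>s. cmod (F i s) \<partial>T3M)\<^sup>2 \<le> 1\<^sup>2"
      using T3M.integral_sq_le[of "F i"] F[OF that] by auto
  qed simp
  have l_le: "cmod (l p (F i)) \<le> 1" if "i \<in> I" for i p
  proof -
    have "cmod (l p (F i)) \<le> (\<integral>s. cmod (indicator (q -` {p}) s * F i s) \<partial>T3M)"
      unfolding l_def by (rule integral_norm_bound)
    also have "\<dots> \<le> (\<integral>s. cmod (F i s) \<partial>T3M)"
      by (intro integral_mono integrable_norm int F_int that) (auto simp: indicator_def)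
    finally show ?thesis using F_le[OF that] by linarith
  qed
  \<comment> \<open>Half of \<open>e\<close> pays for rounding the kernel, as the difference of two
    of the functions has integral norm at most 2; the other half must cover \<open>card J\<close>
    terms of size at most \<open>2 / (d * N)\<close>.\<close>
  obtain N :: nat where N: "4 * real (card J) / (d * e) < real N" using reals_Archimedean2 by blast
  have N0: "0 < real N" using N d e by (meson divide_nonneg_pos le_less_trans mult_nonneg_nonneg mult_pos_pos of_nat_0_le_iff zero_le_numeral)
  define \<Phi> where "\<Phi> i = restrict (\<lambda>p. (\<lfloor>real N * Re (l p (F i))\<rfloor>, \<lfloor>real N * Im (l p (F i))\<rfloor>)) J" for i
  have fl: "\<lfloor>real N * x\<rfloor> \<in> {- int N..int N}" if "\<bar>x\<bar> \<le> 1" for x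
  proof -
    have "real N * \<bar>x\<bar> \<le> real N * 1" using that by (intro mult_left_mono) auto
    then have "\<bar>real N * x\<bar> \<le> real N" by (simp add: abs_mult)
    then show ?thesis by (simp add: le_floor_iff floor_le_iff abs_le_iff)
  qed
  have "\<Phi> ` I \<subseteq> J \<rightarrow>\<^sub>E ({- int N..int N} \<times> {- int N..int N})"
  proof
    fix y assume "y \<in> \<Phi> ` I"
    then obtain i where i: "i \<in> I" "y = \<Phi> i" by auto
    have "\<bar>Re (l p (F i))\<bar> \<le> 1" "\<bar>Im (l p (F i))\<bar> \<le> 1" for p
      using l_le[OF i(1), of p] abs_Re_le_cmod[of "l p (F i)"] abs_Im_le_cmod[of "l p (F i)"] by linarith+
    then show "y \<in> J \<rightarrow>\<^sub>E ({- int N..int N} \<times> {- int N..int N})"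
      unfolding i \<Phi>_def using fl by (intro restrict_PiE_iff[THEN iffD2]) auto
  qed
  then have "finite (\<Phi> ` I)" by (rule finite_subset) (intro finite_PiE q finite_cartesian_product finite_atLeastAtMost_int)
  then obtain i where i: "i \<in> I" "infinite {j \<in> I. \<Phi> j = \<Phi> i}"
    using pigeonhole_infinite[OF I] by blast
  then obtain j where j: "j \<in> I" "\<Phi> j = \<Phi> i" "j \<noteq> i"
  proof -
    have "infinite ({j \<in> I. \<Phi> j = \<Phi> i} - {i})" using i(2) by simp
    then show ?thesis using that by (metis (mono_tags, lifting) DiffE ex_in_conv finite.emptyI insertI1 mem_Collect_eq)
  qed
  have close: "\<bar>x - y\<bar> \<le> 1 / real N" if "\<lfloor>real N * x\<rfloor> = \<lfloor>real N * y\<rfloor>" for x y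
  proof -
    have "\<bar>real N * x - real N * y\<bar> \<le> 1" using that by linarith
    then have "real N * \<bar>x - y\<bar> \<le> 1" by (simp add: abs_mult flip: right_diff_distrib)
    then show ?thesis using N0 by (simp add: field_simps)
  qed
  have l_close: "cmod (l p (\<lambda>s. F i s - F j s)) \<le> 2 / real N" if "p \<in> J" for p
  proof -
    have "\<Phi> j p = \<Phi> i p" using j by simp
    then have eq: "\<lfloor>real N * Re (l p (F i))\<rfloor> = \<lfloor>real N * Re (l p (F j))\<rfloor>" "\<lfloor>real N * Im (l p (F i))\<rfloor> = \<lfloor>real N * Im (l p (F j))\<rfloor>"
      using that unfolding \<Phi>_def by auto
    have "l p (\<lambda>s. F i s - F j s) = l p (F i) - l p (F j)"
      unfolding l_def using int[OF F_int[OF i(1)]] int[OF F_int[OF j(1)]] by (simp add: right_diff_distrib)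
    then have "cmod (l p (\<lambda>s. F i s - F j s)) \<le> \<bar>Re (l p (F i)) - Re (l p (F j))\<bar> + \<bar>Im (l p (F i)) - Im (l p (F j))\<bar>"
      using cmod_le[of "l p (F i) - l p (F j)"] by simp
    then show ?thesis using close[OF eq(1)] close[OF eq(2)] by simp
  qed
  have D_int: "integrable T3M (\<lambda>s. F i s - F j s)" using F_int i(1) j(1) by simp
  have D_le: "(\<integral>s. cmod (F i s - F j s) \<partial>T3M) \<le> 2"
  proof -
    have "(\<integral>s. cmod (F i s - F j s) \<partial>T3M) \<le> (\<integral>s. cmod (F i s) + cmod (F j s) \<partial>T3M)"
      using D_int F_int[OF i(1)] F_int[OF j(1)] by (intro integral_mono norm_triangle_ineq4) auto
    also have "\<dots> \<le> 2" using F_int[OF i(1)] F_int[OF j(1)] F_le[OF i(1)] F_le[OF j(1)] by simp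
    finally show ?thesis .
  qed
  have "cmod (Kop z (\<lambda>s. F i s - F j s) k) \<le> e" for k
  proof -
    have 1: "cmod (Kop z (\<lambda>s. F i s - F j s) k - (\<Sum>p\<in>J. resolvent_kernel z k p * l p (\<lambda>s. F i s - F j s))) \<le> e / 4 * 2"
      unfolding l_def using e
      by (intro order_trans[OF Kop_split[OF q ap D_int]] mult_left_mono D_le) auto
    have "cmod (\<Sum>p\<in>J. resolvent_kernel z k p * l p (\<lambda>s. F i s - F j s)) \<le> (\<Sum>p\<in>J. 1 / d * (2 / real N))"
      by (intro sum_norm_le) (simp only: norm_mult, intro mult_mono kernel_bound l_close, use d in auto)
    also have "\<dots> = (4 * real (card J) / (d * e)) * (e / (2 * real N))" using e by simp
    also have "\<dots> \<le> real N * (e / (2 * real N))" using N N0 e by (intro mult_right_mono) auto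
    also have "\<dots> = e / 2" using N0 by simp
    finally have 2: "cmod (\<Sum>p\<in>J. resolvent_kernel z k p * l p (\<lambda>s. F i s - F j s)) \<le> e / 2" .
    show ?thesis
      using norm_triangle_ineq2[of "Kop z (\<lambda>s. F i s - F j s) k" "\<Sum>p\<in>J. resolvent_kernel z k p * l p (\<lambda>s. F i s - F j s)"] 1 2
      by linarith
  qed
  then show ?thesis using that[OF i(1) j(1)] j(3) by blast
qed

lemma Ashift_shift:
  "Ashift \<gamma> \<mu> z f = (\<lambda>k. fst (Ashift \<gamma> \<mu> z' f) k + (z' - z) * fst f k, \<lambda>x. snd (Ashift \<gamma> \<mu> z' f) x + (z' - z) * snd f x)"
  by (simp add: Ashift_def algebra_simps)

lemma Ashift_diff:
  assumes "inH f" "inH g"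
  shows "eqH (Ashift \<gamma> \<mu> z (\<lambda>k. fst f k - fst g k, \<lambda>x. snd f x - snd g x))
     (\<lambda>k. fst (Ashift \<gamma> \<mu> z f) k - fst (Ashift \<gamma> \<mu> z g) k, \<lambda>x. snd (Ashift \<gamma> \<mu> z f) x - snd (Ashift \<gamma> \<mu> z g) x)"
proof -
  have "AE k in T3M. L2 T3M (\<lambda>s. snd f (k, s))" "AE k in T3M. L2 T3M (\<lambda>s. snd g (k, s))"
    using assms unfolding inH_iff T3M2_def by (auto intro: T3M2.AE_L2_section)
  then have "AE k in T3M. fst (Ashift \<gamma> \<mu> z (\<lambda>k. fst f k - fst g k, \<lambda>x. snd f x - snd g x)) k
     = fst (Ashift \<gamma> \<mu> z f) k - fst (Ashift \<gamma> \<mu> z g) k"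
    by eventually_elim (simp add: fst_Ashift T3M.L2_integrable algebra_simps)
  moreover have "snd (Ashift \<gamma> \<mu> z (\<lambda>k. fst f k - fst g k, \<lambda>x. snd f x - snd g x)) x
     = snd (Ashift \<gamma> \<mu> z f) x - snd (Ashift \<gamma> \<mu> z g) x" for x
    by (simp add: snd_Ashift field_simps)
  ultimately show ?thesis by (simp add: eqH_def)
qed

text \<open>Infinitely many eigenvalues near a regular real point would give orthonormal eigenvectors,
  two of which are nearly identified by the compact part, contradicting the a priori bound for
  their difference.\<close>

lemma (in regular_point) finite_eigenvalues_near:
  assumes z: "z = complex_of_real x0"
  shows "\<exists>r>0. finite {x. \<bar>x - x0\<bar> < r \<and> is_eigenvalue_A \<gamma> \<mu> (complex_of_real x)}"
proof -
  obtain C where C: "C \<ge> 0" "\<And>f g B. \<lbrakk>inH f; inH g; eqH (Ashift \<gamma> \<mu> z f) g; \<forall>k. cmod (c * Kop z (fst f) k) \<le> B\<rbrakk> \<Longrightarrow>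
     nsq T3M (fst f) + nsq T3M2 (snd f) \<le> C * (nsq T3M (fst g) + nsq T3M2 (snd g) + B\<^sup>2)"
    using a_priori_bound by blast
  \<comment> \<open>Two orthonormal vectors differ by a vector of squared norm 2, while the a priori
    estimate will give at most \<open>C * 5 * r\<^sup>2\<close>; this radius keeps the latter below
    2.\<close>
  define r where "r = 1 / (4 * (C + 1))"
  have r: "0 < r" using C(1) by (simp add: r_def)
  have small: "C * (4 * r\<^sup>2 + r\<^sup>2) < 2"
  proof -
    have "C \<le> (C + 1)\<^sup>2" using C(1) by (simp add: power2_eq_square algebra_simps)
    then have "C / (C + 1)\<^sup>2 \<le> 1" using C(1) by (simp add: divide_le_eq)
    moreover have "C * (4 * r\<^sup>2 + r\<^sup>2) = 5 / 16 * (C / (C + 1)\<^sup>2)"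
    proof -
      have "r\<^sup>2 = 1 / (16 * (C + 1)\<^sup>2)"
        unfolding r_def by (simp only: power_divide power_mult_distrib power_one) simp
      then show ?thesis by simp
    qed
    ultimately show ?thesis by linarith
  qed
  define I where "I = {x. \<bar>x - x0\<bar> < r \<and> is_eigenvalue_A \<gamma> \<mu> (complex_of_real x)}"
  have "finite I"
  proof (rule ccontr)
    assume inf: "infinite I"
    have "\<forall>x\<in>I. \<exists>f. inH f \<and> eqH (Ashift \<gamma> \<mu> (complex_of_real x) f) zeroH \<and> nsqH f = 1"
      unfolding I_def using eigenvalue_unit_eigenvector by (metis (mono_tags, lifting) mem_Collect_eq)
    then obtain F where F: "\<And>x. x \<in> I \<Longrightarrow> inH (F x)" "\<And>x. x \<in> I \<Longrightarrow> eqH (Ashift \<gamma> \<mu> (complex_of_real x) (F x)) zeroH"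
      "\<And>x. x \<in> I \<Longrightarrow> nsqH (F x) = 1" by metis
    have L: "L2 T3M (fst (F x)) \<and> nsq T3M (fst (F x)) \<le> 1" if "x \<in> I" for x
    proof
      show "L2 T3M (fst (F x))" using F(1)[OF that] by (simp add: inH_iff)
      show "nsq T3M (fst (F x)) \<le> 1"
        using F(3)[OF that] nsq_nonneg[of T3M2 "snd (F x)"] unfolding nsqH_def by linarith
    qed
    have pos: "0 < r / (cmod c + 1)" using r by (intro divide_pos_pos add_nonneg_pos) auto
    obtain x y where xy: "x \<in> I" "y \<in> I" "x \<noteq> y"
      and K: "\<forall>k. cmod (Kop z (\<lambda>s. fst (F x) s - fst (F y) s) k) \<le> r / (cmod c + 1)"
      by (rule Kop_almost_equal[OF inf L pos]) blast+
    define e :: hvec where "e = (\<lambda>k. fst (F x) k - fst (F y) k, \<lambda>p. snd (F x) p - snd (F y) p)"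
    \<comment> \<open>\<open>(A - x0) e\<close> equals \<open>a * F x - b * F y\<close>, because
      each eigenvector is annihilated at its own eigenvalue; both coefficients are smaller than
      \<open>r\<close> in modulus.\<close>
    define a b where "a = complex_of_real (x - x0)" and "b = complex_of_real (y - x0)"
    define u v :: hvec where "u = (\<lambda>k. a * fst (F x) k, \<lambda>p. a * snd (F x) p)"
      and "v = (\<lambda>k. b * fst (F y) k, \<lambda>p. b * snd (F y) p)"
    define g :: hvec where "g = (\<lambda>k. fst u k - fst v k, \<lambda>p. snd u p - snd v p)"
    have eH: "inH e" unfolding e_def by (intro inH_diff F xy)
    have uH: "inH u" and vH: "inH v" unfolding u_def v_def by (intro inH_cmult F xy)+
    have gH: "inH g" unfolding g_def by (intro inH_diff uH vH)
    have "ipH (F x) (F y) = 0"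
      using eigenvectors_ip[OF F(1,2)[OF xy(1)] F(1,2)[OF xy(2)]] xy(3) by auto
    then have e2: "nsqH e = 2" unfolding e_def using F xy by (simp add: nsqH_diff)
    have eq: "eqH (Ashift \<gamma> \<mu> z e) g"
    proof -
      have X: "Ashift \<gamma> \<mu> z (F x) = (\<lambda>k. fst (Ashift \<gamma> \<mu> (complex_of_real x) (F x)) k + a * fst (F x) k,
          \<lambda>p. snd (Ashift \<gamma> \<mu> (complex_of_real x) (F x)) p + a * snd (F x) p)"
        unfolding a_def z of_real_diff by (rule Ashift_shift)
      have Y: "Ashift \<gamma> \<mu> z (F y) = (\<lambda>k. fst (Ashift \<gamma> \<mu> (complex_of_real y) (F y)) k + b * fst (F y) k,
          \<lambda>p. snd (Ashift \<gamma> \<mu> (complex_of_real y) (F y)) p + b * snd (F y) p)"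
        unfolding b_def z of_real_diff by (rule Ashift_shift)
      have "AE k in T3M. fst (Ashift \<gamma> \<mu> (complex_of_real x) (F x)) k = 0"
        "AE k in T3M. fst (Ashift \<gamma> \<mu> (complex_of_real y) (F y)) k = 0"
        "AE p in T3M2. snd (Ashift \<gamma> \<mu> (complex_of_real x) (F x)) p = 0"
        "AE p in T3M2. snd (Ashift \<gamma> \<mu> (complex_of_real y) (F y)) p = 0"
        using F(2)[OF xy(1)] F(2)[OF xy(2)] by (auto simp: eqH_def)
      note ae = this
      have "AE k in T3M. fst (Ashift \<gamma> \<mu> z e) k = fst (Ashift \<gamma> \<mu> z (F x)) k - fst (Ashift \<gamma> \<mu> z (F y)) k"
        "AE p in T3M2. snd (Ashift \<gamma> \<mu> z e) p = snd (Ashift \<gamma> \<mu> z (F x)) p - snd (Ashift \<gamma> \<mu> z (F y)) p"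
        using Ashift_diff[OF F(1)[OF xy(1)] F(1)[OF xy(2)], of \<gamma> \<mu> z] unfolding e_def eqH_def by auto
      note ae2 = this
      have "AE k in T3M. fst (Ashift \<gamma> \<mu> z e) k = fst g k"
        using ae(1,2) ae2(1) unfolding X Y g_def u_def v_def by eventually_elim simp
      moreover have "AE p in T3M2. snd (Ashift \<gamma> \<mu> z e) p = snd g p"
        using ae(3,4) ae2(2) unfolding X Y g_def u_def v_def by eventually_elim simp
      ultimately show ?thesis by (simp add: eqH_def)
    qed
    have bd: "\<forall>k. cmod (c * Kop z (fst e) k) \<le> r"
    proof
      fix k
      have "cmod (c * Kop z (fst e) k) \<le> cmod c * (r / (cmod c + 1))"
        unfolding norm_mult e_def fst_conv by (intro mult_left_mono K[rule_format]) auto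
      also have "\<dots> = (cmod c / (cmod c + 1)) * r" by simp
      also have "\<dots> \<le> 1 * r" using r by (intro mult_right_mono) (auto simp: divide_le_eq add_nonneg_pos)
      finally show "cmod (c * Kop z (fst e) k) \<le> r" by simp
    qed
    have sq: "(x - x0)\<^sup>2 \<le> r\<^sup>2" "(y - x0)\<^sup>2 \<le> r\<^sup>2"
      using xy r unfolding I_def by (auto intro!: power2_le_iff_abs_le[THEN iffD2])
    have "nsqH u \<le> r\<^sup>2" "nsqH v \<le> r\<^sup>2"
      unfolding u_def v_def using F xy sq by (simp_all add: nsqH_cmult a_def b_def del: of_real_diff)
    moreover have "nsqH g \<le> 2 * nsqH u + 2 * nsqH v"
      using L2_diff(2)[of T3M "fst u" "fst v"] L2_diff(2)[of T3M2 "snd u" "snd v"] uH vH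
      unfolding g_def nsqH_def inH_iff by simp
    ultimately have "nsqH g \<le> 4 * r\<^sup>2" by linarith
    moreover have "nsqH e \<le> C * (nsqH g + r\<^sup>2)"
      using C(2)[OF eH gH eq bd] unfolding nsqH_def .
    ultimately have "2 \<le> C * (4 * r\<^sup>2 + r\<^sup>2)"
      using mult_left_mono[OF add_right_mono[of "nsqH g" "4 * r\<^sup>2" "r\<^sup>2"] C(1)] e2 by linarith
    then show False using small by linarith
  qed
  then show ?thesis using r unfolding I_def by blast
qed

text \<open>The Herglotz property: \<open>Im (1 / (w - z))\<close> has the sign of
  \<open>Im z\<close>, so the two contributions to \<open>Im Delta\<close> cannot cancel, and the
  term \<open>- z\<close> alone gives the bound.\<close>

lemma nonreal_regular:
  assumes "Im z \<noteq> 0" shows "regular_point z \<bar>Im z\<bar> \<gamma> \<mu> \<bar>Im z\<bar>"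
proof -
  interpret gap_point z "\<bar>Im z\<bar>"
  proof
    show "\<bar>Im z\<bar> \<le> cmod (complex_of_real (w2 k s) - z)" for k s
      using abs_Im_le_cmod[of "complex_of_real (w2 k s) - z"] by simp
  qed (use assms in simp)
  show ?thesis
  proof (unfold_locales)
    fix k
    have int: "integrable T3M (\<lambda>t. resolvent_kernel z k t)"
      using integrable_kernel_mult[of "\<lambda>_. 1" k] by simp
    define P where "P = (\<integral>t. 1 / (cmod (complex_of_real (w2 k t) - z))\<^sup>2 \<partial>T3M)"
    have P: "0 \<le> P" unfolding P_def by simp
    have "Im (resolvent_kernel z k t) = Im z * (1 / (cmod (complex_of_real (w2 k t) - z))\<^sup>2)" for t
      unfolding resolvent_kernel_def by (simp add: Im_divide cmod_power2)
    then have "Im (\<integral>t. resolvent_kernel z k t \<partial>T3M) = Im z * P"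
      unfolding P_def integral_mult_right_zero[symmetric] by (subst integral_Im[OF int, symmetric]) simp
    then have "Im (DeltaC \<gamma> \<mu> z k) = - Im z * (1 + \<mu>\<^sup>2 / 2 * P)"
      unfolding DeltaC_def by (simp add: algebra_simps)
    moreover have "\<bar>Im z\<bar> * 1 \<le> \<bar>Im z\<bar> * \<bar>1 + \<mu>\<^sup>2 / 2 * P\<bar>" using P by (intro mult_left_mono) auto
    ultimately have "\<bar>Im z\<bar> \<le> \<bar>Im (DeltaC \<gamma> \<mu> z k)\<bar>" by (simp add: abs_mult)
    then show "\<bar>Im z\<bar> \<le> cmod (DeltaC \<gamma> \<mu> z k)" using abs_Im_le_cmod order_trans by blast
  qed (use assms in simp)
qed

lemma nonreal_in_resolvent:
  assumes "Im z \<noteq> 0" shows "z \<in> resolvent_set \<gamma> \<mu>"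
  using regular_point.in_resolvent_if_not_eigenvalue[OF nonreal_regular[OF assms]]
    nonreal_not_eigenvalue[OF assms] by blast

text \<open>Regularity is assumed on a whole interval, because each spectral point near
  \<open>x0\<close> has to be an eigenvalue before finiteness of the nearby eigenvalues can isolate
  \<open>x0\<close>. Nonreal neighbours are already in the resolvent set.\<close>

lemma real_regular_nbhd_disc_spectrum:
  assumes e: "0 < e" and reg: "\<And>x. \<bar>x - x0\<bar> < e \<Longrightarrow> \<exists>d \<delta>. regular_point (complex_of_real x) d \<gamma> \<mu> \<delta>"
    and sp: "complex_of_real x0 \<in> spectrum_A \<gamma> \<mu>"
  shows "complex_of_real x0 \<in> disc_spectrum_A \<gamma> \<mu>"
proof -
  have spec: "is_eigenvalue_A \<gamma> \<mu> (complex_of_real x)"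
    if "\<bar>x - x0\<bar> < e" "complex_of_real x \<in> spectrum_A \<gamma> \<mu>" for x
    using reg[OF that(1)] that(2) regular_point.in_resolvent_if_not_eigenvalue unfolding spectrum_A_def by blast
  obtain d \<delta> where r0: "regular_point (complex_of_real x0) d \<gamma> \<mu> \<delta>" using reg[of x0] e by auto
  obtain r where r: "r > 0" "finite {x. \<bar>x - x0\<bar> < r \<and> is_eigenvalue_A \<gamma> \<mu> (complex_of_real x)}"
    using regular_point.finite_eigenvalues_near[OF r0 refl] by blast
  define S where "S = {x. \<bar>x - x0\<bar> < r \<and> is_eigenvalue_A \<gamma> \<mu> (complex_of_real x)} - {x0}"
  have "finite S" using r(2) unfolding S_def by simp
  then obtain s where s: "s > 0" "\<And>x. x \<in> S \<Longrightarrow> s \<le> \<bar>x - x0\<bar>"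
    using finite_set_avoid[of S x0] unfolding S_def by (force simp: dist_real_def abs_minus_commute)
  define t where "t = min e (min r s)"
  have t: "0 < t" "t \<le> e" "t \<le> r" "t \<le> s" using e r s by (auto simp: t_def)
  have "ball (complex_of_real x0) t \<inter> spectrum_A \<gamma> \<mu> = {complex_of_real x0}"
  proof
    show "ball (complex_of_real x0) t \<inter> spectrum_A \<gamma> \<mu> \<subseteq> {complex_of_real x0}"
    proof
      fix y assume y: "y \<in> ball (complex_of_real x0) t \<inter> spectrum_A \<gamma> \<mu>"
      have "Im y = 0" using nonreal_in_resolvent[of y \<gamma> \<mu>] y unfolding spectrum_A_def by auto
      then have yr: "y = complex_of_real (Re y)" by (simp add: complex_eq_iff)
      have "dist (complex_of_real x0) (complex_of_real (Re y)) < t" using y yr by auto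
      then have n: "\<bar>Re y - x0\<bar> < t" by (simp only: dist_of_real dist_real_def abs_minus_commute)
      have "is_eigenvalue_A \<gamma> \<mu> (complex_of_real (Re y))"
        using spec[of "Re y"] n t(2) y yr by auto
      then have "Re y = x0" using s(2)[of "Re y"] n t unfolding S_def by fastforce
      then show "y \<in> {complex_of_real x0}" using yr by simp
    qed
    show "{complex_of_real x0} \<subseteq> ball (complex_of_real x0) t \<inter> spectrum_A \<gamma> \<mu>" using sp t by simp
  qed
  then show ?thesis
    unfolding disc_spectrum_A_def using sp t(1) spec[of x0] e regular_point.finite_multiplicity[OF r0] by auto
qed

section \<open>Singular sequences\<close>

lemma emeasure_T3M:
  assumes "B \<in> sets borel"
  shows "emeasure T3M (B \<inter> T3) = ennreal (1 / (2 * pi)^3) * emeasure lborel (B \<inter> cbox (\<chi> i. - pi) (\<chi> i. pi))"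
proof -
  have "B \<inter> T3 \<in> sets T3M" unfolding sets_T3M using assms by (simp add: sets_restrict_space_iff)
  then have "emeasure T3M (B \<inter> T3) = (\<integral>\<^sup>+t. indicator (B \<inter> T3) t \<partial>T3M)" by simp
  also have "\<dots> = (\<integral>\<^sup>+t. indicator B t \<partial>T3M)"
    by (rule nn_integral_cong) (auto simp: indicator_def)
  also have "\<dots> = ennreal (1 / (2 * pi)^3) * (\<integral>\<^sup>+t. indicator B t * indicator (cbox (\<chi> i. - pi) (\<chi> i. pi)) t \<partial>lborel)"
    using assms by (intro nn_integral_T3M) simp
  also have "(\<integral>\<^sup>+t. indicator B t * indicator (cbox (\<chi> i. - pi) (\<chi> i. pi)) t \<partial>lborel)
      = (\<integral>\<^sup>+t. indicator (B \<inter> cbox (\<chi> i. - pi) (\<chi> i. pi)) t \<partial>lborel)"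
    by (intro nn_integral_cong) (auto simp: indicator_def)
  also have "\<dots> = emeasure lborel (B \<inter> cbox (\<chi> i. - pi) (\<chi> i. pi))"
    using assms by (intro nn_integral_indicator) auto
  finally show ?thesis .
qed

text \<open>Points of \<open>T3\<close> on a face of the cube are the delicate case: they lie in the
  closure of the open box, so each ball around them still meets the box in a nonempty open
  set.\<close>

lemma T3_nbhd_measure_pos:
  assumes "k \<in> T3" "0 < r"
  shows "0 < measure T3M (ball k r \<inter> T3)"
proof -
  let ?O = "box (\<chi> i. - pi) (\<chi> i. pi) :: (real^3) set"
  have "box (\<chi> i. - pi) (\<chi> i. pi) \<noteq> ({} :: (real^3) set)"
    by (auto simp: box_ne_empty Basis_vec_def inner_axis)
  then have "closure ?O = cbox (\<chi> i. - pi) (\<chi> i. pi)" by (rule closure_box)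
  then have "k \<in> closure ?O" using assms(1) T3_subset_cbox by auto
  then have ne: "ball k r \<inter> ?O \<noteq> {}"
    using assms(2) open_Int_closure_eq_empty[OF open_ball, of k r ?O] by (metis IntI centre_in_ball empty_iff)
  have op: "open (ball k r \<inter> ?O)" by (intro open_Int open_ball open_box)
  have "\<not> negligible (ball k r \<inter> ?O)" using open_not_negligible[OF op ne] .
  then have "ball k r \<inter> ?O \<notin> null_sets lborel"
    using null_sets_completionI unfolding negligible_iff_null_sets by blast
  then have "emeasure lborel (ball k r \<inter> ?O) \<noteq> 0"
    using op by (auto simp: null_sets_def)
  moreover have "emeasure lborel (ball k r \<inter> ?O) \<le> emeasure lborel (ball k r \<inter> cbox (\<chi> i. - pi) (\<chi> i. pi))"
    by (rule emeasure_mono) (use box_subset_cbox in auto)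
  ultimately have "emeasure T3M (ball k r \<inter> T3) \<noteq> 0"
    by (subst emeasure_T3M) (auto simp: ennreal_eq_0_iff not_le)
  then show ?thesis by (simp add: T3M.emeasure_eq_measure zero_less_measure_iff)
qed

text \<open>The balls shrink to a null set, so their measures tend to zero yet stay positive.
  Positivity keeps the test vectors nonzero, smallness suppresses the integral terms in their
  residuals.\<close>

lemma exists_small_nbhd:
  assumes k: "k \<in> T3" and U: "open U" "k \<in> U" and e: "0 < e"
  obtains B where "B \<in> sets T3M" "B \<subseteq> U \<inter> T3" "0 < measure T3M B" "measure T3M B < e"
proof -
  define A where "A n = ball k (1 / real (Suc n)) \<inter> T3" for n
  have sets: "A n \<in> sets T3M" for n
    unfolding A_def sets_T3M by (simp add: sets_restrict_space_iff)
  have dec: "decseq A"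
  proof (rule decseq_SucI)
    fix n
    have "1 / real (Suc (Suc n)) \<le> 1 / real (Suc n)" by (intro frac_le) auto
    then show "A (Suc n) \<subseteq> A n" unfolding A_def using subset_ball[of "1 / real (Suc (Suc n))" "1 / real (Suc n)" k] by blast
  qed
  have INT: "(\<Inter>n. A n) = {k}"
  proof
    show "(\<Inter>n. A n) \<subseteq> {k}"
    proof
      fix x assume x: "x \<in> (\<Inter>n. A n)"
      show "x \<in> {k}"
      proof (rule ccontr)
        assume "x \<notin> {k}"
        then have "0 < dist k x" by simp
        then obtain n where "inverse (real (Suc n)) < dist k x" using reals_Archimedean by blast
        moreover have "dist k x < 1 / real (Suc n)" using x unfolding A_def by auto
        ultimately show False by (simp add: inverse_eq_divide)
      qed
    qed
  qed (use k in \<open>auto simp: A_def\<close>)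
  have "(\<lambda>n. measure T3M (A n)) \<longlonglongrightarrow> measure T3M (\<Inter>n. A n)"
    using sets dec by (intro T3M.finite_Lim_measure_decseq) auto
  moreover have "measure T3M {k} = 0"
  proof -
    have "emeasure lborel ({k} \<inter> cbox (\<chi> i. - pi) (\<chi> i. pi)) \<le> emeasure lborel {k}"
      by (intro emeasure_mono) auto
    then have "emeasure T3M ({k} \<inter> T3) = 0" by (subst emeasure_T3M) auto
    then show ?thesis using k by (simp add: measure_def)
  qed
  ultimately have "(\<lambda>n. measure T3M (A n)) \<longlonglongrightarrow> 0" using INT by simp
  then have "\<forall>\<^sub>F n in sequentially. measure T3M (A n) < e" using e by (rule order_tendstoD)
  moreover have "\<forall>\<^sub>F n in sequentially. A n \<subseteq> U"
  proof -
    obtain r where r: "r > 0" "ball k r \<subseteq> U" using U openE by blast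
    obtain N where N: "inverse (real (Suc N)) < r" using r reals_Archimedean by blast
    have "A n \<subseteq> U" if "n \<ge> N" for n
    proof -
      have "1 / real (Suc n) \<le> 1 / real (Suc N)" using that by (intro frac_le) auto
      then have "ball k (1 / real (Suc n)) \<subseteq> ball k r" using N by (intro subset_ball) (simp add: inverse_eq_divide)
      then show ?thesis using r unfolding A_def by auto
    qed
    then show ?thesis by (auto simp: eventually_sequentially)
  qed
  ultimately have "\<forall>\<^sub>F n in sequentially. measure T3M (A n) < e \<and> A n \<subseteq> U" by eventually_elim simp
  then obtain n where "measure T3M (A n) < e" "A n \<subseteq> U"
    using eventually_happens'[OF sequentially_bot] by blast
  then show ?thesis using that[OF sets[of n]] T3_nbhd_measure_pos[OF k, of "1 / real (Suc n)"] unfolding A_def by auto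
qed

lemma (in prob_space) L2_indicator:
  assumes "B \<in> sets M" shows "L2 M (indicator B)" "nsq M (indicator B) = measure M B"
proof -
  show "L2 M (indicator B)" using assms by (intro L2_bounded(1)[where C = 1]) (auto simp: indicator_def)
  have "nsq M (indicator B) = (\<integral>x. indicator B x \<partial>M)"
    unfolding nsq_def by (intro Bochner_Integration.integral_cong) (auto simp: indicator_def)
  then show "nsq M (indicator B) = measure M B" using assms by simp
qed

text \<open>Approximate eigenvectors contradict the lower bound in the definition of
  \<open>resolvent_set\<close>.\<close>

lemma in_spectrum_if_singular:
  assumes "\<And>e. 0 < e \<Longrightarrow> \<exists>f. inH f \<and> 0 < nsqH f \<and> nsqH (Ashift \<gamma> \<mu> z f) \<le> e * nsqH f"
  shows "z \<in> spectrum_A \<gamma> \<mu>"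
proof -
  have "\<not> (\<forall>f. inH f \<longrightarrow> normH f \<le> C * normH (Ashift \<gamma> \<mu> z f))" for C
  proof
    assume C: "\<forall>f. inH f \<longrightarrow> normH f \<le> C * normH (Ashift \<gamma> \<mu> z f)"
    define e where "e = 1 / (2 * (C\<^sup>2 + 1))"
    have e0: "0 < e" unfolding e_def by (simp add: add_nonneg_pos)
    obtain f where f: "inH f" "0 < nsqH f" "nsqH (Ashift \<gamma> \<mu> z f) \<le> e * nsqH f" using assms[OF e0] by blast
    have "sqrt (nsqH f) \<le> C * sqrt (nsqH (Ashift \<gamma> \<mu> z f))"
      using C f(1) normH_eq[OF f(1)] normH_eq[OF inH_Ashift[OF f(1)]] unfolding nsqH_def by metis
    then have "(sqrt (nsqH f))\<^sup>2 \<le> (C * sqrt (nsqH (Ashift \<gamma> \<mu> z f)))\<^sup>2"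
      by (rule power_mono) (simp add: nsqH_nonneg)
    then have "nsqH f \<le> C\<^sup>2 * nsqH (Ashift \<gamma> \<mu> z f)" by (simp add: power_mult_distrib nsqH_nonneg)
    also have "\<dots> \<le> C\<^sup>2 * (e * nsqH f)" by (intro mult_left_mono f) auto
    also have "\<dots> = (C\<^sup>2 * e) * nsqH f" by simp
    also have "\<dots> \<le> 1/2 * nsqH f"
    proof (rule mult_right_mono)
      show "C\<^sup>2 * e \<le> 1/2" unfolding e_def by (simp add: divide_le_eq add_nonneg_pos)
    qed (use f in simp)
    finally show False using f(2) by simp
  qed
  then show ?thesis unfolding spectrum_A_def resolvent_set_def by blast
qed

text \<open>On the diagonal \<open>w2 k k = 3 * eps k\<close>, which already takes every value in \<open>[0, 18]\<close>; this allows
  symmetric singular sequences supported on small squares \<open>B \<times> B\<close>.\<close>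

lemma band_subset_spectrum:
  assumes "0 \<le> x" "x \<le> 18" shows "complex_of_real x \<in> spectrum_A \<gamma> \<mu>"
proof (rule in_spectrum_if_singular)
  fix e :: real assume e: "0 < e"
  \<comment> \<open>Solves \<open>9 * (1 - cos \<theta>) = x\<close>, where the left side is
    \<open>w2\<close> at the diagonal point with all coordinates \<open>\<theta>\<close>.\<close>
  define \<theta> where "\<theta> = arccos (1 - x / 9)"
  define k :: "real^3" where "k = (\<chi> i. \<theta>)"
  have x: "- 1 \<le> 1 - x / 9" "1 - x / 9 \<le> 1" using assms by auto
  have \<theta>: "0 \<le> \<theta>" "\<theta> \<le> pi" "cos \<theta> = 1 - x / 9" unfolding \<theta>_def using x by (auto intro: arccos_lbound arccos_ubound)
  have k: "k \<in> T3" unfolding T3_def k_def using \<theta> pi_gt_zero by (auto intro: less_le_trans[of _ 0])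
  have wk: "w2 k k = x" unfolding w2_diag eps_def k_def using \<theta>(3) by simp
  define \<epsilon> where "\<epsilon> = sqrt (e / 2)"
  have \<epsilon>: "0 < \<epsilon>" "\<epsilon>\<^sup>2 = e / 2" using e by (auto simp: \<epsilon>_def)
  have "open {p :: (real^3) \<times> (real^3). \<bar>w2 (fst p) (snd p) - x\<bar> < \<epsilon>}"
    by (intro open_Collect_less continuous_intros)
  moreover have "(k, k) \<in> {p. \<bar>w2 (fst p) (snd p) - x\<bar> < \<epsilon>}" using wk \<epsilon> by simp
  ultimately obtain U V where UV: "open U" "open V" "(k, k) \<in> U \<times> V" "U \<times> V \<subseteq> {p. \<bar>w2 (fst p) (snd p) - x\<bar> < \<epsilon>}"
    by (rule open_prod_elim)
  have oUV: "open (U \<inter> V)" "k \<in> U \<inter> V" using UV by auto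
  have pos: "0 < e / (2 * (\<mu>\<^sup>2 + 1))" using e by (simp add: add_nonneg_pos)
  obtain B where B: "B \<in> sets T3M" "B \<subseteq> (U \<inter> V) \<inter> T3" "0 < measure T3M B" "measure T3M B < e / (2 * (\<mu>\<^sup>2 + 1))"
    using exists_small_nbhd[OF k oUV pos] by blast
  have BT: "B \<inter> T3 = B" using B(2) by blast
  define m where "m = measure T3M B"
  define f :: hvec where "f = (\<lambda>_. 0, indicator (B \<times> B))"
  have BB: "B \<times> B \<in> sets T3M2" unfolding T3M2_def using B(1) by auto
  interpret P2: prob_space T3M2 unfolding T3M2_def by (rule T3M2.prob_space_axioms)
  have mBB: "measure T3M2 (B \<times> B) = m\<^sup>2"
    unfolding T3M2_def m_def measure_def using B(1)
    by (simp add: T3M.emeasure_pair_measure_Times enn2real_mult power2_eq_square)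
  note ind = P2.L2_indicator[OF BB] T3M.L2_indicator[OF B(1)]
  have fH: "inH f" unfolding inH_iff f_def using ind by (auto simp: L2_def indicator_def)
  have nf: "nsqH f = m\<^sup>2" unfolding nsqH_def f_def using ind mBB by (simp add: nsq_def)
  \<comment> \<open>The first component of the residual has squared norm
    \<open>\<mu>\<^sup>2 * m ^ 3\<close>, against \<open>m\<^sup>2\<close> for \<open>f\<close>, so
    it is negligible for small \<open>m\<close>.\<close>
  have 1: "fst (Ashift \<gamma> \<mu> (complex_of_real x) f) k = complex_of_real (\<mu> * m) * indicator B k" for k
  proof -
    have "(\<integral>s. indicator (B \<times> B) (k, s) \<partial>T3M) = (\<integral>s. indicator B k * complex_of_real (indicator B s) \<partial>T3M)"
      by (intro Bochner_Integration.integral_cong) (auto simp: indicator_def)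
    also have "\<dots> = indicator B k * (\<integral>s. complex_of_real (indicator B s) \<partial>T3M)"
      by simp
    also have "\<dots> = indicator B k * complex_of_real m"
      using B(1) BT unfolding m_def integral_complex_of_real by simp
    finally show ?thesis unfolding fst_Ashift f_def by simp
  qed
  define b where "b p = (if p \<in> B \<times> B then complex_of_real (w2 (fst p) (snd p) - x) else 0)" for p
  have 2: "snd (Ashift \<gamma> \<mu> (complex_of_real x) f) p = b p * indicator (B \<times> B) p" for p
    unfolding snd_Ashift f_def b_def by (simp add: indicator_def)
  have b_m: "b \<in> borel_measurable T3M2"
  proof -
    have [measurable]: "(\<lambda>p. complex_of_real (w2 (fst p) (snd p) - x)) \<in> borel_measurable T3M2"
      by (rule borel_measurable_T3M2, intro borel_measurable_continuous_onI continuous_intros continuous_on_of_real)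
    show ?thesis unfolding b_def using BB by measurable
  qed
  have b_le: "cmod (b p) \<le> \<epsilon>" for p
  proof (cases "p \<in> B \<times> B")
    case True
    then have "\<bar>w2 (fst p) (snd p) - x\<bar> < \<epsilon>"
    proof -
      have "p \<in> U \<times> V" using True B(2) by auto
      then show ?thesis using UV(4) by blast
    qed
    then have "cmod (complex_of_real (w2 (fst p) (snd p) - x)) \<le> \<epsilon>" unfolding norm_of_real by simp
    then show ?thesis unfolding b_def by (simp only: True if_True)
  qed (use \<epsilon>(1) in \<open>simp add: b_def\<close>)
  have "nsqH (Ashift \<gamma> \<mu> (complex_of_real x) f) \<le> (\<mu> * m)\<^sup>2 * m + \<epsilon>\<^sup>2 * m\<^sup>2"
    unfolding nsqH_def 1[abs_def] 2[abs_def]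
    using L2_cmult(2)[OF ind(3), of "complex_of_real (\<mu> * m)"] L2_bounded_mult(2)[OF ind(1) b_m b_le] ind mBB
    by (simp add: m_def norm_mult power_mult_distrib)
  also have "\<dots> = (\<mu>\<^sup>2 * m + \<epsilon>\<^sup>2) * m\<^sup>2" by (simp add: power2_eq_square algebra_simps)
  also have "\<dots> \<le> e * m\<^sup>2"
  proof (rule mult_right_mono)
    have "(\<mu>\<^sup>2 + 1) * m \<le> e / 2"
    proof -
      have q: "0 < 2 * (\<mu>\<^sup>2 + 1)" by (simp add: add_nonneg_pos)
      have "m * (2 * (\<mu>\<^sup>2 + 1)) < e"
        using B(4) unfolding m_def[symmetric] pos_less_divide_eq[OF q] .
      then show ?thesis by (simp add: algebra_simps)
    qed
    moreover have "\<mu>\<^sup>2 * m \<le> (\<mu>\<^sup>2 + 1) * m" using B(3) unfolding m_def by (intro mult_right_mono) auto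
    ultimately show "\<mu>\<^sup>2 * m + \<epsilon>\<^sup>2 \<le> e" using \<epsilon>(2) by linarith
  qed simp
  finally show "\<exists>f. inH f \<and> 0 < nsqH f \<and> nsqH (Ashift \<gamma> \<mu> (complex_of_real x) f) \<le> e * nsqH f"
    using fH nf B(3) unfolding m_def[symmetric] by (intro exI[of _ f]) simp
qed

section \<open>The branch of zeros below the band\<close>

lemma gap_point_negative: "x < 0 \<Longrightarrow> gap_point (complex_of_real x) (- x)"
proof unfold_locales
  fix k s assume "x < 0"
  then show "- x \<le> cmod (complex_of_real (w2 k s) - complex_of_real x)"
    using w2_bounds[of k s] unfolding of_real_diff[symmetric] norm_of_real by linarith
qed simp

lemma DeltaC_of_real: "DeltaC \<gamma> \<mu> (complex_of_real x) k = complex_of_real (Delta \<gamma> \<mu> k x)"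
proof -
  have "resolvent_kernel (complex_of_real x) k t = complex_of_real (1 / (w2 k t - x))" for t
    by (simp add: resolvent_kernel_def)
  then have "(\<integral>t. resolvent_kernel (complex_of_real x) k t \<partial>T3M) = complex_of_real (Iint k x)"
    unfolding Iint_def integral_complex_of_real[symmetric] by (intro Bochner_Integration.integral_cong) auto
  then show ?thesis unfolding DeltaC_def Delta_def by simp
qed

text \<open>The test vector has \<open>f1\<close> concentrated near the zero \<open>k\<close> and
  \<open>f2\<close> chosen to annihilate the second row. What remains is \<open>Delta * f1\<close>,
  small by continuity, minus the integral term, whose squared norm is of order
  \<open>m\<^sup>2\<close> against \<open>m\<close>.\<close>

lemma branch_subset_spectrum:
  assumes x: "x < 0" and k: "k \<in> T3" and \<Delta>: "Delta \<gamma> \<mu> k x = 0"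
  shows "complex_of_real x \<in> spectrum_A \<gamma> \<mu>"
proof (rule in_spectrum_if_singular)
  fix e :: real assume e: "0 < e"
  interpret gap_point "complex_of_real x" "- x" by (rule gap_point_negative[OF x])
  let ?z = "complex_of_real x"
  define c where "c = \<mu>\<^sup>2 / 2"
  \<comment> \<open>Twice the square of the bound \<open>c / (- x)\<close> for the integral term,
    the 2 coming from the square of a difference.\<close>
  define H where "H = 2 * (c / x)\<^sup>2"
  have H: "0 \<le> H" unfolding H_def by simp
  define \<epsilon> where "\<epsilon> = sqrt (e / 4)"
  have \<epsilon>: "0 < \<epsilon>" "\<epsilon>\<^sup>2 = e / 4" using e by (auto simp: \<epsilon>_def)
  define U where "U = {k. cmod (DeltaC \<gamma> \<mu> ?z k) < \<epsilon>}"
  have U: "open U" "k \<in> U"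
    unfolding U_def using \<Delta> \<epsilon>(1)
    by (intro open_Collect_less continuous_on_norm DeltaC_continuous continuous_on_const, simp add: DeltaC_of_real)
  have pos: "0 < e / (2 * (H + 1))" using e H by (simp add: add_nonneg_pos)
  obtain B where B: "B \<in> sets T3M" "B \<subseteq> U \<inter> T3" "0 < measure T3M B" "measure T3M B < e / (2 * (H + 1))"
    using exists_small_nbhd[OF k U pos] by blast
  have BT: "B \<inter> T3 = B" using B(2) by blast
  define m where "m = measure T3M B"
  define f1 :: "real^3 \<Rightarrow> complex" where "f1 = indicator B"
  have f1: "L2 T3M f1" "nsq T3M f1 = m" unfolding f1_def m_def by (rule T3M.L2_indicator[OF B(1)])+
  define f :: hvec where "f = (f1, lift_snd \<mu> zeroH f1)"
  have fH: "inH f"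
    unfolding f_def inH_iff using f1(1) L2_lift_snd(1)[OF inH_zero f1(1)] lift_snd_sym[OF inH_zero] by auto
  have nf: "m \<le> nsqH f" unfolding nsqH_def f_def by (simp add: f1)
  define b where "b k = (if k \<in> B then DeltaC \<gamma> \<mu> ?z k else 0)" for k
  have b_m: "b \<in> borel_measurable T3M"
  proof -
    note DeltaC_measurable[measurable]
    show ?thesis unfolding b_def using B(1) by measurable
  qed
  have b_le: "cmod (b k) \<le> \<epsilon>" for k using B(2) \<epsilon>(1) unfolding b_def U_def by auto
  note int = T3M.L2_integrable[OF f1(1)]
  have K_le: "cmod (complex_of_real c * Kop ?z f1 k) \<le> c / (- x) * m" for k
  proof -
    have "(\<integral>s. cmod (f1 s) \<partial>T3M) = (\<integral>s. indicator B s \<partial>T3M)"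
      unfolding f1_def by (intro Bochner_Integration.integral_cong) (auto simp: indicator_def)
    also have "\<dots> = m" unfolding m_def using B(1) BT by simp
    finally have "cmod (Kop ?z f1 k) \<le> 1 / (- x) * m" using Kop_bound[OF int, of k] by simp
    moreover have c0: "0 \<le> c" by (simp add: c_def)
    ultimately have "c * cmod (Kop ?z f1 k) \<le> c * (1 / (- x) * m)" by (intro mult_left_mono)
    then show ?thesis by (simp only: norm_mult norm_of_real abs_of_nonneg[OF c0]) simp
  qed
  have AE: "AE k in T3M. fst (Ashift \<gamma> \<mu> ?z f) k = b k * f1 k - complex_of_real c * Kop ?z f1 k"
    using integral_lift_snd[OF inH_zero f1(1), of \<mu>]
  proof eventually_elim
    case (elim k)
    have "b k * f1 k = DeltaC \<gamma> \<mu> ?z k * f1 k" unfolding b_def f1_def by (simp add: indicator_def)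
    then show ?case using elim unfolding fst_Ashift f_def fst_conv snd_conv elim DeltaC_eq_Kop c_def
      by (simp add: algebra_simps power2_eq_square)
  qed
  have K2: "L2 T3M (\<lambda>k. complex_of_real c * Kop ?z f1 k)" "nsq T3M (\<lambda>k. complex_of_real c * Kop ?z f1 k) \<le> (c / (- x) * m)\<^sup>2"
    by (rule T3M.L2_bounded[OF _ K_le], intro borel_measurable_times borel_measurable_const Kop_measurable int)+
  note bf = L2_bounded_mult[OF f1(1) b_m b_le]
  have "nsq T3M (fst (Ashift \<gamma> \<mu> ?z f)) = nsq T3M (\<lambda>k. b k * f1 k - complex_of_real c * Kop ?z f1 k)"
    using AE inH_Ashift[OF fH, of \<gamma> \<mu> ?z] L2_diff(1)[OF bf(1) K2(1)]
    by (intro nsq_cong_AE) (auto simp: inH_iff L2_def)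
  also have "\<dots> \<le> 2 * (\<epsilon>\<^sup>2 * m) + 2 * (c / (- x) * m)\<^sup>2"
    using L2_diff(2)[OF bf(1) K2(1)] bf(2) K2(2) unfolding f1(2) by linarith
  also have "\<dots> = (e / 2 + H * m) * m" unfolding \<epsilon>(2) H_def by (simp add: power2_eq_square field_simps)
  also have "\<dots> \<le> e * m"
  proof (rule mult_right_mono)
    have "(H + 1) * m \<le> e / 2"
    proof -
      have q: "0 < 2 * (H + 1)" using H by (simp add: add_nonneg_pos)
      have "m * (2 * (H + 1)) < e"
        using B(4) unfolding m_def[symmetric] pos_less_divide_eq[OF q] .
      then show ?thesis by (simp add: algebra_simps)
    qed
    moreover have "H * m \<le> (H + 1) * m" unfolding m_def by (intro mult_right_mono) auto
    ultimately show "e / 2 + H * m \<le> e" by linarith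
  qed (simp add: m_def)
  finally have "nsq T3M (fst (Ashift \<gamma> \<mu> ?z f)) \<le> e * m" .
  moreover have "snd (Ashift \<gamma> \<mu> ?z f) p = 0" for p
    unfolding snd_Ashift f_def lift_snd_def resolvent_kernel_def
    using denom_nonzero[of "fst p" "snd p"] by (simp add: field_simps)
  ultimately have "nsqH (Ashift \<gamma> \<mu> ?z f) \<le> e * m" unfolding nsqH_def by (simp add: nsq_def)
  also have "\<dots> \<le> e * nsqH f" using nf e by (intro mult_left_mono) auto
  finally show "\<exists>f. inH f \<and> 0 < nsqH f \<and> nsqH (Ashift \<gamma> \<mu> ?z f) \<le> e * nsqH f"
    using fH nf B(3) unfolding m_def[symmetric] by (intro exI[of _ f]) simp
qed

section \<open>Rearrangement of the Friedrichs integral\<close>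

definition reflect :: "3 \<Rightarrow> real \<Rightarrow> real^3 \<Rightarrow> real^3" where
  "reflect i b t = (\<chi> j. if j = i then b - t $ j else t $ j)"

lemma reflect_measurable [measurable]: "reflect i b \<in> borel_measurable borel"
  unfolding reflect_def
proof (intro borel_measurable_continuous_onI continuous_on_vec_lambda)
  fix j show "continuous_on UNIV (\<lambda>t :: real^3. if j = i then b - t $ j else t $ j)"
    by (cases "j = i") (simp_all add: continuous_on_component continuous_on_diff)
qed

lemma Basis_vec_range: "(Basis :: (real^3) set) = range (\<lambda>j. axis j 1)"
  unfolding Basis_vec_def by auto

lemma inj_axis_1: "inj (\<lambda>j. axis j 1 :: real^3)"
  by (auto simp: inj_def axis_eq_axis)

text \<open>The reflection is affine with diagonal linear part of entries 1 and -1, hence has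
  Jacobian of modulus 1.\<close>

lemma nn_integral_reflect:
  assumes [measurable]: "f \<in> borel_measurable borel"
  shows "(\<integral>\<^sup>+t. f (reflect i b t) \<partial>lborel) = (\<integral>\<^sup>+t. f t \<partial>lborel)"
proof -
  define c where "c e = (if e = axis i (1::real) then -1 else 1 :: real)" for e :: "real^3"
  have T: "axis i b + (\<Sum>j\<in>Basis. (c j * (x \<bullet> j)) *\<^sub>R j) = reflect i b x" for x
  proof -
    have c: "c (axis j 1) = (if j = i then -1 else 1)" for j
      unfolding c_def by (simp add: axis_eq_axis)
    have sum: "(\<Sum>j\<in>Basis. (c j * (x \<bullet> j)) *\<^sub>R j) = (\<Sum>j\<in>UNIV. ((if j = i then -1 else 1) * x $ j) *\<^sub>R axis j 1)"
      unfolding Basis_vec_range by (subst sum.reindex[OF inj_axis_1]) (simp add: c inner_axis)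
    show ?thesis
    proof (rule vec_eq_iff[THEN iffD2], rule allI)
      fix m
      have "(\<Sum>j\<in>UNIV. ((if j = i then -1 else 1) * x $ j) *\<^sub>R axis j 1) $ m
          = (\<Sum>j\<in>UNIV. if j = m then (if j = i then -1 else 1) * x $ j else 0)"
        unfolding sum_component by (intro sum.cong) (auto simp: axis_def)
      also have "\<dots> = (if m = i then -1 else 1) * x $ m" by simp
      finally show "(axis i b + (\<Sum>j\<in>Basis. (c j * (x \<bullet> j)) *\<^sub>R j)) $ m = reflect i b x $ m"
        unfolding sum by (simp add: reflect_def axis_def)
    qed
  qed
  have "lborel = density (distr lborel borel (\<lambda>x. axis i b + (\<Sum>j\<in>Basis. (c j * (x \<bullet> j)) *\<^sub>R j))) (\<lambda>_. (\<Prod>j\<in>Basis. \<bar>c j\<bar>))"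
    by (rule lborel_affine_euclidean) (simp add: c_def)
  also have "(\<Prod>j\<in>Basis. \<bar>c j\<bar>) = 1" by (intro prod.neutral) (simp add: c_def)
  finally have "lborel = distr lborel borel (reflect i b)" by (simp add: T density_1)
  then have "(\<integral>\<^sup>+t. f t \<partial>lborel) = (\<integral>\<^sup>+t. f t \<partial>distr lborel borel (reflect i b))" by simp
  also have "\<dots> = (\<integral>\<^sup>+t. f (reflect i b t) \<partial>lborel)" by (rule nn_integral_distr) auto
  finally show ?thesis by simp
qed

section \<open>Integrability of the singularity at zero momentum\<close>

lemma AE_component_nonzero: "AE t in lborel. (t :: real^3) $ i \<noteq> 0"
proof -
  have "axis i (1::real) \<in> Basis" by (simp add: Basis_vec_range)
  then have "negligible {t :: real^3. t \<bullet> axis i 1 = 0}" by (rule negligible_standard_hyperplane)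
  then have "{t :: real^3. t $ i = 0} \<in> null_sets lebesgue"
    by (simp add: inner_axis negligible_iff_null_sets)
  then have "AE t in lebesgue. (t :: real^3) \<notin> {t. t $ i = 0}" by (rule AE_not_in)
  then show ?thesis unfolding AE_completion_iff by simp
qed

text \<open>\<open>1 - cos (x / 2) = 2 * (sin y)\<^sup>2\<close> with
  \<open>y = \<bar>x\<bar> / 4 \<le> pi / 3\<close>; up to there cosine is at least 1/2, so
  \<open>sin y \<ge> y / 2\<close>.\<close>

lemma one_minus_cos_ge:
  fixes x :: real assumes "\<bar>x\<bar> \<le> pi" shows "x\<^sup>2 / 32 \<le> 1 - cos (x / 2)"
proof -
  define y where "y = \<bar>x\<bar> / 4"
  have y: "0 \<le> y" "y \<le> pi / 3" using assms by (auto simp: y_def)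
  have "y / 2 \<le> sin y"
  proof (cases "y = 0")
    case False
    then have "0 < y" using y by simp
    then obtain \<xi> where \<xi>: "0 < \<xi>" "\<xi> < y" "sin y - sin 0 = (y - 0) * cos \<xi>"
      using MVT2[of 0 y sin cos] by (auto intro: DERIV_sin)
    have "cos (pi / 3) \<le> cos \<xi>" using \<xi> y by (intro cos_monotone_0_pi_le) auto
    then have "y * (1/2) \<le> y * cos \<xi>" using y by (intro mult_left_mono) (auto simp: cos_60)
    then show ?thesis using \<xi>(3) by simp
  qed simp
  then have "(y / 2)\<^sup>2 \<le> (sin y)\<^sup>2" using y by (intro power_mono) auto
  moreover have "cos (x / 2) = cos (2 * y)" unfolding y_def by (cases "0 \<le> x") (auto simp: cos_minus[symmetric, of "x/2"] simp del: cos_minus)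
  then have "1 - cos (x / 2) = 2 * (sin y)\<^sup>2" by (simp add: cos_double_sin)
  ultimately show ?thesis by (simp add: y_def power_divide)
qed

lemma w2_zero_ge:
  assumes "t \<in> cbox (\<chi> i. - pi) (\<chi> i. pi)" shows "(\<Sum>i\<in>UNIV. (t $ i)\<^sup>2) / 32 \<le> w2 0 t"
proof -
  have "\<bar>t $ i\<bar> \<le> pi" for i using assms by (auto simp: mem_box_cart abs_le_iff minus_le_iff)
  then have "(\<Sum>i\<in>UNIV. (t $ i)\<^sup>2 / 32) \<le> eps ((1/2) *\<^sub>R t)"
    unfolding eps_def using one_minus_cos_ge by (intro sum_mono) auto
  then show ?thesis using eps_bounds(1)[of t] unfolding w2_def
    by (simp add: eps_def sum_divide_distrib)
qed

lemma nn_integral_abs_powr_finite: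
  "(\<integral>\<^sup>+x. ennreal (\<bar>x\<bar> powr (- 2/3)) * indicator {- pi..pi} x \<partial>lborel) < \<infinity>"
proof -
  have hi: "((\<lambda>x. x powr (- 2/3)) has_integral (pi powr (- 2/3 + 1) / (- 2/3 + 1))) {0..pi}"
    by (rule has_integral_powr_from_0) auto
  have fin: "(\<integral>\<^sup>+x. ennreal (x powr (- 2/3)) * indicator {0..pi} x \<partial>lborel) < \<infinity>"
  proof -
    have "(\<integral>\<^sup>+x. ennreal (x powr (- 2/3)) * indicator {0..pi} x \<partial>lborel)
        = (\<integral>\<^sup>+x. ennreal (indicator {0..pi} x * x powr (- 2/3)) \<partial>lborel)"
      by (intro nn_integral_cong) (auto simp: indicator_def)
    also have "\<dots> = ennreal (pi powr (- 2/3 + 1) / (- 2/3 + 1))"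
      by (rule nn_integral_has_integral_lebesgue[OF _ hi]) simp
    also have "\<dots> < \<infinity>" by simp
    finally show ?thesis .
  qed
  have neg: "(\<integral>\<^sup>+x. ennreal (\<bar>x\<bar> powr (- 2/3)) * indicator {- pi..0} x \<partial>lborel)
      = (\<integral>\<^sup>+x. ennreal (x powr (- 2/3)) * indicator {0..pi} x \<partial>lborel)"
    by (subst nn_integral_real_affine[where c = "-1" and t = 0])
      (auto intro!: nn_integral_cong simp: indicator_def)
  have "(\<integral>\<^sup>+x. ennreal (\<bar>x\<bar> powr (- 2/3)) * indicator {- pi..pi} x \<partial>lborel)
      \<le> (\<integral>\<^sup>+x. ennreal (x powr (- 2/3)) * indicator {0..pi} x + ennreal (\<bar>x\<bar> powr (- 2/3)) * indicator {- pi..0} x \<partial>lborel)"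
    by (intro nn_integral_mono) (auto simp: indicator_def)
  also have "\<dots> = (\<integral>\<^sup>+x. ennreal (x powr (- 2/3)) * indicator {0..pi} x \<partial>lborel)
      + (\<integral>\<^sup>+x. ennreal (\<bar>x\<bar> powr (- 2/3)) * indicator {- pi..0} x \<partial>lborel)"
    by (rule nn_integral_add) auto
  also have "\<dots> < \<infinity>" using fin unfolding neg infinity_ennreal_def ennreal_add_less_top by simp
  finally show ?thesis .
qed

text \<open>Each of the three factors \<open>S powr (- 1/3)\<close> of \<open>1 / S\<close> is
  bounded through one coordinate. The exponent -2/3 exceeds -1, so the product bound reduces
  integrability in three dimensions to one dimension.\<close>

lemma inverse_sum_squares_le:
  fixes t :: "real^3" assumes "\<And>i. t $ i \<noteq> 0"
  shows "1 / (\<Sum>i\<in>UNIV. (t $ i)\<^sup>2) \<le> (\<Prod>i\<in>UNIV. \<bar>t $ i\<bar> powr (- 2/3))"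
proof -
  define S where "S = (\<Sum>i\<in>UNIV. (t $ i)\<^sup>2)"
  have le: "(t $ i)\<^sup>2 \<le> S" for i unfolding S_def by (rule member_le_sum) auto
  have S: "0 < S" using le[of 1] assms[of 1] zero_less_power2[of "t $ 1"] by linarith
  have "S powr (- 1/3) \<le> \<bar>t $ i\<bar> powr (- 2/3)" for i
  proof -
    have "S powr (- 1/3) \<le> ((t $ i)\<^sup>2) powr (- 1/3)"
      using le[of i] assms[of i] by (intro powr_mono2') auto
    also have "(t $ i)\<^sup>2 = \<bar>t $ i\<bar> powr 2" using assms[of i] by (simp add: powr_numeral)
    finally show ?thesis unfolding powr_powr by simp
  qed
  then have "(\<Prod>i\<in>(UNIV::3 set). S powr (- 1/3)) \<le> (\<Prod>i\<in>UNIV. \<bar>t $ i\<bar> powr (- 2/3))"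
    by (intro prod_mono) auto
  moreover have "(\<Prod>i\<in>(UNIV::3 set). S powr (- 1/3)) = 1 / S"
  proof -
    have "(S powr (- 1/3)) ^ 3 = S powr (real 3 * (- 1/3))" by (rule powr_power) (use S in simp)
    also have "\<dots> = 1 / S" using S by (simp add: powr_neg_one)
    finally show ?thesis by simp
  qed
  ultimately show ?thesis unfolding S_def by simp
qed

lemma nn_integral_I00_finite: "(\<integral>\<^sup>+t. ennreal (1 / w2 0 t) \<partial>T3M) < \<infinity>"
proof -
  let ?C = "cbox (\<chi> i. - pi) (\<chi> i. pi) :: (real^3) set"
  define f where "f x = ennreal (\<bar>x\<bar> powr (- 2/3)) * indicator {- pi..pi} x" for x :: real
  have fm: "f \<in> borel_measurable borel" unfolding f_def by measurable
  have m: "(\<lambda>t. ennreal (1 / w2 0 t)) \<in> borel_measurable borel" by measurable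
  have "(\<integral>\<^sup>+t. ennreal (1 / w2 0 t) * indicator ?C t \<partial>lborel) \<le> (\<integral>\<^sup>+t. 32 * (\<Prod>b\<in>Basis. f ((t :: real^3) \<bullet> b)) \<partial>lborel)"
  proof (rule nn_integral_mono_AE)
    have "AE t in lborel. \<forall>i. (t :: real^3) $ i \<noteq> 0"
      using AE_component_nonzero by (simp add: AE_all_countable)
    then show "AE t in lborel. ennreal (1 / w2 0 t) * indicator ?C t \<le> 32 * (\<Prod>b\<in>Basis. f (t \<bullet> b))"
    proof eventually_elim
      case (elim t)
      have prod: "(\<Prod>b\<in>Basis. f (t \<bullet> b)) = (\<Prod>i\<in>UNIV. f (t $ i))"
        unfolding Basis_vec_range by (subst prod.reindex[OF inj_axis_1]) (simp add: inner_axis)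
      show ?case
      proof (cases "t \<in> ?C")
        case True
        have S: "0 < (\<Sum>i\<in>UNIV. (t $ i)\<^sup>2)" using elim by (intro sum_pos) auto
        have "1 / w2 0 t \<le> 1 / ((\<Sum>i\<in>UNIV. (t $ i)\<^sup>2) / 32)"
          using w2_zero_ge[OF True] S by (intro divide_left_mono mult_pos_pos) auto
        also have "\<dots> = 32 * (1 / (\<Sum>i\<in>UNIV. (t $ i)\<^sup>2))" by simp
        also have "\<dots> \<le> 32 * (\<Prod>i\<in>UNIV. \<bar>t $ i\<bar> powr (- 2/3))"
          using elim by (intro mult_left_mono inverse_sum_squares_le) auto
        finally have le: "1 / w2 0 t \<le> 32 * (\<Prod>i\<in>UNIV. \<bar>t $ i\<bar> powr (- 2/3))" .
        have "ennreal (1 / w2 0 t) \<le> 32 * (\<Prod>i\<in>UNIV. ennreal (\<bar>t $ i\<bar> powr (- 2/3)))"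
        proof -
          from le have "ennreal (1 / w2 0 t) \<le> ennreal (32 * (\<Prod>i\<in>UNIV. \<bar>t $ i\<bar> powr (- 2/3)))"
            by (rule ennreal_leI)
          then show ?thesis by (simp add: prod_ennreal ennreal_mult')
        qed
        also have "(\<Prod>i\<in>UNIV. ennreal (\<bar>t $ i\<bar> powr (- 2/3))) = (\<Prod>i\<in>UNIV. f (t $ i))"
          using True by (intro prod.cong) (auto simp: f_def mem_box_cart)
        finally show ?thesis using True prod by simp
      qed simp
    qed
  qed
  also have "\<dots> = 32 * (\<integral>\<^sup>+t. (\<Prod>b\<in>Basis. f ((t :: real^3) \<bullet> b)) \<partial>lborel)"
  proof (rule nn_integral_cmult)
    show "(\<lambda>t :: real^3. \<Prod>b\<in>Basis. f (t \<bullet> b)) \<in> borel_measurable lborel"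
      by (intro borel_measurable_prod_ennreal measurable_compose[OF _ fm]) simp
  qed
  also have "(\<integral>\<^sup>+t. (\<Prod>b\<in>Basis. f ((t :: real^3) \<bullet> b)) \<partial>lborel) = (\<Prod>b\<in>(Basis :: (real^3) set). (\<integral>\<^sup>+x. f x \<partial>lborel))"
    by (rule nn_integral_lborel_prod) (auto simp: fm)
  also have "32 * \<dots> < \<infinity>"
    using nn_integral_abs_powr_finite unfolding f_def[symmetric]
    by (simp add: ennreal_mult_less_top power_less_top_ennreal)
  finally show ?thesis unfolding nn_integral_T3M[OF m] by (simp add: ennreal_mult_less_top)
qed

section \<open>Monotonicity in the momentum\<close>

abbreviation cube :: "(real^3) set" where "cube \<equiv> cbox (\<chi> i. - pi) (\<chi> i. pi)"

lemma mem_cube: "t \<in> cube \<longleftrightarrow> (\<forall>i. \<bar>t $ i\<bar> \<le> pi)"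
  by (auto simp: mem_box_cart abs_le_iff minus_le_iff)

lemma cos_mono_abs:
  assumes "\<bar>x\<bar> \<le> \<bar>y\<bar>" "\<bar>y\<bar> \<le> pi" shows "cos y \<le> cos (x :: real)"
proof -
  have "cos \<bar>y\<bar> \<le> cos \<bar>x\<bar>" using assms by (intro cos_monotone_0_pi_le) auto
  then show ?thesis by (simp add: abs_if split: if_splits)
qed

text \<open>\<open>1 / (a + b)\<close> has positive mixed derivative, so pairing the smaller
  summands with each other gives the larger total.\<close>

lemma inverse_supermodular:
  fixes a b a' b' :: real
  assumes "a \<le> a'" "b' \<le> b" "0 < a + b'"
  shows "1 / (a + b) + 1 / (a' + b') \<le> 1 / (a + b') + 1 / (a' + b)"
proof -
  have pos: "0 < a + b" "0 < a' + b'" "0 < a' + b" using assms by auto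
  have "1 / (a + b') - 1 / (a' + b') = (a' - a) / ((a + b') * (a' + b'))"
    using pos assms by (simp add: field_simps)
  moreover have "1 / (a + b) - 1 / (a' + b) = (a' - a) / ((a + b) * (a' + b))"
    using pos by (simp add: field_simps)
  moreover have "(a' - a) / ((a + b) * (a' + b)) \<le> (a' - a) / ((a + b') * (a' + b'))"
    using pos assms by (intro divide_left_mono mult_mono) auto
  ultimately show ?thesis by linarith
qed

text \<open>Two-point rearrangement: the reflection \<open>t \<mapsto> - (x + x') - t\<close> interchanges the centres
  \<open>-x\<close> and \<open>-x'\<close> of the two cosine wells.\<close>

lemma two_point_rearrangement:
  fixes r x x' t :: real
  assumes r: "0 < r" and x: "\<bar>x'\<bar> \<le> \<bar>x\<bar>" "\<bar>x\<bar> \<le> pi"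
  defines "\<phi> \<equiv> \<lambda>x t. if \<bar>t\<bar> \<le> pi then 1 / (r + (1 - cos t) + (1 - cos ((x + t) / 2))) else 0"
  shows "\<phi> x t + \<phi> x (- (x + x') - t) \<le> \<phi> x' t + \<phi> x' (- (x + x') - t)"
proof -
  \<comment> \<open>It is enough to treat the point of the reflected pair that lies nearer to
    \<open>-x'\<close> than to \<open>-x\<close>; the reflection exchanges the two cases.\<close>
  have main: "\<phi> x t + \<phi> x (- (x + x') - t) \<le> \<phi> x' t + \<phi> x' (- (x + x') - t)"
    if le: "\<bar>x' + t\<bar> \<le> \<bar>x + t\<bar>" for t
  proof (cases "x = x'")
    case False
    define s where "s = - (x + x') - t"
    define A where "A t = 1 - cos t" for t :: real
    define B where "B t = 1 - cos (t / 2)" for t :: real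
    have nn: "0 \<le> A u" "0 \<le> B u" for u by (simp_all add: A_def B_def)
    have \<phi>: "\<phi> y u = (if \<bar>u\<bar> \<le> pi then 1 / (r + A u + B (y + u)) else 0)" for y u
      by (simp add: \<phi>_def A_def B_def)
    have Bs: "B (x + s) = B (x' + t)" "B (x' + s) = B (x + t)"
    proof -
      have "(x + s) / 2 = - ((x' + t) / 2)" "(x' + s) / 2 = - ((x + t) / 2)" by (simp_all add: s_def field_simps)
      then show "B (x + s) = B (x' + t)" "B (x' + s) = B (x + t)" unfolding B_def by (simp_all only: cos_minus)
    qed
    \<comment> \<open>The product of the two nonnegative quantities is
      \<open>(x - x')\<^sup>2 * (s\<^sup>2 - t\<^sup>2)\<close>, so the point \<open>t\<close>
      nearer to \<open>-x'\<close> also has the smaller modulus.\<close>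
    have 1: "0 \<le> (x - x') * (x + x' + 2 * t)"
      using power_mono[OF le, of 2] by (simp add: power2_eq_square algebra_simps)
    have 2: "0 \<le> (x - x') * (x + x')"
      using power_mono[OF x(1), of 2] by (simp add: power2_eq_square algebra_simps)
    have "0 \<le> ((x - x') * (x + x' + 2 * t)) * ((x - x') * (x + x'))" using 1 2 by (rule mult_nonneg_nonneg)
    then have "0 \<le> (x - x')\<^sup>2 * ((x + x') * (x + x' + 2 * t))" by (simp add: power2_eq_square mult_ac)
    then have "0 \<le> (x + x') * (x + x' + 2 * t)" using False by (simp add: zero_le_mult_iff)
    then have "t\<^sup>2 \<le> s\<^sup>2" by (simp add: s_def power2_eq_square algebra_simps)
    then have ts: "\<bar>t\<bar> \<le> \<bar>s\<bar>" by (simp add: abs_le_square_iff)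
    have Bm: "B (x' + t) \<le> B (x + t)" if "\<bar>t\<bar> \<le> pi"
      unfolding B_def using le x that by (simp, intro cos_mono_abs) auto
    \<comment> \<open>The reflection does not preserve the interval from \<open>-pi\<close> to
      \<open>pi\<close>, but as \<open>\<bar>t\<bar> \<le> \<bar>s\<bar>\<close> the point cut off
      first is \<open>s\<close>, where the comparison goes the other way.\<close>
    consider "\<bar>s\<bar> \<le> pi" | "\<bar>t\<bar> \<le> pi" "\<bar>s\<bar> > pi" | "\<bar>t\<bar> > pi" by linarith
    then have "\<phi> x t + \<phi> x s \<le> \<phi> x' t + \<phi> x' s"
    proof cases
      case 1
      then have "A t \<le> A s" unfolding A_def using ts by (simp add: cos_mono_abs)
      then show ?thesis unfolding \<phi> Bs using 1 ts nn[of t] nn[of "x' + t"] r Bm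
        inverse_supermodular[of "r + A t" "r + A s" "B (x' + t)" "B (x + t)"] by auto
    next
      case 2
      have "1 / (r + A t + B (x + t)) \<le> 1 / (r + A t + B (x' + t))"
        using Bm[OF 2(1)] nn[of t] nn[of "x' + t"] nn[of "x + t"] r by (intro divide_left_mono mult_pos_pos) auto
      then show ?thesis unfolding \<phi> using 2 by auto
    next
      case 3
      then show ?thesis unfolding \<phi> using ts by auto
    qed
    then show ?thesis unfolding s_def .
  qed simp
  show ?thesis
  proof (cases "\<bar>x' + t\<bar> \<le> \<bar>x + t\<bar>")
    case False
    have "x' + (- (x + x') - t) = - (x + t)" "x + (- (x + x') - t) = - (x' + t)" by simp_all
    then have "\<bar>x' + (- (x + x') - t)\<bar> \<le> \<bar>x + (- (x + x') - t)\<bar>" using False by simp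
    from main[OF this] show ?thesis by (simp add: add.commute)
  qed (rule main)
qed

text \<open>The Lebesgue integral is invariant under the reflection, so averaging over it turns the
  pointwise two-point inequality into one between integrals. The constant \<open>a\<close> stands
  for a frozen value of \<open>eps k' - z\<close>, so that the momentum occurs in the half-sum
  alone.\<close>

lemma nn_integral_rearrange_component:
  fixes k k' :: "real^3"
  assumes a: "0 < a" and k: "\<bar>k' $ i\<bar> \<le> \<bar>k $ i\<bar>" "\<bar>k $ i\<bar> \<le> pi" and eq: "\<And>j. j \<noteq> i \<Longrightarrow> k' $ j = k $ j"
  shows "(\<integral>\<^sup>+t. ennreal (1 / (a + eps t + eps ((1/2) *\<^sub>R (k + t)))) * indicator cube t \<partial>lborel)
     \<le> (\<integral>\<^sup>+t. ennreal (1 / (a + eps t + eps ((1/2) *\<^sub>R (k' + t)))) * indicator cube t \<partial>lborel)"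
proof -
  define F where "F k t = 1 / (a + eps t + eps ((1/2) *\<^sub>R (k + t))) * indicator cube t" for k t :: "real^3"
  have F: "(\<lambda>t. ennreal (F k t)) \<in> borel_measurable borel" for k
    unfolding F_def by measurable
  have nn: "0 \<le> F k t" for k t unfolding F_def using a eps_bounds(1)[of t] eps_bounds(1)[of "(1/2) *\<^sub>R (k + t)"]
    by (intro mult_nonneg_nonneg divide_nonneg_nonneg) auto
  define b where "b = - (k $ i + k' $ i)"
  have pw: "F k t + F k (reflect i b t) \<le> F k' t + F k' (reflect i b t)" for t
  proof (cases "\<forall>j. j \<noteq> i \<longrightarrow> \<bar>t $ j\<bar> \<le> pi")
    case True
    define r where "r = a + (\<Sum>j\<in>UNIV - {i}. 1 - cos (t $ j)) + (\<Sum>j\<in>UNIV - {i}. 1 - cos ((k $ j + t $ j) / 2))"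
    have r: "0 < r" unfolding r_def using a by (intro add_pos_nonneg sum_nonneg) auto
    have 1: "a + eps u + eps ((1/2) *\<^sub>R (l + u)) = r + (1 - cos (u $ i)) + (1 - cos ((l $ i + u $ i) / 2))"
      if "\<And>j. j \<noteq> i \<Longrightarrow> u $ j = t $ j" "\<And>j. j \<noteq> i \<Longrightarrow> l $ j = k $ j" for u l
    proof -
      have "(\<Sum>j\<in>UNIV - {i}. 1 - cos (u $ j)) = (\<Sum>j\<in>UNIV - {i}. 1 - cos (t $ j))"
        "(\<Sum>j\<in>UNIV - {i}. 1 - cos ((l $ j + u $ j) / 2)) = (\<Sum>j\<in>UNIV - {i}. 1 - cos ((k $ j + t $ j) / 2))"
        using that by (auto intro!: sum.cong)
      then show ?thesis unfolding eps_def r_def by (simp add: sum.remove[of UNIV i])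
    qed
    have 2: "u \<in> cube \<longleftrightarrow> \<bar>u $ i\<bar> \<le> pi" if "\<And>j. j \<noteq> i \<Longrightarrow> u $ j = t $ j" for u
      unfolding mem_cube using True that by metis
    have F1: "F l u = (if \<bar>u $ i\<bar> \<le> pi then 1 / (r + (1 - cos (u $ i)) + (1 - cos ((l $ i + u $ i) / 2))) else 0)"
      if "\<And>j. j \<noteq> i \<Longrightarrow> u $ j = t $ j" "\<And>j. j \<noteq> i \<Longrightarrow> l $ j = k $ j" for u l
      unfolding F_def using 1[OF that] 2[OF that(1)] by (simp add: indicator_def)
    have ri: "reflect i b t $ i = - (k $ i + k' $ i) - t $ i" by (simp add: reflect_def b_def)
    have rj: "\<And>j. j \<noteq> i \<Longrightarrow> reflect i b t $ j = t $ j" by (simp add: reflect_def)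
    show ?thesis
      using two_point_rearrangement[OF r k, of "t $ i"] F1[of t k] F1[of t k'] F1[OF rj, of k] F1[OF rj, of k'] eq
      unfolding ri by auto
  next
    case False
    then obtain j where "j \<noteq> i" "\<not> \<bar>t $ j\<bar> \<le> pi" by blast
    then have "t \<notin> cube" "reflect i b t \<notin> cube" unfolding mem_cube by (auto simp: reflect_def intro!: exI[of _ j])
    then show ?thesis by (simp add: F_def)
  qed
  have two: "2 * (\<integral>\<^sup>+t. ennreal (F l t) \<partial>lborel) = (\<integral>\<^sup>+t. ennreal (F l t) + ennreal (F l (reflect i b t)) \<partial>lborel)" for l
  proof -
    have "(\<integral>\<^sup>+t. ennreal (F l t) + ennreal (F l (reflect i b t)) \<partial>lborel)
        = (\<integral>\<^sup>+t. ennreal (F l t) \<partial>lborel) + (\<integral>\<^sup>+t. ennreal (F l (reflect i b t)) \<partial>lborel)"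
      using F[of l] measurable_compose[OF reflect_measurable F[of l]] by (intro nn_integral_add) auto
    also have "(\<integral>\<^sup>+t. ennreal (F l (reflect i b t)) \<partial>lborel) = (\<integral>\<^sup>+t. ennreal (F l t) \<partial>lborel)"
      using nn_integral_reflect[OF F[of l]] .
    finally show ?thesis by (simp add: mult_2)
  qed
  have "2 * (\<integral>\<^sup>+t. ennreal (F k t) \<partial>lborel) \<le> 2 * (\<integral>\<^sup>+t. ennreal (F k' t) \<partial>lborel)"
    unfolding two using pw nn by (intro nn_integral_mono) (simp flip: ennreal_plus)
  then have "(\<integral>\<^sup>+t. ennreal (F k t) \<partial>lborel) \<le> (\<integral>\<^sup>+t. ennreal (F k' t) \<partial>lborel)"
    by (subst (asm) ennreal_mult_le_mult_iff) auto
  moreover have "ennreal (F l t) = ennreal (1 / (a + eps t + eps ((1/2) *\<^sub>R (l + t)))) * indicator cube t" for l t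
    unfolding F_def by (simp add: indicator_def)
  ultimately show ?thesis by simp
qed

lemma nn_integral_rearrange:
  fixes k k' :: "real^3"
  assumes a: "0 < a" and k: "\<And>i. \<bar>k' $ i\<bar> \<le> \<bar>k $ i\<bar>" "\<And>i. \<bar>k $ i\<bar> \<le> pi"
  shows "(\<integral>\<^sup>+t. ennreal (1 / (a + eps t + eps ((1/2) *\<^sub>R (k + t)))) * indicator cube t \<partial>lborel)
     \<le> (\<integral>\<^sup>+t. ennreal (1 / (a + eps t + eps ((1/2) *\<^sub>R (k' + t)))) * indicator cube t \<partial>lborel)"
proof -
  define J where "J l = (\<integral>\<^sup>+t. ennreal (1 / (a + eps t + eps ((1/2) *\<^sub>R (l + t)))) * indicator cube t \<partial>lborel)" for l
  define m where "m S = (\<chi> j. if j \<in> S then k' $ j else k $ j)" for S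
  have "J k \<le> J (m S)" if "finite S" for S using that
  proof (induction S)
    case empty
    have "m {} = k" by (simp add: m_def vec_eq_iff)
    then show ?case by simp
  next
    case (insert i S)
    have "J (m S) \<le> J (m (insert i S))"
      unfolding J_def using insert k by (intro nn_integral_rearrange_component[OF a, of _ i]) (auto simp: m_def)
    then show ?case using insert by auto
  qed
  then have "J k \<le> J (m UNIV)" by simp
  moreover have "m UNIV = k'" by (simp add: m_def vec_eq_iff)
  ultimately show ?thesis unfolding J_def by simp
qed

lemma eps_mono_abs:
  assumes "\<And>i. \<bar>k' $ i\<bar> \<le> \<bar>k $ i\<bar>" "\<And>i. \<bar>k $ i\<bar> \<le> pi" shows "eps k' \<le> eps k"
  unfolding eps_def using assms by (intro sum_mono) (simp add: cos_mono_abs)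

lemma integrable_Iint_neg:
  assumes "z < 0" shows "integrable T3M (\<lambda>t. 1 / (w2 k t - z))"
proof (rule T3M.integrable_const_bound[where B = "1 / (- z)"])
  show "AE t in T3M. norm (1 / (w2 k t - z)) \<le> 1 / (- z)"
  proof (rule AE_I2)
    fix t show "norm (1 / (w2 k t - z)) \<le> 1 / (- z)"
    proof -
      have "1 / (w2 k t - z) \<le> 1 / (- z)" using w2_bounds(1)[of k t] assms by (intro frac_le) auto
      moreover have "0 \<le> 1 / (w2 k t - z)" using w2_bounds(1)[of k t] assms by simp
      ultimately show ?thesis by (simp only: real_norm_def abs_of_nonneg)
    qed
  qed
qed measurable

lemma nn_integral_Iint_neg:
  assumes "z < 0" shows "(\<integral>\<^sup>+t. ennreal (1 / (w2 k t - z)) \<partial>T3M) = ennreal (Iint k z)"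
  unfolding Iint_def
proof (rule nn_integral_eq_integral[OF integrable_Iint_neg[OF assms]], rule AE_I2)
  fix t show "0 \<le> 1 / (w2 k t - z)" using w2_bounds(1)[of k t] assms by simp
qed

lemma Iint_nonneg_neg: "z < 0 \<Longrightarrow> 0 \<le> Iint k z"
  unfolding Iint_def using w2_bounds(1)[of k]
  by (intro Bochner_Integration.integral_nonneg) (simp add: order_trans[of z 0])

text \<open>Lowering \<open>eps k\<close> to \<open>eps k'\<close> enlarges the integrand; after
  that the momentum occurs only in the half-sum and the rearrangement applies.\<close>

lemma Iint_antimono:
  assumes z: "z < 0" and k: "\<And>i. \<bar>k' $ i\<bar> \<le> \<bar>k $ i\<bar>" "\<And>i. \<bar>k $ i\<bar> \<le> pi"
  shows "Iint k z \<le> Iint k' z"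
proof -
  have m: "(\<lambda>t. ennreal (1 / (w2 k t - z))) \<in> borel_measurable borel" for k by measurable
  have a: "0 < eps k' - z" using eps_bounds(1)[of k'] z by linarith
  have "(\<integral>\<^sup>+t. ennreal (1 / (w2 k t - z)) * indicator cube t \<partial>lborel)
      \<le> (\<integral>\<^sup>+t. ennreal (1 / ((eps k' - z) + eps t + eps ((1/2) *\<^sub>R (k + t)))) * indicator cube t \<partial>lborel)"
  proof (intro nn_integral_mono mult_right_mono ennreal_leI)
    fix t
    show "1 / (w2 k t - z) \<le> 1 / ((eps k' - z) + eps t + eps ((1/2) *\<^sub>R (k + t)))"
      using a eps_mono_abs[of k' k] k eps_bounds(1)[of t] eps_bounds(1)[of "(1/2) *\<^sub>R (k + t)"]
      unfolding w2_def by (intro frac_le) auto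
  qed auto
  also have "\<dots> \<le> (\<integral>\<^sup>+t. ennreal (1 / ((eps k' - z) + eps t + eps ((1/2) *\<^sub>R (k' + t)))) * indicator cube t \<partial>lborel)"
    by (rule nn_integral_rearrange[OF a k])
  also have "\<dots> = (\<integral>\<^sup>+t. ennreal (1 / (w2 k' t - z)) * indicator cube t \<partial>lborel)"
    unfolding w2_def by (simp add: algebra_simps)
  finally have "ennreal (Iint k z) \<le> ennreal (Iint k' z)"
    unfolding nn_integral_Iint_neg[OF z, symmetric] nn_integral_T3M[OF m] by (intro mult_left_mono) auto
  then show ?thesis using Iint_nonneg_neg[OF z] by simp
qed

section \<open>Behaviour above the band and at the threshold\<close>

text \<open>Interchanges the hyperplane \<open>t $ i = 0\<close> and the two opposite faces of the
  cube, hence the minimum and the maximum of \<open>1 - cos (t $ i)\<close>.\<close>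

definition fold_comp :: "3 \<Rightarrow> real^3 \<Rightarrow> real^3" where
  "fold_comp i t = (\<chi> j. if j = i then pi - \<bar>t $ j\<bar> else t $ j)"

lemma fold_comp_measurable [measurable]: "fold_comp i \<in> borel_measurable borel"
  unfolding fold_comp_def
proof (intro borel_measurable_continuous_onI continuous_on_vec_lambda)
  fix j show "continuous_on UNIV (\<lambda>t :: real^3. if j = i then pi - \<bar>t $ j\<bar> else t $ j)"
    by (cases "j = i") (auto intro!: continuous_on_component continuous_on_diff continuous_on_rabs)
qed

text \<open>On each half of the cube the map is a reflection, composed on the negative half with a
  sign change that an even \<open>G\<close> does not see.\<close>

lemma nn_integral_fold_comp:
  assumes G: "G \<in> borel_measurable borel" and even: "\<And>t. G (reflect i 0 t) = G t"
  shows "(\<integral>\<^sup>+t. G (fold_comp i t) * indicator cube t \<partial>lborel) = (\<integral>\<^sup>+t. G t * indicator cube t \<partial>lborel)"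
proof -
  define P where "P = cube \<inter> {t. 0 \<le> t $ i}"
  define N where "N = cube \<inter> {t. t $ i \<le> 0}"
  have PN [measurable]: "P \<in> sets borel" "N \<in> sets borel"
    unfolding P_def N_def by (intro borel_closed closed_Int closed_cbox closed_Collect_le continuous_intros continuous_on_component)+
  have split: "(\<integral>\<^sup>+t. H t * indicator cube t \<partial>lborel) = (\<integral>\<^sup>+t. H t * indicator P t \<partial>lborel) + (\<integral>\<^sup>+t. H t * indicator N t \<partial>lborel)"
    if [measurable]: "H \<in> borel_measurable borel" for H :: "real^3 \<Rightarrow> ennreal"
  proof -
    have "(\<integral>\<^sup>+t. H t * indicator cube t \<partial>lborel) = (\<integral>\<^sup>+t. H t * indicator P t + H t * indicator N t \<partial>lborel)"
    proof (rule nn_integral_cong_AE)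
      show "AE t in lborel. H t * indicator cube t = H t * indicator P t + H t * indicator N t"
        using AE_component_nonzero[of i] by eventually_elim (auto simp: P_def N_def indicator_def)
    qed
    also have "\<dots> = (\<integral>\<^sup>+t. H t * indicator P t \<partial>lborel) + (\<integral>\<^sup>+t. H t * indicator N t \<partial>lborel)"
      by (rule nn_integral_add) auto
    finally show ?thesis .
  qed
  have P: "t \<in> P \<longleftrightarrow> (\<forall>j. j \<noteq> i \<longrightarrow> \<bar>t $ j\<bar> \<le> pi) \<and> 0 \<le> t $ i \<and> t $ i \<le> pi" for t
    unfolding P_def mem_Collect_eq Int_iff mem_cube by (metis abs_le_iff abs_of_nonneg)
  have N: "t \<in> N \<longleftrightarrow> (\<forall>j. j \<noteq> i \<longrightarrow> \<bar>t $ j\<bar> \<le> pi) \<and> - pi \<le> t $ i \<and> t $ i \<le> 0" for t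
    unfolding N_def mem_Collect_eq Int_iff mem_cube by (metis abs_le_iff abs_of_nonpos minus_le_iff)
  have "(\<integral>\<^sup>+t. G (fold_comp i t) * indicator P t \<partial>lborel) = (\<integral>\<^sup>+t. G (reflect i pi t) * indicator P (reflect i pi t) \<partial>lborel)"
  proof (rule nn_integral_cong)
    fix t :: "real^3"
    have "indicator P (reflect i pi t) = (indicator P t :: ennreal)" by (auto simp: indicator_def P reflect_def)
    moreover have "fold_comp i t = reflect i pi t" if "t \<in> P" using that by (auto simp: P fold_comp_def reflect_def vec_eq_iff)
    ultimately show "G (fold_comp i t) * indicator P t = G (reflect i pi t) * indicator P (reflect i pi t)"
      by (auto simp: indicator_def)
  qed
  also have "\<dots> = (\<integral>\<^sup>+t. G t * indicator P t \<partial>lborel)"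
    by (rule nn_integral_reflect) (use G in measurable)
  finally have 1: "(\<integral>\<^sup>+t. G (fold_comp i t) * indicator P t \<partial>lborel) = (\<integral>\<^sup>+t. G t * indicator P t \<partial>lborel)" .
  have "(\<integral>\<^sup>+t. G (fold_comp i t) * indicator N t \<partial>lborel) = (\<integral>\<^sup>+t. G (reflect i (- pi) t) * indicator N (reflect i (- pi) t) \<partial>lborel)"
  proof (rule nn_integral_cong)
    fix t :: "real^3"
    have "indicator N (reflect i (- pi) t) = (indicator N t :: ennreal)" by (auto simp: indicator_def N reflect_def)
    moreover have "fold_comp i t = reflect i 0 (reflect i (- pi) t)" if "t \<in> N"
      using that by (auto simp: N fold_comp_def reflect_def vec_eq_iff)
    ultimately show "G (fold_comp i t) * indicator N t = G (reflect i (- pi) t) * indicator N (reflect i (- pi) t)"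
      by (auto simp: indicator_def even)
  qed
  also have "\<dots> = (\<integral>\<^sup>+t. G t * indicator N t \<partial>lborel)"
    by (rule nn_integral_reflect) (use G in measurable)
  finally have 2: "(\<integral>\<^sup>+t. G (fold_comp i t) * indicator N t \<partial>lborel) = (\<integral>\<^sup>+t. G t * indicator N t \<partial>lborel)" .
  have m: "(\<lambda>t. G (fold_comp i t)) \<in> borel_measurable borel" using G by measurable
  show ?thesis unfolding split[OF m] split[OF G] 1 2 ..
qed

text \<open>The left-hand side is \<open>w2 0\<close> at the point with coordinates \<open>pi - \<bar>t $ i\<bar>\<close>.\<close>

lemma eighteen_minus_w2_ge:
  assumes "k \<in> cube" "t \<in> cube"
  shows "(\<Sum>i\<in>UNIV. 2 - cos (pi - \<bar>t $ i\<bar>) - cos ((pi - \<bar>t $ i\<bar>) / 2)) \<le> 18 - w2 k t"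
proof -
  have 1: "2 - cos (pi - \<bar>y\<bar>) - cos ((pi - \<bar>y\<bar>) / 2) \<le> 6 - (1 - cos x) - (1 - cos ((x + y) / 2)) - (1 - cos y)"
    if "\<bar>x\<bar> \<le> pi" "\<bar>y\<bar> \<le> pi" for x y :: real
  proof -
    \<comment> \<open>The worst \<open>x\<close> has modulus \<open>pi\<close> and the sign of
      \<open>y\<close>; there \<open>\<bar>x + y\<bar>\<close> equals
      \<open>pi + \<bar>y\<bar>\<close>, and half of it is still at most \<open>pi\<close>, where
      cosine is monotone.\<close>
    have "cos ((pi + \<bar>y\<bar>) / 2) \<le> cos ((x + y) / 2)" using that by (intro cos_mono_abs) auto
    moreover have "cos ((pi + \<bar>y\<bar>) / 2) = - sin (\<bar>y\<bar> / 2)"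
      by (simp add: add_divide_distrib cos_add)
    moreover have "cos ((pi - \<bar>y\<bar>) / 2) = sin (\<bar>y\<bar> / 2)"
      by (simp add: diff_divide_distrib cos_diff)
    moreover have "cos (pi - \<bar>y\<bar>) = - cos y" by (simp add: cos_diff abs_if)
    ultimately show ?thesis using cos_ge_minus_one[of x] by linarith
  qed
  have "(\<Sum>i\<in>UNIV. 2 - cos (pi - \<bar>t $ i\<bar>) - cos ((pi - \<bar>t $ i\<bar>) / 2))
      \<le> (\<Sum>i\<in>(UNIV::3 set). 6 - (1 - cos (k $ i)) - (1 - cos ((k $ i + t $ i) / 2)) - (1 - cos (t $ i)))"
    using assms unfolding mem_cube by (intro sum_mono 1) auto
  also have "\<dots> = 18 - w2 k t" unfolding w2_def eps_def by (simp add: sum_subtractf sum.distrib)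
  finally show ?thesis .
qed

text \<open>The top of the band is compared with the bottom at zero momentum: the folded lower bound
  for \<open>18 - w2 k t\<close> is unfolded one coordinate at a time, each step preserving the
  integral.\<close>

lemma Iint_above:
  assumes z: "18 < z" and k: "k \<in> T3"
  shows "- Iint k z \<le> Iint 0 (- (z - 18))"
proof -
  define b where "b = z - 18"
  have b: "0 < b" using z by (simp add: b_def)
  define f where "f y = 2 - cos y - cos (y / 2)" for y :: real
  have f: "0 \<le> f y" "f (- y) = f y" for y
    unfolding f_def using cos_le_one[of y] cos_le_one[of "y / 2"] by (linarith, simp)
  \<comment> \<open>\<open>S\<close> lists the folded coordinates: \<open>h UNIV\<close> is the
    lower bound for \<open>18 - w2 k t\<close> on the cube and \<open>h {}\<close> is
    \<open>w2 0\<close>.\<close>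
  define h where "h S t = (\<Sum>j\<in>UNIV. if j \<in> S then f (pi - \<bar>t $ j\<bar>) else f (t $ j))" for S and t :: "real^3"
  have h0: "0 \<le> h S t" for S t unfolding h_def using f by (intro sum_nonneg) auto
  have hm: "h S \<in> borel_measurable borel" for S
  proof (rule borel_measurable_continuous_onI)
    have "continuous_on UNIV (\<lambda>t :: real^3. if j \<in> S then f (pi - \<bar>t $ j\<bar>) else f (t $ j))" for j
      unfolding f_def by (cases "j \<in> S") (auto intro!: continuous_intros continuous_on_component continuous_on_cos)
    then show "continuous_on UNIV (h S)" unfolding h_def by (intro continuous_on_sum) auto
  qed
  define J where "J S = (\<integral>\<^sup>+t. ennreal (1 / (b + h S t)) * indicator cube t \<partial>lborel)" for S
  have "J S = J {}" if "finite S" for S using that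
  proof (induction S)
    case (insert i S)
    have 1: "h (insert i S) t = h S (fold_comp i t)" for t
      unfolding h_def fold_comp_def using insert(2) by (intro sum.cong) auto
    have 2: "h S (reflect i 0 t) = h S t" for t
      unfolding h_def reflect_def using f(2) by (intro sum.cong) auto
    have "J (insert i S) = J S" unfolding J_def 1
    proof (rule nn_integral_fold_comp)
      show "(\<lambda>t. ennreal (1 / (b + h S t))) \<in> borel_measurable borel" using hm[of S] by measurable
    qed (simp add: 2)
    then show ?case using insert by simp
  qed simp
  then have J: "J UNIV = J {}" by simp
  have h_empty: "h {} t = w2 0 t" for t
    unfolding h_def f_def w2_def eps_def by (simp add: sum.distrib[symmetric] algebra_simps)
  have m: "(\<lambda>t. ennreal (1 / (z - w2 k t))) \<in> borel_measurable borel"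
    "(\<lambda>t. ennreal (1 / (w2 0 t - (- b)))) \<in> borel_measurable borel" by measurable
  have pos: "0 < z - w2 k t" for t using w2_bounds(2)[of k t] z by linarith
  have int: "integrable T3M (\<lambda>t. 1 / (z - w2 k t))"
  proof (rule T3M.integrable_const_bound[where B = "1 / b"])
    show "AE t in T3M. norm (1 / (z - w2 k t)) \<le> 1 / b"
    proof (rule AE_I2)
      fix t
      have "1 / (z - w2 k t) \<le> 1 / b" using w2_bounds(2)[of k t] b unfolding b_def by (intro frac_le) auto
      then show "norm (1 / (z - w2 k t)) \<le> 1 / b" using pos[of t] by simp
    qed
  qed measurable
  have "ennreal (- Iint k z) = (\<integral>\<^sup>+t. ennreal (1 / (z - w2 k t)) \<partial>T3M)"
  proof -
    have "- Iint k z = (\<integral>t. 1 / (z - w2 k t) \<partial>T3M)"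
      unfolding Iint_def Bochner_Integration.integral_minus[symmetric]
      by (intro Bochner_Integration.integral_cong refl) (metis minus_diff_eq minus_divide_right)
    then show ?thesis using pos by (simp add: nn_integral_eq_integral[OF int] less_imp_le)
  qed
  also have "\<dots> = ennreal (1 / (2 * pi)^3) * (\<integral>\<^sup>+t. ennreal (1 / (z - w2 k t)) * indicator cube t \<partial>lborel)"
    by (rule nn_integral_T3M[OF m(1)])
  also have "\<dots> \<le> ennreal (1 / (2 * pi)^3) * J UNIV"
    unfolding J_def
  proof (intro mult_left_mono nn_integral_mono)
    fix t
    show "ennreal (1 / (z - w2 k t)) * indicator cube t \<le> ennreal (1 / (b + h UNIV t)) * indicator cube t"
    proof (cases "t \<in> cube")
      case True
      have "h UNIV t \<le> 18 - w2 k t"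
        using eighteen_minus_w2_ge[OF _ True, of k] k T3_subset_cbox unfolding h_def f_def by auto
      then have "1 / (z - w2 k t) \<le> 1 / (b + h UNIV t)"
        using b h0[of UNIV t] unfolding b_def by (intro frac_le) auto
      then show ?thesis using True by (simp add: ennreal_leI)
    qed simp
  qed simp
  also have "ennreal (1 / (2 * pi)^3) * J UNIV = (\<integral>\<^sup>+t. ennreal (1 / (w2 0 t - (- b))) \<partial>T3M)"
  proof -
    have "J {} = (\<integral>\<^sup>+t. ennreal (1 / (w2 0 t - (- b))) * indicator cube t \<partial>lborel)"
      unfolding J_def h_empty by (simp add: add.commute)
    then show ?thesis unfolding J nn_integral_T3M[OF m(2)] by simp
  qed
  also have "\<dots> = ennreal (Iint 0 (- b))" by (rule nn_integral_Iint_neg) (use b in simp)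
  finally have "ennreal (- Iint k z) \<le> ennreal (Iint 0 (- b))" .
  then show ?thesis using Iint_nonneg_neg[of "- b" 0] b unfolding b_def by simp
qed

section \<open>The threshold \<open>z = 0\<close>\<close>

lemma w2_pos:
  assumes "t \<in> T3" "t \<noteq> 0" shows "0 < w2 k t"
proof -
  obtain i where i: "t $ i \<noteq> 0" using assms(2) by (auto simp: vec_eq_iff)
  have "\<bar>t $ i\<bar> \<le> pi" using assms(1) T3_subset_cbox mem_cube by blast
  then have "cos \<bar>t $ i\<bar> < cos 0" using i by (intro cos_monotone_0_pi) auto
  then have "0 < 1 - cos (t $ i)" by (simp add: abs_if split: if_splits)
  then have "0 < eps t" unfolding eps_def by (intro sum_pos2[of _ i]) auto
  then show ?thesis using eps_bounds(1)[of k] eps_bounds(1)[of "(1/2) *\<^sub>R (k + t)"] unfolding w2_def by linarith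
qed

lemma zero_in_T3: "0 \<in> T3" by (simp add: T3_def)

lemma AE_w2_pos: "AE t in T3M. 0 < w2 k t"
proof -
  have "emeasure lborel ({0} \<inter> cube) \<le> emeasure lborel {0 :: real^3}" by (intro emeasure_mono) auto
  then have "emeasure T3M ({0} \<inter> T3) = 0" by (subst emeasure_T3M) auto
  moreover have "{0} \<inter> T3 \<in> sets T3M" unfolding sets_T3M by (simp add: sets_restrict_space_iff)
  ultimately have "AE t in T3M. t \<notin> {0} \<inter> T3" by (intro AE_not_in) (auto simp: null_sets_def)
  then show ?thesis using AE_space by eventually_elim (auto intro: w2_pos)
qed

lemma integrable_I00: "integrable T3M (\<lambda>t. 1 / w2 0 t)"
proof (rule integrableI_nonneg)
  show "AE t in T3M. 0 \<le> 1 / w2 0 t" using w2_bounds(1) by (intro AE_I2) simp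
qed (use nn_integral_I00_finite in \<open>simp_all add: borel_measurable_divide\<close>)

lemma Iint_le_of_integrable:
  assumes "integrable T3M (\<lambda>t. 1 / w2 k t)" "z < 0" shows "Iint k z \<le> Iint k 0"
  unfolding Iint_def
proof (rule integral_mono_AE[OF integrable_Iint_neg[OF assms(2)]])
  show "integrable T3M (\<lambda>t. 1 / (w2 k t - 0))" using assms(1) by simp
  show "AE t in T3M. 1 / (w2 k t - z) \<le> 1 / (w2 k t - 0)"
    using AE_w2_pos[of k] by eventually_elim (use assms(2) in \<open>auto intro!: divide_left_mono mult_pos_pos\<close>)
qed

lemma Iint_le_I00:
  assumes "k \<in> T3" "z < 0" shows "Iint k z \<le> Iint 0 0"
proof -
  have "\<bar>k $ i\<bar> \<le> pi" for i using assms(1) T3_subset_cbox mem_cube by blast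
  then have "Iint k z \<le> Iint 0 z" by (intro Iint_antimono assms(2)) auto
  also have "\<dots> \<le> Iint 0 0" by (rule Iint_le_of_integrable[OF integrable_I00 assms(2)])
  finally show ?thesis .
qed

lemma inverse_shift_tendsto:
  assumes "0 < w" shows "(\<lambda>n. 1 / (w - (- 1 / real (Suc n)))) \<longlonglongrightarrow> 1 / w"
proof -
  have "(\<lambda>n. - 1 * (1 / real (Suc n))) \<longlonglongrightarrow> - 1 * 0"
    by (intro tendsto_mult tendsto_const LIMSEQ_Suc[OF lim_1_over_n])
  then have "(\<lambda>n. 1 / (w - (- 1 / real (Suc n)))) \<longlonglongrightarrow> 1 / (w - 0)"
    using assms by (intro tendsto_divide tendsto_diff tendsto_const) auto
  then show ?thesis by simp
qed

text \<open>Fatou's lemma along \<open>z = - 1 / (n + 1)\<close>. The bound \<open>Iint 0 0\<close>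
  is uniform in \<open>z\<close> and \<open>k\<close>, so finiteness at every momentum follows from
  finiteness at zero momentum.\<close>

lemma integrable_Ik0:
  assumes "k \<in> T3" shows "integrable T3M (\<lambda>t. 1 / w2 k t)"
proof (rule integrableI_nonneg)
  have "(\<integral>\<^sup>+t. ennreal (1 / w2 k t) \<partial>T3M) \<le> (\<integral>\<^sup>+t. liminf (\<lambda>n. ennreal (1 / (w2 k t - (- 1 / real (Suc n))))) \<partial>T3M)"
  proof (rule nn_integral_mono_AE)
    show "AE t in T3M. ennreal (1 / w2 k t) \<le> liminf (\<lambda>n. ennreal (1 / (w2 k t - (- 1 / real (Suc n)))))"
      using AE_w2_pos[of k]
    proof eventually_elim
      fix t assume "0 < w2 k t"
      then have "(\<lambda>n. ennreal (1 / (w2 k t - (- 1 / real (Suc n))))) \<longlonglongrightarrow> ennreal (1 / w2 k t)"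
        by (intro tendsto_ennrealI inverse_shift_tendsto)
      then show "ennreal (1 / w2 k t) \<le> liminf (\<lambda>n. ennreal (1 / (w2 k t - (- 1 / real (Suc n)))))"
        using lim_imp_Liminf[OF sequentially_bot] by force
    qed
  qed
  also have "\<dots> \<le> liminf (\<lambda>n. \<integral>\<^sup>+t. ennreal (1 / (w2 k t - (- 1 / real (Suc n)))) \<partial>T3M)"
    by (rule nn_integral_liminf) measurable
  also have "\<dots> \<le> liminf (\<lambda>n. ennreal (Iint 0 0))"
  proof (rule Liminf_mono, rule always_eventually, rule allI)
    fix n
    have n: "- 1 / real (Suc n) < 0" by simp
    show "(\<integral>\<^sup>+t. ennreal (1 / (w2 k t - (- 1 / real (Suc n)))) \<partial>T3M) \<le> ennreal (Iint 0 0)"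
      unfolding nn_integral_Iint_neg[OF n] by (intro ennreal_leI Iint_le_I00 assms n)
  qed
  also have "\<dots> = ennreal (Iint 0 0)" by (rule Liminf_const) simp
  also have "\<dots> < \<infinity>" by simp
  finally show "(\<integral>\<^sup>+t. ennreal (1 / w2 k t) \<partial>T3M) < \<infinity>" .
  show "AE t in T3M. 0 \<le> 1 / w2 k t" using w2_bounds(1) by (intro AE_I2) simp
qed measurable

lemma Iint_le_at_zero: "k \<in> T3 \<Longrightarrow> z < 0 \<Longrightarrow> Iint k z \<le> Iint k 0"
  by (intro Iint_le_of_integrable integrable_Ik0)

lemma Iint_at_zero_nonneg: "0 \<le> Iint k 0"
  unfolding Iint_def using w2_bounds(1)[of k] by (intro Bochner_Integration.integral_nonneg) simp

lemma I00_pos: "0 < Iint 0 0"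
proof -
  have "(\<integral>t. 1 / 18 \<partial>T3M) \<le> (\<integral>t. 1 / (w2 0 t - 0) \<partial>T3M)"
  proof (rule integral_mono_AE)
    show "integrable T3M (\<lambda>t. 1 / (w2 0 t - 0))" using integrable_I00 by simp
    show "AE t in T3M. 1 / 18 \<le> 1 / (w2 0 t - 0)"
      using AE_w2_pos[of 0] by eventually_elim (use w2_bounds(2) in \<open>auto intro!: divide_left_mono\<close>)
  qed simp
  then show ?thesis unfolding Iint_def[symmetric] using T3M.prob_space[unfolded space_T3M] by simp
qed

text \<open>Dominated by the integrable \<open>1 / w2 0 t\<close>. It supplies a negative
  \<open>z\<close> close to 0 at which a negative threshold value of \<open>Delta\<close> at zero
  momentum persists.\<close>

lemma Iint_tendsto_I00: "(\<lambda>n. Iint 0 (- 1 / real (Suc n))) \<longlonglongrightarrow> Iint 0 0"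
  unfolding Iint_def
proof (rule integral_dominated_convergence[where w = "\<lambda>t. 1 / w2 0 t"])
  show "AE t in T3M. (\<lambda>n. 1 / (w2 0 t - (- 1 / real (Suc n)))) \<longlonglongrightarrow> 1 / (w2 0 t - 0)"
    using AE_w2_pos[of 0] by eventually_elim (simp only: diff_zero inverse_shift_tendsto)
  fix n
  have n: "- 1 / real (Suc n) < 0" by simp
  show "AE t in T3M. norm (1 / (w2 0 t - (- 1 / real (Suc n)))) \<le> 1 / w2 0 t"
    using AE_w2_pos[of 0]
  proof eventually_elim
    fix t assume w: "0 < w2 0 t"
    have "1 / (w2 0 t - (- 1 / real (Suc n))) \<le> 1 / w2 0 t" using w n by (intro divide_left_mono mult_pos_pos) linarith+
    moreover have "0 \<le> 1 / (w2 0 t - (- 1 / real (Suc n)))" using w n by (intro divide_nonneg_pos) linarith+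
    ultimately show "norm (1 / (w2 0 t - (- 1 / real (Suc n)))) \<le> 1 / w2 0 t" by (simp only: real_norm_def abs_of_nonneg)
  qed
qed (use integrable_I00 in measurable)

section \<open>The essential spectrum\<close>

text \<open>\<open>T3\<close> is closed at \<open>pi\<close>, so this point of maximal
  \<open>eps\<close> belongs to it.\<close>

definition corner :: "real^3" where "corner = (\<chi> i. pi)"

lemma corner_T3: "corner \<in> T3"
  using pi_gt_zero by (simp add: corner_def T3_def less_trans[of "- pi" 0 pi])

lemma eps_zero: "eps 0 = 0" and eps_corner: "eps corner = 6"
  by (simp_all add: eps_def corner_def)

lemma T3_abs_le: "k \<in> T3 \<Longrightarrow> \<bar>k $ i\<bar> \<le> pi"
  using T3_subset_cbox mem_cube by blast

section \<open>Zeros of \<open>Delta\<close> below the band\<close>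

lemma Delta_bounds:
  assumes "k \<in> T3" "z < 0"
  shows "Delta \<gamma> \<mu> 0 z \<le> Delta \<gamma> \<mu> k z" "Delta \<gamma> \<mu> k z \<le> Delta \<gamma> \<mu> corner z"
proof -
  have "Iint k z \<le> Iint 0 z" using T3_abs_le[OF assms(1)] by (intro Iint_antimono assms(2)) auto
  then have "\<mu>\<^sup>2 / 2 * Iint k z \<le> \<mu>\<^sup>2 / 2 * Iint 0 z" by (intro mult_left_mono) auto
  then show "Delta \<gamma> \<mu> 0 z \<le> Delta \<gamma> \<mu> k z"
    unfolding Delta_def w1_def using eps_zero eps_bounds(1)[of k] by linarith
  have "Iint corner z \<le> Iint k z" using T3_abs_le[OF assms(1)] by (intro Iint_antimono assms(2)) (auto simp: corner_def)
  then have "\<mu>\<^sup>2 / 2 * Iint corner z \<le> \<mu>\<^sup>2 / 2 * Iint k z" by (intro mult_left_mono) auto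
  then show "Delta \<gamma> \<mu> k z \<le> Delta \<gamma> \<mu> corner z"
    unfolding Delta_def w1_def using eps_corner eps_bounds(2)[of k] by linarith
qed

text \<open>Strictness comes from \<open>eps corner = 6\<close> against \<open>eps 0 = 0\<close>. It
  keeps the negative branch from degenerating to isolated points.\<close>

lemma Delta_zero_less_corner:
  assumes "z < 0" shows "Delta \<gamma> \<mu> 0 z < Delta \<gamma> \<mu> corner z"
proof -
  have "Iint corner z \<le> Iint 0 z" by (intro Iint_antimono assms) (auto simp: corner_def)
  then have "\<mu>\<^sup>2 / 2 * Iint corner z \<le> \<mu>\<^sup>2 / 2 * Iint 0 z" by (intro mult_left_mono) auto
  then show ?thesis unfolding Delta_def w1_def using eps_zero eps_corner by linarith
qed

lemma Iint_mono_z: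
  assumes "z \<le> z'" "z' < 0" shows "Iint k z \<le> Iint k z'"
  unfolding Iint_def
proof (rule integral_mono[OF integrable_Iint_neg integrable_Iint_neg])
  show "1 / (w2 k t - z) \<le> 1 / (w2 k t - z')" for t
    using w2_bounds(1)[of k t] assms by (intro frac_le) auto
qed (use assms in auto)

lemma Delta_strict_antimono:
  assumes "z < z'" "z' < 0" shows "Delta \<gamma> \<mu> k z' < Delta \<gamma> \<mu> k z"
proof -
  have "\<mu>\<^sup>2 / 2 * Iint k z \<le> \<mu>\<^sup>2 / 2 * Iint k z'" using assms by (intro mult_left_mono Iint_mono_z) auto
  then show ?thesis unfolding Delta_def using assms by linarith
qed

lemma Delta_isCont:
  assumes "z < 0" shows "isCont (Delta \<gamma> \<mu> k) z"
proof -
  define b where "b = z / 2"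
  have b: "b < 0" "z < b" using assms by (auto simp: b_def)
  have "(1 / b\<^sup>2)-lipschitz_on {..b} (Iint k)"
  proof (rule lipschitz_onI)
    fix x y assume "x \<in> {..b}" "y \<in> {..b}"
    then have xy: "x \<le> b" "y \<le> b" "x < 0" "y < 0" using b by auto
    have pw: "\<bar>1 / (w2 k t - x) - 1 / (w2 k t - y)\<bar> \<le> 1 / b\<^sup>2 * \<bar>x - y\<bar>" for t
    proof -
      have w: "- b \<le> w2 k t - x" "- b \<le> w2 k t - y" using w2_bounds(1)[of k t] xy by auto
      then have pos: "0 < w2 k t - x" "0 < w2 k t - y" using b by auto
      have "1 / (w2 k t - x) - 1 / (w2 k t - y) = (x - y) / ((w2 k t - x) * (w2 k t - y))"
        using pos by (simp add: field_simps)
      then have "\<bar>1 / (w2 k t - x) - 1 / (w2 k t - y)\<bar> = \<bar>x - y\<bar> / ((w2 k t - x) * (w2 k t - y))"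
        using pos by (simp add: abs_mult)
      also have "\<dots> \<le> \<bar>x - y\<bar> / ((- b) * (- b))"
        using w b pos by (intro divide_left_mono mult_mono mult_pos_pos) auto
      finally show ?thesis by (simp add: power2_eq_square)
    qed
    have "Iint k x - Iint k y = (\<integral>t. 1 / (w2 k t - x) - 1 / (w2 k t - y) \<partial>T3M)"
      unfolding Iint_def
      by (rule Bochner_Integration.integral_diff[OF integrable_Iint_neg[OF xy(3)] integrable_Iint_neg[OF xy(4)], symmetric])
    also have "\<bar>\<dots>\<bar> \<le> (\<integral>t. \<bar>1 / (w2 k t - x) - 1 / (w2 k t - y)\<bar> \<partial>T3M)"
      by (rule integral_abs_bound)
    also have "\<dots> \<le> (\<integral>t. 1 / b\<^sup>2 * \<bar>x - y\<bar> \<partial>T3M)"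
      by (intro integral_mono integrable_abs Bochner_Integration.integrable_diff integrable_Iint_neg xy pw) simp
    also have "\<dots> = 1 / b\<^sup>2 * \<bar>x - y\<bar>" using T3M.prob_space[unfolded space_T3M] by simp
    finally show "dist (Iint k x) (Iint k y) \<le> 1 / b\<^sup>2 * dist x y" by (simp only: dist_real_def)
  qed simp
  then have "continuous_on {..b} (Iint k)" by (rule lipschitz_on_continuous_on)
  then have "isCont (Iint k) z" using b by (intro continuous_on_interior[of "{..b}"]) auto
  then show ?thesis unfolding Delta_def[abs_def] by (intro continuous_intros)
qed

text \<open>\<open>T3\<close> is convex, hence connected, and \<open>Delta\<close> is continuous in
  \<open>k\<close>, so every value between those at 0 and at the corner is attained.\<close>

lemma in_Lambda_iff:
  assumes "z < 0"
  shows "z \<in> Lambda \<gamma> \<mu> \<longleftrightarrow> Delta \<gamma> \<mu> 0 z \<le> 0 \<and> 0 \<le> Delta \<gamma> \<mu> corner z"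
proof
  assume "z \<in> Lambda \<gamma> \<mu>"
  then obtain k where k: "k \<in> T3" "Delta \<gamma> \<mu> k z = 0" unfolding Lambda_def disc_fiber_def by auto
  then show "Delta \<gamma> \<mu> 0 z \<le> 0 \<and> 0 \<le> Delta \<gamma> \<mu> corner z" using Delta_bounds[OF k(1) assms] by metis
next
  assume D: "Delta \<gamma> \<mu> 0 z \<le> 0 \<and> 0 \<le> Delta \<gamma> \<mu> corner z"
  interpret gap_point "complex_of_real z" "- z" by (rule gap_point_negative[OF assms])
  have conv: "convex T3"
  proof -
    have "T3 = (\<Inter>i. {k. - pi < k $ i} \<inter> {k. k $ i \<le> pi})" by (auto simp: T3_def)
    moreover have "convex ({k :: real^3. - pi < k $ i} \<inter> {k. k $ i \<le> pi})" for i
    proof -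
      have "{k :: real^3. - pi < k $ i} = {k. axis i 1 \<bullet> k > - pi}" "{k :: real^3. k $ i \<le> pi} = {k. axis i 1 \<bullet> k \<le> pi}"
        by (simp_all add: inner_axis')
      then show ?thesis by (simp add: convex_Int convex_halfspace_gt convex_halfspace_le)
    qed
    then have "convex (\<Inter>i. {k :: real^3. - pi < k $ i} \<inter> {k. k $ i \<le> pi})" by (rule convex_INT)
    ultimately show ?thesis by (simp only:)
  qed
  have "continuous_on UNIV (\<lambda>k. Re (DeltaC \<gamma> \<mu> (complex_of_real z) k))"
    by (intro continuous_on_Re DeltaC_continuous)
  then have "continuous_on T3 (\<lambda>k. Delta \<gamma> \<mu> k z)"
    unfolding DeltaC_of_real by (auto intro: continuous_on_subset)
  then have "connected ((\<lambda>k. Delta \<gamma> \<mu> k z) ` T3)"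
    using convex_connected[OF conv] by (rule connected_continuous_image)
  then have "0 \<in> (\<lambda>k. Delta \<gamma> \<mu> k z) ` T3"
    using connectedD_interval[of _ "Delta \<gamma> \<mu> 0 z" "Delta \<gamma> \<mu> corner z" 0] D zero_in_T3 corner_T3 by blast
  then obtain k where k: "k \<in> T3" "Delta \<gamma> \<mu> k z = 0" by auto
  have "0 \<le> Inf (w2 k ` T3)" using zero_in_T3 w2_bounds(1) by (intro cInf_greatest) auto
  then have "z \<notin> {Inf (w2 k ` T3)..Sup (w2 k ` T3)}" using assms by auto
  then show "z \<in> Lambda \<gamma> \<mu>" unfolding Lambda_def disc_fiber_def using k by auto
qed

lemma isCont_eventually_pos:
  assumes "isCont f (z :: real)" "0 < (f z :: real)"
  obtains e where "0 < e" "\<And>y. \<bar>y - z\<bar> < e \<Longrightarrow> 0 < f y"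
proof -
  have "\<forall>\<^sub>F y in nhds z. 0 < f y"
    using assms unfolding isCont_def tendsto_at_iff_tendsto_nhds by (rule order_tendstoD)
  then show ?thesis using that unfolding eventually_nhds_metric dist_real_def by blast
qed

text \<open>The value 0 is excluded since it already belongs to the band.\<close>

definition negative_branch :: "real \<Rightarrow> real \<Rightarrow> real set" where
  "negative_branch \<gamma> \<mu> = Lambda \<gamma> \<mu> \<inter> {..<0}"

lemma mem_negative_branch:
  "z \<in> negative_branch \<gamma> \<mu> \<longleftrightarrow> z < 0 \<and> Delta \<gamma> \<mu> 0 z \<le> 0 \<and> 0 \<le> Delta \<gamma> \<mu> corner z"
  unfolding negative_branch_def using in_Lambda_iff by auto

text \<open>If \<open>Delta\<close> is negative at zero momentum there is room to the left, where
  the corner value grows. Otherwise it vanishes there, the corner value is positive, and there is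
  room to the right.\<close>

lemma negative_branch_no_isolated_point:
  assumes z: "z \<in> negative_branch \<gamma> \<mu>" and e: "0 < e"
  shows "\<exists>y. y \<noteq> z \<and> \<bar>y - z\<bar> < e \<and> y \<in> negative_branch \<gamma> \<mu>"
proof -
  have D: "z < 0" "Delta \<gamma> \<mu> 0 z \<le> 0" "0 \<le> Delta \<gamma> \<mu> corner z" using z by (auto simp: mem_negative_branch)
  show ?thesis
  proof (cases "Delta \<gamma> \<mu> 0 z = 0")
    case False
    have "isCont (\<lambda>z. - Delta \<gamma> \<mu> 0 z) z" by (intro continuous_intros Delta_isCont D)
    then obtain r where r: "0 < r" "\<And>y. \<bar>y - z\<bar> < r \<Longrightarrow> 0 < - Delta \<gamma> \<mu> 0 y"
      using isCont_eventually_pos[where f = "\<lambda>z. - Delta \<gamma> \<mu> 0 z" and z = z] False D by auto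
    define y where "y = z - min r e / 2"
    have y: "y < z" "\<bar>y - z\<bar> < r" "\<bar>y - z\<bar> < e" using r e by (auto simp: y_def)
    have "Delta \<gamma> \<mu> corner z < Delta \<gamma> \<mu> corner y" by (rule Delta_strict_antimono[OF y(1) D(1)])
    then have "y \<in> negative_branch \<gamma> \<mu>" using r(2)[OF y(2)] y(1) D by (auto simp: mem_negative_branch)
    then show ?thesis using y by (intro exI[of _ y]) auto
  next
    case True
    then have "0 < Delta \<gamma> \<mu> corner z" using Delta_zero_less_corner[OF D(1), of \<gamma> \<mu>] by simp
    then obtain r where r: "0 < r" "\<And>y. \<bar>y - z\<bar> < r \<Longrightarrow> 0 < Delta \<gamma> \<mu> corner y"
      using isCont_eventually_pos[OF Delta_isCont[OF D(1)]] by metis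
    define y where "y = z + min (min r e) (- z) / 2"
    have y: "z < y" "\<bar>y - z\<bar> < r" "\<bar>y - z\<bar> < e" "y < 0" using r e D(1) by (auto simp: y_def min_def field_simps split: if_splits)
    have "Delta \<gamma> \<mu> 0 y < Delta \<gamma> \<mu> 0 z" by (rule Delta_strict_antimono[OF y(1,4)])
    then have "y \<in> negative_branch \<gamma> \<mu>" using r(2)[OF y(2)] y D by (auto simp: mem_negative_branch)
    then show ?thesis using y by (intro exI[of _ y]) auto
  qed
qed

lemma regular_pointI:
  assumes "0 < d" "\<And>w. 0 \<le> w \<Longrightarrow> w \<le> 18 \<Longrightarrow> d \<le> \<bar>w - x\<bar>" "0 < \<delta>" "\<And>k. k \<in> T3 \<Longrightarrow> \<delta> \<le> \<bar>Delta \<gamma> \<mu> k x\<bar>"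
  shows "regular_point (complex_of_real x) d \<gamma> \<mu> \<delta>"
proof unfold_locales
  fix k s
  show "d \<le> cmod (complex_of_real (w2 k s) - complex_of_real x)"
    using assms(2)[OF w2_bounds] unfolding of_real_diff[symmetric] norm_of_real .
next
  fix k assume "k \<in> T3"
  then show "\<delta> \<le> cmod (DeltaC \<gamma> \<mu> (complex_of_real x) k)"
    unfolding DeltaC_of_real norm_of_real by (rule assms(4))
qed (use assms in auto)

text \<open>One of the two inequalities describing the branch fails strictly. By continuity it fails
  nearby, with a bound uniform in \<open>k\<close> because 0 and the corner are the extreme
  momenta.\<close>

lemma regular_negative:
  assumes "x < 0" "x \<notin> negative_branch \<gamma> \<mu>"
  shows "\<exists>e>0. \<forall>y. \<bar>y - x\<bar> < e \<longrightarrow> (\<exists>d \<delta>. regular_point (complex_of_real y) d \<gamma> \<mu> \<delta>)"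
proof -
  consider "0 < Delta \<gamma> \<mu> 0 x" | "0 < - Delta \<gamma> \<mu> corner x"
    using assms by (auto simp: mem_negative_branch)
  then show ?thesis
  proof cases
    case 1
    then obtain r where r: "0 < r" "\<And>y. \<bar>y - x\<bar> < r \<Longrightarrow> 0 < Delta \<gamma> \<mu> 0 y"
      using isCont_eventually_pos[OF Delta_isCont[OF assms(1)]] by metis
    have "regular_point (complex_of_real y) (- y) \<gamma> \<mu> (Delta \<gamma> \<mu> 0 y)" if "\<bar>y - x\<bar> < min r (- x)" for y
    proof (rule regular_pointI)
      have y: "y < 0" using that by auto
      show "0 < - y" using y by simp
      show "Delta \<gamma> \<mu> 0 y \<le> \<bar>Delta \<gamma> \<mu> k y\<bar>" if "k \<in> T3" for k
        using Delta_bounds(1)[OF that y, of \<gamma> \<mu>] by linarith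
    qed (use r that in auto)
    then show ?thesis using r(1) assms(1) by (intro exI[of _ "min r (- x)"]) auto
  next
    case 2
    have "isCont (\<lambda>z. - Delta \<gamma> \<mu> corner z) x" by (intro continuous_intros Delta_isCont assms)
    then obtain r where r: "0 < r" "\<And>y. \<bar>y - x\<bar> < r \<Longrightarrow> 0 < - Delta \<gamma> \<mu> corner y"
      using isCont_eventually_pos[where f = "\<lambda>z. - Delta \<gamma> \<mu> corner z" and z = x] 2 by blast
    have "regular_point (complex_of_real y) (- y) \<gamma> \<mu> (- Delta \<gamma> \<mu> corner y)" if "\<bar>y - x\<bar> < min r (- x)" for y
    proof (rule regular_pointI)
      have y: "y < 0" using that by auto
      show "0 < - y" using y by simp
      show "- Delta \<gamma> \<mu> corner y \<le> \<bar>Delta \<gamma> \<mu> k y\<bar>" if "k \<in> T3" for k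
        using Delta_bounds(2)[OF that y, of \<gamma> \<mu>] by linarith
      show "0 < - Delta \<gamma> \<mu> corner y" using r(2)[of y] that by simp
    qed (use that in auto)
    then show ?thesis using r(1) assms(1) by (intro exI[of _ "min r (- x)"]) auto
  qed
qed

section \<open>The critical coupling\<close>

lemma mu_sq:
  assumes "\<gamma> < 12" "\<mu> = mu_r0 \<gamma>" shows "\<mu>\<^sup>2 / 2 * Iint 0 0 = 12 - \<gamma>"
proof -
  have "\<mu>\<^sup>2 = (24 - 2 * \<gamma>) / Iint 0 0"
    unfolding assms(2) mu_r0_def power_divide using assms(1) I00_pos by simp
  then show ?thesis using I00_pos by simp
qed

lemma Delta_above_neg:
  assumes "\<gamma> < 12" "\<mu> = mu_r0 \<gamma>" "18 < z" "k \<in> T3"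
  shows "Delta \<gamma> \<mu> k z \<le> 18 - z"
proof -
  have "- Iint k z \<le> Iint 0 (- (z - 18))" by (rule Iint_above[OF assms(3,4)])
  also have "\<dots> \<le> Iint 0 0" using assms(3) by (intro Iint_le_I00 zero_in_T3) simp
  finally have "\<mu>\<^sup>2 / 2 * (- Iint k z) \<le> \<mu>\<^sup>2 / 2 * Iint 0 0" by (intro mult_left_mono) auto
  then show ?thesis unfolding mu_sq[OF assms(1,2)] Delta_def w1_def using eps_bounds(2)[of k] by simp
qed

lemma not_disc_if_not_isolated:
  assumes "\<And>e. 0 < e \<Longrightarrow> \<exists>y. y \<noteq> x \<and> \<bar>y - x\<bar> < e \<and> complex_of_real y \<in> spectrum_A \<gamma> \<mu>"
  shows "complex_of_real x \<notin> disc_spectrum_A \<gamma> \<mu>"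
proof
  assume "complex_of_real x \<in> disc_spectrum_A \<gamma> \<mu>"
  then obtain e where e: "e > 0" "ball (complex_of_real x) e \<inter> spectrum_A \<gamma> \<mu> = {complex_of_real x}"
    unfolding disc_spectrum_A_def by blast
  obtain y where y: "y \<noteq> x" "\<bar>y - x\<bar> < e" "complex_of_real y \<in> spectrum_A \<gamma> \<mu>" using assms[OF e(1)] by blast
  have "complex_of_real y \<in> ball (complex_of_real x) e"
    using y(2) by (simp only: mem_ball dist_of_real dist_real_def abs_minus_commute)
  then show False using y e(2) by (metis IntI of_real_eq_iff singletonD)
qed

lemma negative_branch_spectrum:
  assumes "x \<in> negative_branch \<gamma> \<mu>" shows "complex_of_real x \<in> spectrum_A \<gamma> \<mu>"
proof -
  obtain k where "k \<in> T3" "Delta \<gamma> \<mu> k x = 0" "x < 0"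
    using assms unfolding negative_branch_def Lambda_def disc_fiber_def by auto
  then show ?thesis using branch_subset_spectrum by blast
qed

theorem ess_spectrum_eq:
  assumes "\<gamma> < 12" "\<mu> = mu_r0 \<gamma>"
  shows "ess_spectrum_A \<gamma> \<mu> = complex_of_real ` (negative_branch \<gamma> \<mu> \<union> {0..18})"
proof
  show "complex_of_real ` (negative_branch \<gamma> \<mu> \<union> {0..18}) \<subseteq> ess_spectrum_A \<gamma> \<mu>"
  proof
    fix w assume "w \<in> complex_of_real ` (negative_branch \<gamma> \<mu> \<union> {0..18})"
    then obtain x where x: "w = complex_of_real x" "x \<in> negative_branch \<gamma> \<mu> \<or> 0 \<le> x \<and> x \<le> 18" by auto
    have "complex_of_real x \<in> spectrum_A \<gamma> \<mu>"
      using x(2) negative_branch_spectrum band_subset_spectrum by blast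
    moreover have "complex_of_real x \<notin> disc_spectrum_A \<gamma> \<mu>"
    proof (rule not_disc_if_not_isolated)
      fix e :: real assume e: "0 < e"
      show "\<exists>y. y \<noteq> x \<and> \<bar>y - x\<bar> < e \<and> complex_of_real y \<in> spectrum_A \<gamma> \<mu>"
        using x(2)
      proof
        assume "x \<in> negative_branch \<gamma> \<mu>"
        then show ?thesis using negative_branch_no_isolated_point[OF _ e] negative_branch_spectrum by blast
      next
        assume b: "0 \<le> x \<and> x \<le> 18"
        define y where "y = (if x \<le> 9 then x + min (e / 2) 1 else x - min (e / 2) 1)"
        have "y \<noteq> x" "\<bar>y - x\<bar> < e" "0 \<le> y" "y \<le> 18" using b e by (auto simp: y_def min_def)
        then show ?thesis using band_subset_spectrum by blast
      qed
    qed
    ultimately show "w \<in> ess_spectrum_A \<gamma> \<mu>" unfolding ess_spectrum_A_def x(1) by blast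
  qed
  show "ess_spectrum_A \<gamma> \<mu> \<subseteq> complex_of_real ` (negative_branch \<gamma> \<mu> \<union> {0..18})"
  proof
    fix w assume w: "w \<in> ess_spectrum_A \<gamma> \<mu>"
    then have sp: "w \<in> spectrum_A \<gamma> \<mu>" "w \<notin> disc_spectrum_A \<gamma> \<mu>" unfolding ess_spectrum_A_def by auto
    have "Im w = 0" using nonreal_in_resolvent[of w \<gamma> \<mu>] sp(1) unfolding spectrum_A_def by auto
    then have wr: "w = complex_of_real (Re w)" by (simp add: complex_eq_iff)
    define x where "x = Re w"
    have sp': "complex_of_real x \<in> spectrum_A \<gamma> \<mu>" "complex_of_real x \<notin> disc_spectrum_A \<gamma> \<mu>"
      using sp wr unfolding x_def by auto
    have "x \<in> negative_branch \<gamma> \<mu> \<union> {0..18}"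
    proof (rule ccontr)
      assume "x \<notin> negative_branch \<gamma> \<mu> \<union> {0..18}"
      then consider "x < 0" "x \<notin> negative_branch \<gamma> \<mu>" | "18 < x" by fastforce
      then have "\<exists>e>0. \<forall>y. \<bar>y - x\<bar> < e \<longrightarrow> (\<exists>d \<delta>. regular_point (complex_of_real y) d \<gamma> \<mu> \<delta>)"
      proof cases
        case 1 then show ?thesis by (rule regular_negative)
      next
        case 2
        have "regular_point (complex_of_real y) (y - 18) \<gamma> \<mu> (y - 18)" if "\<bar>y - x\<bar> < x - 18" for y
        proof (rule regular_pointI)
          have y: "18 < y" using that by linarith
          then show "0 < y - 18" "0 < y - 18" by auto
          show "y - 18 \<le> \<bar>Delta \<gamma> \<mu> k y\<bar>" if "k \<in> T3" for k
            using Delta_above_neg[OF assms y that] by linarith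
        qed auto
        then show ?thesis using 2 by (intro exI[of _ "x - 18"]) auto
      qed
      then show False using real_regular_nbhd_disc_spectrum[of _ x \<gamma> \<mu>] sp' by blast
    qed
    then show "w \<in> complex_of_real ` (negative_branch \<gamma> \<mu> \<union> {0..18})" using wr unfolding x_def by blast
  qed
qed

text \<open>\<open>2 * \<gamma> - 12\<close> is the value at \<open>z = 0\<close>. For
  \<open>\<gamma> \<ge> 6\<close> the bound is positive for all \<open>z < 0\<close>, which empties
  the branch.\<close>

lemma Delta_zero_momentum_ge:
  assumes "\<gamma> < 12" "\<mu> = mu_r0 \<gamma>" "z < 0"
  shows "2 * \<gamma> - 12 - z \<le> Delta \<gamma> \<mu> 0 z"
proof -
  have "\<mu>\<^sup>2 / 2 * Iint 0 z \<le> \<mu>\<^sup>2 / 2 * Iint 0 0"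
    by (intro mult_left_mono Iint_le_I00 zero_in_T3 assms) auto
  then show ?thesis unfolding mu_sq[OF assms(1,2)] Delta_def w1_def eps_zero by linarith
qed

lemma exists_branch_start:
  assumes "\<gamma> < 12" "\<mu> = mu_r0 \<gamma>" "\<gamma> < 6"
  obtains e where "e < 0" "Delta \<gamma> \<mu> 0 e = 0"
proof -
  have z: "(\<lambda>n. - 1 / real (Suc n)) \<longlonglongrightarrow> 0"
    using tendsto_minus[OF LIMSEQ_Suc[OF lim_1_over_n]] by simp
  have "(\<lambda>n. Delta \<gamma> \<mu> 0 (- 1 / real (Suc n))) \<longlonglongrightarrow> w1 \<gamma> 0 - 0 - \<mu>\<^sup>2 / 2 * Iint 0 0"
    unfolding Delta_def by (intro tendsto_diff tendsto_const tendsto_mult_left Iint_tendsto_I00 z)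
  moreover have "w1 \<gamma> 0 - 0 - \<mu>\<^sup>2 / 2 * Iint 0 0 < 0"
    unfolding mu_sq[OF assms(1,2)] w1_def eps_zero using assms(3) by simp
  ultimately have "\<forall>\<^sub>F n in sequentially. Delta \<gamma> \<mu> 0 (- 1 / real (Suc n)) < 0" by (rule order_tendstoD(2))
  then obtain n where n: "Delta \<gamma> \<mu> 0 (- 1 / real (Suc n)) < 0"
    using eventually_happens'[OF sequentially_bot] by blast
  define b where "b = - 1 / real (Suc n)"
  have b: "b < 0" "Delta \<gamma> \<mu> 0 b < 0" using n unfolding b_def by simp_all
  \<comment> \<open>Far enough left that \<open>2 * \<gamma> - 12 - a \<ge> 1\<close>, so
    \<open>Delta\<close> is positive at \<open>a\<close> and changes sign before
    \<open>b\<close>.\<close>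
  define a where "a = min (b - 1) (2 * \<gamma> - 13)"
  have a: "a \<le> b" "a < 0" "a \<le> 2 * \<gamma> - 13" using b by (auto simp: a_def)
  have "0 \<le> Delta \<gamma> \<mu> 0 a" using Delta_zero_momentum_ge[OF assms(1,2) a(2)] a(3) by linarith
  moreover have "continuous_on {a..b} (Delta \<gamma> \<mu> 0)"
    using b by (intro continuous_at_imp_continuous_on ballI Delta_isCont) auto
  ultimately obtain e where "a \<le> e" "e \<le> b" "Delta \<gamma> \<mu> 0 e = 0"
    using IVT2'[of "Delta \<gamma> \<mu> 0" b 0 a] b a by auto
  then show ?thesis using b by (intro that[of e]) auto
qed

text \<open>\<open>Delta\<close> at zero momentum is strictly decreasing in \<open>z\<close>, so its
  zero is unique and marks the left end of the branch.\<close>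

lemma branch_start_eq_E1:
  assumes e: "e < 0" "Delta \<gamma> \<mu> 0 e = 0"
  shows "E1 \<gamma> \<mu> = e" "e \<in> negative_branch \<gamma> \<mu>" "\<And>z. z < 0 \<Longrightarrow> Delta \<gamma> \<mu> 0 z \<le> 0 \<longleftrightarrow> e \<le> z"
proof -
  show iff: "Delta \<gamma> \<mu> 0 z \<le> 0 \<longleftrightarrow> e \<le> z" if "z < 0" for z
    using Delta_strict_antimono[of z e \<gamma> \<mu> 0] Delta_strict_antimono[of e z \<gamma> \<mu> 0] e that by force
  show eb: "e \<in> negative_branch \<gamma> \<mu>"
    using Delta_zero_less_corner[OF e(1), of \<gamma> \<mu>] e by (auto simp: mem_negative_branch)
  show "E1 \<gamma> \<mu> = e" unfolding E1_def
  proof (rule cInf_eq_minimum)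
    show "e \<in> Lambda \<gamma> \<mu> \<inter> {..0}" using eb unfolding negative_branch_def by auto
    fix x assume x: "x \<in> Lambda \<gamma> \<mu> \<inter> {..0}"
    show "e \<le> x"
    proof (cases "x < 0")
      case True
      then show ?thesis using x in_Lambda_iff iff by blast
    qed (use e in auto)
  qed
qed

text \<open>The origin of \<open>gamma0\<close>: with \<open>r = Iint k 0 / Iint 0 0\<close> the
  threshold value is \<open>eps k + \<gamma> - (12 - \<gamma>) * r\<close>, affine in
  \<open>\<gamma>\<close> with slope \<open>1 + r\<close> and root \<open>gamma0 k\<close>.\<close>

lemma Delta_at_zero:
  assumes "\<gamma> < 12" "\<mu> = mu_r0 \<gamma>"
  shows "Delta \<gamma> \<mu> k 0 = (\<gamma> - gamma0 k) * (1 + Iint k 0 / Iint 0 0)"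
proof -
  define r where "r = Iint k 0 / Iint 0 0"
  have r: "0 < 1 + r" unfolding r_def using Iint_at_zero_nonneg[of k] I00_pos by (simp add: add_pos_nonneg)
  have "\<mu>\<^sup>2 / 2 * Iint k 0 = (\<mu>\<^sup>2 / 2 * Iint 0 0) * r" unfolding r_def using I00_pos by simp
  then have "Delta \<gamma> \<mu> k 0 = eps k + \<gamma> - (12 - \<gamma>) * r"
    unfolding mu_sq[OF assms] Delta_def w1_def by simp
  moreover have "gamma0 k * (1 + r) = 12 * r - eps k" unfolding gamma0_def r_def[symmetric] using r by simp
  ultimately show ?thesis unfolding r_def[symmetric] by (simp add: algebra_simps)
qed

theorem theorem3p1:
  fixes \<gamma> \<mu> :: real and k0 :: "real^3"
  assumes "\<gamma> < 12"
    and "\<mu> = mu_r0 \<gamma>"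
    and "k0 \<in> T3"
    and "\<forall>k\<in>T3. Delta \<gamma> \<mu> k 0 \<le> Delta \<gamma> \<mu> k0 0"
  shows "(\<gamma> < gamma0 k0 \<longrightarrow>
            ess_spectrum_A \<gamma> \<mu> = complex_of_real ` ({E1 \<gamma> \<mu> .. E2 \<gamma> \<mu>} \<union> {0..18}))
       \<and> (gamma0 k0 \<le> \<gamma> \<and> \<gamma> < 6 \<longrightarrow>
            ess_spectrum_A \<gamma> \<mu> = complex_of_real ` {E1 \<gamma> \<mu> .. 18})
       \<and> (6 \<le> \<gamma> \<longrightarrow>
            ess_spectrum_A \<gamma> \<mu> = complex_of_real ` {0..18})"
proof (intro conjI impI)
  note ess = ess_spectrum_eq[OF assms(1,2)]
  have fac: "0 < 1 + Iint k0 0 / Iint 0 0"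
    using Iint_at_zero_nonneg[of k0] I00_pos by (simp add: add_pos_nonneg)
  show "ess_spectrum_A \<gamma> \<mu> = complex_of_real ` ({E1 \<gamma> \<mu> .. E2 \<gamma> \<mu>} \<union> {0..18})" if "\<gamma> < gamma0 k0"
  proof -
    have neg: "Delta \<gamma> \<mu> k0 0 < 0"
      unfolding Delta_at_zero[OF assms(1,2)] using that fac by (intro mult_neg_pos) auto
    \<comment> \<open>In this case \<open>\<gamma> < 6\<close> is a consequence: the negative
      maximum over \<open>k\<close> at \<open>z = 0\<close> dominates the value
      \<open>2 * \<gamma> - 12\<close> at zero momentum.\<close>
    have D0: "Delta \<gamma> \<mu> 0 0 = 2 * \<gamma> - 12"
      unfolding Delta_def mu_sq[OF assms(1,2)] w1_def eps_zero by simp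
    have "Delta \<gamma> \<mu> 0 0 < 0" using assms(4) zero_in_T3 neg by force
    then have "\<gamma> < 6" unfolding D0 by simp
    then obtain e where e: "e < 0" "Delta \<gamma> \<mu> 0 e = 0" by (rule exists_branch_start[OF assms(1,2)])
    note e1 = branch_start_eq_E1[OF e]
    \<comment> \<open>At \<open>z = 0\<close> the function \<open>Delta\<close> is negative for
      every momentum, so \<open>E2\<close> is the supremum of the negative branch itself.\<close>
    have "0 \<notin> Lambda \<gamma> \<mu>" using assms(4) neg unfolding Lambda_def disc_fiber_def by force
    then have X: "Lambda \<gamma> \<mu> \<inter> {..0} = negative_branch \<gamma> \<mu>"
      unfolding negative_branch_def by (auto simp: less_le)
    have bdd: "bdd_above (negative_branch \<gamma> \<mu>)"
      by (rule bdd_aboveI[of _ 0]) (simp add: mem_negative_branch)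
    \<comment> \<open>No gaps: if the corner value is negative at \<open>z\<close>, it is negative
      on a neighbourhood and everywhere to the right of \<open>z\<close> below 0, so the supremum
      \<open>E2\<close> would be at most \<open>z - r\<close>.\<close>
    have "z \<in> negative_branch \<gamma> \<mu>" if z: "z < 0" "e \<le> z" "z \<le> E2 \<gamma> \<mu>" for z
    proof (rule ccontr)
      assume "z \<notin> negative_branch \<gamma> \<mu>"
      then have "0 < - Delta \<gamma> \<mu> corner z" using z e1(3) by (auto simp: mem_negative_branch)
      moreover have "isCont (\<lambda>z. - Delta \<gamma> \<mu> corner z) z" by (intro continuous_intros Delta_isCont z)
      ultimately obtain r where r: "0 < r" "\<And>y. \<bar>y - z\<bar> < r \<Longrightarrow> 0 < - Delta \<gamma> \<mu> corner y"
        using isCont_eventually_pos[where f = "\<lambda>z. - Delta \<gamma> \<mu> corner z" and z = z] by blast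
      have "E2 \<gamma> \<mu> \<le> z - r" unfolding E2_def X
      proof (rule cSup_least)
        show "negative_branch \<gamma> \<mu> \<noteq> {}" using e1(2) by blast
        fix y assume y: "y \<in> negative_branch \<gamma> \<mu>"
        show "y \<le> z - r"
        proof (rule ccontr)
          assume "\<not> y \<le> z - r"
          then consider "\<bar>y - z\<bar> < r" | "z < y" by linarith
          then show False
          proof cases
            case 1
            then show False using r(2)[of y] y by (auto simp: mem_negative_branch)
          next
            case 2
            then have "Delta \<gamma> \<mu> corner y < Delta \<gamma> \<mu> corner z"
              using y by (intro Delta_strict_antimono) (auto simp: mem_negative_branch)
            then show False using r(2)[of z] r(1) y by (auto simp: mem_negative_branch)
          qed
        qed
      qed
      then show False using z(3) r(1) by linarith
    qed
    moreover have "e \<le> z \<and> z \<le> E2 \<gamma> \<mu>" if "z \<in> negative_branch \<gamma> \<mu>" for z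
      using that e1(3)[of z] cSup_upper[OF that bdd] unfolding E2_def X by (auto simp: mem_negative_branch)
    \<comment> \<open>The value \<open>E2 = 0\<close> would do no harm, since 0 lies in the
      band.\<close>
    moreover have "E2 \<gamma> \<mu> \<le> 0" unfolding E2_def X
      using e1(2) by (intro cSup_least) (auto simp: mem_negative_branch)
    ultimately have "negative_branch \<gamma> \<mu> \<union> {0..18} = {E1 \<gamma> \<mu> .. E2 \<gamma> \<mu>} \<union> {0..18}"
      unfolding e1(1) by (auto simp: set_eq_iff) (metis less_le order_trans not_le)+
    then show ?thesis using ess by simp
  qed
  show "ess_spectrum_A \<gamma> \<mu> = complex_of_real ` {E1 \<gamma> \<mu> .. 18}" if "gamma0 k0 \<le> \<gamma> \<and> \<gamma> < 6"
  proof -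
    have "\<gamma> < 6" using that by blast
    then obtain e where e: "e < 0" "Delta \<gamma> \<mu> 0 e = 0" by (rule exists_branch_start[OF assms(1,2)])
    note e1 = branch_start_eq_E1[OF e]
    \<comment> \<open>\<open>k0\<close> is extremal at \<open>z = 0\<close> only. Its nonnegative
      value there carries over to \<open>z < 0\<close>, as \<open>Delta\<close> decreases in
      \<open>z\<close>, and then bounds the corner value from below.\<close>
    have nn: "0 \<le> Delta \<gamma> \<mu> k0 0" unfolding Delta_at_zero[OF assms(1,2)] using that fac by simp
    have "0 \<le> Delta \<gamma> \<mu> corner z" if z: "z < 0" for z
    proof -
      have "\<mu>\<^sup>2 / 2 * Iint k0 z \<le> \<mu>\<^sup>2 / 2 * Iint k0 0" by (intro mult_left_mono Iint_le_at_zero assms(3) z) auto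
      then have "Delta \<gamma> \<mu> k0 0 \<le> Delta \<gamma> \<mu> k0 z" unfolding Delta_def using z by linarith
      then show ?thesis using nn Delta_bounds(2)[OF assms(3) z, of \<gamma> \<mu>] by linarith
    qed
    then have "negative_branch \<gamma> \<mu> \<union> {0..18} = {e..18}"
      using e(1) e1(3) by (auto simp: mem_negative_branch)
    then show ?thesis using ess e1(1) by simp
  qed
  show "ess_spectrum_A \<gamma> \<mu> = complex_of_real ` {0..18}" if "6 \<le> \<gamma>"
  proof -
    have "negative_branch \<gamma> \<mu> = {}"
      using Delta_zero_momentum_ge[OF assms(1,2)] that by (force simp: mem_negative_branch)
    then show ?thesis using ess by simp
  qed
qed

end
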